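(* Let $\mathcal{C}$ be a $2$-Calabi-Yau triangulated category which has a functorially finite maximal rigid subcategory. (1) The category $\mathcal{C}$ has a maximal rigid object if and only if all functorially finite maximal rigid subcategories of $\mathcal{C}$ have a finite number of pairwise non-isomorphic indecomposable objects. (2) All maximal rigid objects of $\mathcal{C}$ have the same number of indecomposable direct summands (up to isomorphism).
   Context: Let $k$ be an algebraically closed field. $\mathcal{C}$ is a $k$-linear triangulated category with shift functor $[1]$, which is Hom-finite and Krull-Remak-Schmidt. Put $\mathrm{Ext}^n(X,Y)=\mathrm{Hom}(X,Y[n])$. $\mathcal{C}$ is called $2$-Calabi-Yau ($2$-CY) if there are bifunctorial isomorphisms $\mathrm{Ext}^1(X,Y)\cong D\,\mathrm{Ext}^1(Y,X)$ for $X,Y\in\mathcal{C}$, where $D=\mathrm{Hom}_k(-,k)$. Subcategories are full and closed under isomorphism. A morphism $f:T\to X$ with $T\in\mathcal{T}$ is a right $\mathcal{T}$-approximation of $X$ if every morphism from an object of $\mathcal{T}$ to $X$ factors through $f$; $\mathcal{T}$ is contravariantly finite if every object of $\mathcal{C}$ has a right $\mathcal{T}$-approximation. Left approximations and covariantly finite subcategories are defined dually; $\mathcal{T}$ is functorially finite if it is both. Let $\mathcal{T}$ be a subcategory closed under direct summands and finite direct sums. $\mathcal{T}$ is rigid if $\mathrm{Ext}^1(T,T')=0$ for all $T,T'\in\mathcal{T}$; it is maximal rigid if it is rigid and, whenever $\mathrm{Ext}^1(\mathcal{T}\cup\mathrm{add}\,M,\mathcal{T}\cup\mathrm{add}\,M)=0$,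 one has $M\in\mathcal{T}$ (here $\mathrm{add}\,M$ is the subcategory of direct summands of finite direct sums of copies of $M$). An object $T$ is maximal rigid if $\mathrm{add}\,T$ is a maximal rigid subcategory. The number of indecomposable direct summands of an object is counted up to isomorphism. *)

theory Defs
  imports "HOL-Algebra.Algebra"
begin

text \<open>Frees the letter \<open>X\<close>, which \<^theory>\<open>HOL-Algebra.Polynomials\<close> reserves for the indeterminate.\<close>

no_notation var (\<open>X\<index>\<close>)

section \<open>Vector spaces\<close>

text \<open>A vector space over a field \<open>K\<close> is a module in the sense of theory \<^theory>\<open>HOL-Algebra.Module\<close>;
  the multiplication and unit that its record inherits from rings carry no meaning.\<close>

definition linear_map ::
    "('k, 'r) ring_scheme \<Rightarrow> ('k, 'a, 's) module_scheme \<Rightarrow> ('k, 'b, 't) module_scheme \<Rightarrow> ('a \<Rightarrow> 'b) \<Rightarrow> bool"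
  where "linear_map K M N f \<longleftrightarrow>
     f \<in> carrier M \<rightarrow> carrier N \<and>
     (\<forall>x\<in>carrier M. \<forall>y\<in>carrier M. f (x \<oplus>\<^bsub>M\<^esub> y) = f x \<oplus>\<^bsub>N\<^esub> f y) \<and>
     (\<forall>c\<in>carrier K. \<forall>x\<in>carrier M. f (c \<odot>\<^bsub>M\<^esub> x) = c \<odot>\<^bsub>N\<^esub> f x)"

definition linear_iso ::
    "('k, 'r) ring_scheme \<Rightarrow> ('k, 'a, 's) module_scheme \<Rightarrow> ('k, 'b, 't) module_scheme \<Rightarrow> ('a \<Rightarrow> 'b) \<Rightarrow> bool"
  where "linear_iso K M N f \<longleftrightarrow> linear_map K M N f \<and> bij_betw f (carrier M) (carrier N)"

definition finite_dim :: "('k, 'r) ring_scheme \<Rightarrow> ('k, 'a, 's) module_scheme \<Rightarrow> bool"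
  where "finite_dim K M \<longleftrightarrow>
     (\<exists>S. finite S \<and> S \<subseteq> carrier M \<and>
        (\<forall>x\<in>carrier M. \<exists>c. c \<in> S \<rightarrow> carrier K \<and> x = (\<Oplus>\<^bsub>M\<^esub>s\<in>S. c s \<odot>\<^bsub>M\<^esub> s)))"

text \<open>The dual space \<open>Hom\<^sub>K(M, K)\<close> with pointwise operations.  Linear forms are extensional
  functions, so that equality of forms is equality on the carrier of \<open>M\<close>.\<close>

definition dual_space ::
    "('k, 'r) ring_scheme \<Rightarrow> ('k, 'a, 's) module_scheme \<Rightarrow> ('k, 'a \<Rightarrow> 'k) module"
  where "dual_space K M =
     \<lparr> carrier = {\<phi> \<in> carrier M \<rightarrow>\<^sub>E carrier K.
          (\<forall>x\<in>carrier M. \<forall>y\<in>carrier M. \<phi> (x \<oplus>\<^bsub>M\<^esub> y) = \<phi> x \<oplus>\<^bsub>K\<^esub> \<phi> y) \<and>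
          (\<forall>c\<in>carrier K. \<forall>x\<in>carrier M. \<phi> (c \<odot>\<^bsub>M\<^esub> x) = c \<otimes>\<^bsub>K\<^esub> \<phi> x)},
       monoid.mult = undefined, monoid.one = undefined,
       ring.zero = (\<lambda>x\<in>carrier M. \<zero>\<^bsub>K\<^esub>),
       ring.add = (\<lambda>\<phi> \<psi>. \<lambda>x\<in>carrier M. \<phi> x \<oplus>\<^bsub>K\<^esub> \<psi> x),
       Module.module.smult = (\<lambda>c \<phi>. \<lambda>x\<in>carrier M. c \<otimes>\<^bsub>K\<^esub> \<phi> x) \<rparr>"


section \<open>Linear categories\<close>

text \<open>Every operation takes its source and target objects as arguments, so the carriers of
  different Hom-spaces need not be disjoint.  The composite \<open>g \<circ> f\<close> of \<open>f : X \<rightarrow> Y\<close>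
  and \<open>g : Y \<rightarrow> Z\<close> is \<open>cmp C X Y Z g f\<close>.\<close>

record ('o, 'm, 'k) lin_cat =
  obj :: "'o set"
  Hom :: "'o \<Rightarrow> 'o \<Rightarrow> ('k, 'm) module"
  ident :: "'o \<Rightarrow> 'm"
  cmp :: "'o \<Rightarrow> 'o \<Rightarrow> 'o \<Rightarrow> 'm \<Rightarrow> 'm \<Rightarrow> 'm"

definition mor :: "('o, 'm, 'k, 'z) lin_cat_scheme \<Rightarrow> 'o \<Rightarrow> 'o \<Rightarrow> 'm set"
  where "mor C X Y = carrier (Hom C X Y)"

definition iso_mor :: "('o, 'm, 'k, 'z) lin_cat_scheme \<Rightarrow> 'o \<Rightarrow> 'o \<Rightarrow> 'm \<Rightarrow> bool"
  where "iso_mor C X Y f \<longleftrightarrow> f \<in> mor C X Y \<and>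
     (\<exists>g\<in>mor C Y X. cmp C X Y X g f = ident C X \<and> cmp C Y X Y f g = ident C Y)"

definition isomorphic :: "('o, 'm, 'k, 'z) lin_cat_scheme \<Rightarrow> 'o \<Rightarrow> 'o \<Rightarrow> bool"
  where "isomorphic C X Y \<longleftrightarrow> X \<in> obj C \<and> Y \<in> obj C \<and> (\<exists>f. iso_mor C X Y f)"

definition iso_rel :: "('o, 'm, 'k, 'z) lin_cat_scheme \<Rightarrow> ('o \<times> 'o) set"
  where "iso_rel C = {(X, Y). isomorphic C X Y}"

text \<open>\<open>X\<close> is a direct sum (biproduct) of the finite list of objects \<open>Ys\<close>.\<close>

definition is_direct_sum :: "('o, 'm, 'k, 'z) lin_cat_scheme \<Rightarrow> 'o \<Rightarrow> 'o list \<Rightarrow> bool"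
  where "is_direct_sum C X Ys \<longleftrightarrow> X \<in> obj C \<and> set Ys \<subseteq> obj C \<and>
     (\<exists>\<iota> \<pi>. (\<forall>j<length Ys. \<iota> j \<in> mor C (Ys ! j) X \<and> \<pi> j \<in> mor C X (Ys ! j)) \<and>
        (\<forall>j<length Ys. \<forall>l<length Ys.
           cmp C (Ys ! l) X (Ys ! j) (\<pi> j) (\<iota> l) =
             (if j = l then ident C (Ys ! j) else \<zero>\<^bsub>Hom C (Ys ! l) (Ys ! j)\<^esub>)) \<and>
        (\<Oplus>\<^bsub>Hom C X X\<^esub>j\<in>{..<length Ys}. cmp C X (Ys ! j) X (\<iota> j) (\<pi> j)) = ident C X)"

text \<open>For the empty list the condition reads \<open>0 = id\<close> in \<open>End(X)\<close>.\<close>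

definition zero_object :: "('o, 'm, 'k, 'z) lin_cat_scheme \<Rightarrow> 'o \<Rightarrow> bool"
  where "zero_object C X \<longleftrightarrow> is_direct_sum C X []"

definition direct_summand :: "('o, 'm, 'k, 'z) lin_cat_scheme \<Rightarrow> 'o \<Rightarrow> 'o \<Rightarrow> bool"
  where "direct_summand C X Y \<longleftrightarrow> (\<exists>Z\<in>obj C. is_direct_sum C Y [X, Z])"

definition indecomposable :: "('o, 'm, 'k, 'z) lin_cat_scheme \<Rightarrow> 'o \<Rightarrow> bool"
  where "indecomposable C X \<longleftrightarrow> X \<in> obj C \<and> \<not> zero_object C X \<and>
     (\<forall>Y\<in>obj C. \<forall>Z\<in>obj C. is_direct_sum C X [Y, Z] \<longrightarrow> zero_object C Y \<or> zero_object C Z)"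

locale linear_category =
  fixes K :: "'k ring" and C :: "('o, 'm, 'k, 'z) lin_cat_scheme"
  assumes base_field: "field K"
    and Hom_module: "\<lbrakk>X \<in> obj C; Y \<in> obj C\<rbrakk> \<Longrightarrow> Module.module K (Hom C X Y)"
    and ident_mor: "X \<in> obj C \<Longrightarrow> ident C X \<in> mor C X X"
    and cmp_mor:
      "\<lbrakk>X \<in> obj C; Y \<in> obj C; Z \<in> obj C; f \<in> mor C X Y; g \<in> mor C Y Z\<rbrakk>
        \<Longrightarrow> cmp C X Y Z g f \<in> mor C X Z"
    and cmp_ident_right:
      "\<lbrakk>X \<in> obj C; Y \<in> obj C; f \<in> mor C X Y\<rbrakk> \<Longrightarrow> cmp C X X Y f (ident C X) = f"
    and cmp_ident_left:
      "\<lbrakk>X \<in> obj C; Y \<in> obj C; f \<in> mor C X Y\<rbrakk> \<Longrightarrow> cmp C X Y Y (ident C Y) f = f"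
    and cmp_assoc:
      "\<lbrakk>W \<in> obj C; X \<in> obj C; Y \<in> obj C; Z \<in> obj C;
        f \<in> mor C W X; g \<in> mor C X Y; h \<in> mor C Y Z\<rbrakk>
        \<Longrightarrow> cmp C W X Z (cmp C X Y Z h g) f = cmp C W Y Z h (cmp C W X Y g f)"
    and cmp_linear_left:
      "\<lbrakk>X \<in> obj C; Y \<in> obj C; Z \<in> obj C; f \<in> mor C X Y\<rbrakk>
        \<Longrightarrow> linear_map K (Hom C Y Z) (Hom C X Z) (\<lambda>g. cmp C X Y Z g f)"
    and cmp_linear_right:
      "\<lbrakk>X \<in> obj C; Y \<in> obj C; Z \<in> obj C; g \<in> mor C Y Z\<rbrakk>
        \<Longrightarrow> linear_map K (Hom C X Y) (Hom C X Z) (\<lambda>f. cmp C X Y Z g f)"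

text \<open>Finite direct sums include the empty one, i.e. a zero object.\<close>

locale additive_linear_category = linear_category +
  assumes finite_direct_sums: "set Ys \<subseteq> obj C \<Longrightarrow> \<exists>X. is_direct_sum C X Ys"

definition Hom_finite :: "'k ring \<Rightarrow> ('o, 'm, 'k, 'z) lin_cat_scheme \<Rightarrow> bool"
  where "Hom_finite K C \<longleftrightarrow> (\<forall>X\<in>obj C. \<forall>Y\<in>obj C. finite_dim K (Hom C X Y))"

text \<open>The endomorphism ring of \<open>X\<close> is local: it is nonzero and its non-units are closed
  under addition.\<close>

definition local_End :: "('o, 'm, 'k, 'z) lin_cat_scheme \<Rightarrow> 'o \<Rightarrow> bool"
  where "local_End C X \<longleftrightarrow> ident C X \<noteq> \<zero>\<^bsub>Hom C X X\<^esub> \<and>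
     (\<forall>f\<in>mor C X X. \<forall>g\<in>mor C X X.
        \<not> iso_mor C X X f \<longrightarrow> \<not> iso_mor C X X g \<longrightarrow> \<not> iso_mor C X X (f \<oplus>\<^bsub>Hom C X X\<^esub> g))"

definition Krull_Remak_Schmidt :: "('o, 'm, 'k, 'z) lin_cat_scheme \<Rightarrow> bool"
  where "Krull_Remak_Schmidt C \<longleftrightarrow>
     (\<forall>X\<in>obj C. \<exists>Ys. is_direct_sum C X Ys \<and> (\<forall>Y\<in>set Ys. local_End C Y))"


section \<open>Subcategories\<close>

text \<open>Full subcategories closed under isomorphism are given by their sets of objects.\<close>

definition additive_subcategory :: "('o, 'm, 'k, 'z) lin_cat_scheme \<Rightarrow> 'o set \<Rightarrow> bool"
  where "additive_subcategory C T \<longleftrightarrow> T \<subseteq> obj C \<and>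
     (\<forall>X Y. X \<in> T \<and> isomorphic C X Y \<longrightarrow> Y \<in> T) \<and>
     (\<forall>X Y. Y \<in> T \<and> direct_summand C X Y \<longrightarrow> X \<in> T) \<and>
     (\<forall>X Ys. set Ys \<subseteq> T \<and> is_direct_sum C X Ys \<longrightarrow> X \<in> T)"

definition add_subcat :: "('o, 'm, 'k, 'z) lin_cat_scheme \<Rightarrow> 'o \<Rightarrow> 'o set"
  where "add_subcat C M = {X. \<exists>n Y. is_direct_sum C Y (replicate n M) \<and> direct_summand C X Y}"

definition right_approximation ::
    "('o, 'm, 'k, 'z) lin_cat_scheme \<Rightarrow> 'o set \<Rightarrow> 'o \<Rightarrow> 'o \<Rightarrow> 'm \<Rightarrow> bool"
  where "right_approximation C T T0 X f \<longleftrightarrow> T0 \<in> T \<and> f \<in> mor C T0 X \<and>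
     (\<forall>T1\<in>T. \<forall>g\<in>mor C T1 X. \<exists>h\<in>mor C T1 T0. g = cmp C T1 T0 X f h)"

definition left_approximation ::
    "('o, 'm, 'k, 'z) lin_cat_scheme \<Rightarrow> 'o set \<Rightarrow> 'o \<Rightarrow> 'o \<Rightarrow> 'm \<Rightarrow> bool"
  where "left_approximation C T X T0 f \<longleftrightarrow> T0 \<in> T \<and> f \<in> mor C X T0 \<and>
     (\<forall>T1\<in>T. \<forall>g\<in>mor C X T1. \<exists>h\<in>mor C T0 T1. g = cmp C X T0 T1 h f)"

definition contravariantly_finite :: "('o, 'm, 'k, 'z) lin_cat_scheme \<Rightarrow> 'o set \<Rightarrow> bool"
  where "contravariantly_finite C T \<longleftrightarrow> (\<forall>X\<in>obj C. \<exists>T0 f. right_approximation C T T0 X f)"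

definition covariantly_finite :: "('o, 'm, 'k, 'z) lin_cat_scheme \<Rightarrow> 'o set \<Rightarrow> bool"
  where "covariantly_finite C T \<longleftrightarrow> (\<forall>X\<in>obj C. \<exists>T0 f. left_approximation C T X T0 f)"

definition functorially_finite :: "('o, 'm, 'k, 'z) lin_cat_scheme \<Rightarrow> 'o set \<Rightarrow> bool"
  where "functorially_finite C T \<longleftrightarrow> contravariantly_finite C T \<and> covariantly_finite C T"


section \<open>Triangulated categories\<close>

text \<open>\<open>shift C\<close> and \<open>shift_mor C X Y\<close> are the action of the shift functor \<open>[1]\<close> on objects
  and on \<open>Hom(X, Y)\<close>.  A tuple \<open>(X, Y, Z, u, v, w)\<close> in \<open>triangles C\<close> is a distinguished
  triangle \<open>X \<rightarrow> Y \<rightarrow> Z \<rightarrow> X[1]\<close> with morphisms \<open>u\<close>, \<open>v\<close>, \<open>w\<close>.\<close>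

record ('o, 'm, 'k) tri_cat = "('o, 'm, 'k) lin_cat" +
  shift :: "'o \<Rightarrow> 'o"
  shift_mor :: "'o \<Rightarrow> 'o \<Rightarrow> 'm \<Rightarrow> 'm"
  triangles :: "('o \<times> 'o \<times> 'o \<times> 'm \<times> 'm \<times> 'm) set"

definition Ext1 :: "('o, 'm, 'k, 'z) tri_cat_scheme \<Rightarrow> 'o \<Rightarrow> 'o \<Rightarrow> ('k, 'm) module"
  where "Ext1 C X Y = Hom C X (shift C Y)"

definition candidate_triangle ::
    "('o, 'm, 'k, 'z) tri_cat_scheme \<Rightarrow> 'o \<Rightarrow> 'o \<Rightarrow> 'o \<Rightarrow> 'm \<Rightarrow> 'm \<Rightarrow> 'm \<Rightarrow> bool"
  where "candidate_triangle C X Y Z u v w \<longleftrightarrow> X \<in> obj C \<and> Y \<in> obj C \<and> Z \<in> obj C \<and>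
     u \<in> mor C X Y \<and> v \<in> mor C Y Z \<and> w \<in> mor C Z (shift C X)"

text \<open>Commutativity of the ladder with rungs \<open>a : X \<rightarrow> X'\<close>, \<open>b : Y \<rightarrow> Y'\<close>, \<open>c : Z \<rightarrow> Z'\<close>
  and \<open>a[1]\<close>.\<close>

definition triangle_morphism ::
    "('o, 'm, 'k, 'z) tri_cat_scheme \<Rightarrow> 'o \<times> 'o \<times> 'o \<times> 'm \<times> 'm \<times> 'm
       \<Rightarrow> 'o \<times> 'o \<times> 'o \<times> 'm \<times> 'm \<times> 'm \<Rightarrow> 'm \<Rightarrow> 'm \<Rightarrow> 'm \<Rightarrow> bool"
  where "triangle_morphism C = (\<lambda>(X, Y, Z, u, v, w) (X', Y', Z', u', v', w') a b c.
     a \<in> mor C X X' \<and> b \<in> mor C Y Y' \<and> c \<in> mor C Z Z' \<and>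
     cmp C X Y Y' b u = cmp C X X' Y' u' a \<and>
     cmp C Y Z Z' c v = cmp C Y Y' Z' v' b \<and>
     cmp C Z (shift C X) (shift C X') (shift_mor C X X' a) w = cmp C Z Z' (shift C X') w' c)"

text \<open>The shift is only required to be an autoequivalence (fully faithful and essentially
  surjective); an automorphism is a special case.\<close>

locale triangulated_category = additive_linear_category K C
  for K :: "'k ring" and C :: "('o, 'm, 'k, 'z) tri_cat_scheme" +
  assumes shift_obj: "X \<in> obj C \<Longrightarrow> shift C X \<in> obj C"
    and shift_ident: "X \<in> obj C \<Longrightarrow> shift_mor C X X (ident C X) = ident C (shift C X)"
    and shift_cmp:
      "\<lbrakk>X \<in> obj C; Y \<in> obj C; Z \<in> obj C; f \<in> mor C X Y; g \<in> mor C Y Z\<rbrakk>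
        \<Longrightarrow> shift_mor C X Z (cmp C X Y Z g f) =
          cmp C (shift C X) (shift C Y) (shift C Z) (shift_mor C Y Z g) (shift_mor C X Y f)"
    and shift_fully_faithful:
      "\<lbrakk>X \<in> obj C; Y \<in> obj C\<rbrakk>
        \<Longrightarrow> linear_iso K (Hom C X Y) (Hom C (shift C X) (shift C Y)) (shift_mor C X Y)"
    and shift_ess_surj: "Y \<in> obj C \<Longrightarrow> \<exists>X\<in>obj C. isomorphic C (shift C X) Y"
    and triangles_candidate:
      "(X, Y, Z, u, v, w) \<in> triangles C \<Longrightarrow> candidate_triangle C X Y Z u v w"
    and TR1_iso:
      "\<lbrakk>(X, Y, Z, u, v, w) \<in> triangles C; candidate_triangle C X' Y' Z' u' v' w';
        triangle_morphism C (X, Y, Z, u, v, w) (X', Y', Z', u', v', w') a b c;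
        iso_mor C X X' a; iso_mor C Y Y' b; iso_mor C Z Z' c\<rbrakk>
        \<Longrightarrow> (X', Y', Z', u', v', w') \<in> triangles C"
    and TR1_ident:
      "\<lbrakk>X \<in> obj C; zero_object C Z\<rbrakk>
        \<Longrightarrow> (X, X, Z, ident C X, \<zero>\<^bsub>Hom C X Z\<^esub>, \<zero>\<^bsub>Hom C Z (shift C X)\<^esub>) \<in> triangles C"
    and TR1_cone:
      "\<lbrakk>X \<in> obj C; Y \<in> obj C; u \<in> mor C X Y\<rbrakk> \<Longrightarrow> \<exists>Z v w. (X, Y, Z, u, v, w) \<in> triangles C"
    and TR2_rotation:
      "candidate_triangle C X Y Z u v w \<Longrightarrow>
        (X, Y, Z, u, v, w) \<in> triangles C \<longleftrightarrow>
        (Y, Z, shift C X, v, w, \<ominus>\<^bsub>Hom C (shift C X) (shift C Y)\<^esub> shift_mor C X Y u) \<in> triangles C"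
    and TR3_morphism:
      "\<lbrakk>(X, Y, Z, u, v, w) \<in> triangles C; (X', Y', Z', u', v', w') \<in> triangles C;
        a \<in> mor C X X'; b \<in> mor C Y Y'; cmp C X Y Y' b u = cmp C X X' Y' u' a\<rbrakk>
        \<Longrightarrow> \<exists>c. triangle_morphism C (X, Y, Z, u, v, w) (X', Y', Z', u', v', w') a b c"
    and TR4_octahedral:
      "\<lbrakk>(X, Y, P, f, p1, d1) \<in> triangles C;
        (X, Z, Q, cmp C X Y Z g f, p2, d2) \<in> triangles C;
        (Y, Z, R, g, p3, d3) \<in> triangles C\<rbrakk>
        \<Longrightarrow> \<exists>a b.
          (P, Q, R, a, b, cmp C R (shift C Y) (shift C P) (shift_mor C Y P p1) d3) \<in> triangles C \<and>
          triangle_morphism C (X, Y, P, f, p1, d1) (X, Z, Q, cmp C X Y Z g f, p2, d2) (ident C X) g a \<and>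
          triangle_morphism C (X, Z, Q, cmp C X Y Z g f, p2, d2) (Y, Z, R, g, p3, d3) f (ident C Z) b"

text \<open>Bifunctorial isomorphisms \<open>\<Phi> X Y : Ext\<^sup>1(X, Y) \<rightarrow> D Ext\<^sup>1(Y, X)\<close>.  For \<open>f : X' \<rightarrow> X\<close>,
  \<open>g : Y \<rightarrow> Y'\<close> the induced map \<open>Ext\<^sup>1(f, g)\<close> sends \<open>x\<close> to \<open>g[1] \<circ> x \<circ> f\<close>, and its counterpart on
  the dual side sends a form \<open>\<phi>\<close> on \<open>Ext\<^sup>1(Y, X)\<close> to \<open>y \<mapsto> \<phi> (f[1] \<circ> y \<circ> g)\<close> on \<open>Ext\<^sup>1(Y', X')\<close>.\<close>

definition Ext1_map ::
    "('o, 'm, 'k, 'z) tri_cat_scheme \<Rightarrow> 'o \<Rightarrow> 'o \<Rightarrow> 'o \<Rightarrow> 'o \<Rightarrow> 'm \<Rightarrow> 'm \<Rightarrow> 'm \<Rightarrow> 'm"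
  where "Ext1_map C X' X Y Y' f g x =
     cmp C X' (shift C Y) (shift C Y') (shift_mor C Y Y' g) (cmp C X' X (shift C Y) x f)"

definition two_Calabi_Yau :: "'k ring \<Rightarrow> ('o, 'm, 'k, 'z) tri_cat_scheme \<Rightarrow> bool"
  where "two_Calabi_Yau K C \<longleftrightarrow>
     (\<exists>\<Phi>. (\<forall>X\<in>obj C. \<forall>Y\<in>obj C.
              linear_iso K (Ext1 C X Y) (dual_space K (Ext1 C Y X)) (\<Phi> X Y)) \<and>
        (\<forall>X\<in>obj C. \<forall>X'\<in>obj C. \<forall>Y\<in>obj C. \<forall>Y'\<in>obj C.
           \<forall>f\<in>mor C X' X. \<forall>g\<in>mor C Y Y'. \<forall>x\<in>carrier (Ext1 C X Y). \<forall>y\<in>carrier (Ext1 C Y' X').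
              \<Phi> X' Y' (Ext1_map C X' X Y Y' f g x) y = \<Phi> X Y x (Ext1_map C Y Y' X' X g f y)))"


section \<open>Maximal rigid subcategories and objects\<close>

definition Ext1_vanishes :: "('o, 'm, 'k, 'z) tri_cat_scheme \<Rightarrow> 'o set \<Rightarrow> 'o set \<Rightarrow> bool"
  where "Ext1_vanishes C A B \<longleftrightarrow> (\<forall>X\<in>A. \<forall>Y\<in>B. carrier (Ext1 C X Y) = {\<zero>\<^bsub>Ext1 C X Y\<^esub>})"

definition rigid :: "('o, 'm, 'k, 'z) tri_cat_scheme \<Rightarrow> 'o set \<Rightarrow> bool"
  where "rigid C T \<longleftrightarrow> additive_subcategory C T \<and> Ext1_vanishes C T T"

definition maximal_rigid :: "('o, 'm, 'k, 'z) tri_cat_scheme \<Rightarrow> 'o set \<Rightarrow> bool"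
  where "maximal_rigid C T \<longleftrightarrow> rigid C T \<and>
     (\<forall>M\<in>obj C. Ext1_vanishes C (T \<union> add_subcat C M) (T \<union> add_subcat C M) \<longrightarrow> M \<in> T)"

definition maximal_rigid_object :: "('o, 'm, 'k, 'z) tri_cat_scheme \<Rightarrow> 'o \<Rightarrow> bool"
  where "maximal_rigid_object C T \<longleftrightarrow> T \<in> obj C \<and> maximal_rigid C (add_subcat C T)"

definition indec_classes :: "('o, 'm, 'k, 'z) lin_cat_scheme \<Rightarrow> 'o set \<Rightarrow> 'o set set"
  where "indec_classes C T = {X \<in> T. indecomposable C X} // iso_rel C"

text \<open>In a Krull-Remak-Schmidt category the set counted here is always finite.\<close>

definition num_indec_summands :: "('o, 'm, 'k, 'z) lin_cat_scheme \<Rightarrow> 'o \<Rightarrow> nat"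
  where "num_indec_summands C T = card (indec_classes C {X. direct_summand C X T})"

end

theory Submission
  imports Defs "HOL-Library.Function_Algebras"
begin

text \<open>
  The proof compares two functorially finite maximal rigid subcategories \<open>R\<close> and \<open>T\<close> by means of an
  index: every object of \<open>T\<close> determines an element of the split Grothendieck group of \<open>R\<close>, the free
  abelian group on the isomorphism classes of indecomposable objects of \<open>R\<close>.  If \<open>T\<close> has finitely many
  classes of indecomposables, their indices span the rational Grothendieck group of \<open>R\<close>, so \<open>R\<close> has at
  most as many classes as \<open>T\<close> (\<open>indec_classes_card_le\<close>).  This inequality is symmetric in the roles of
  the two subcategories, and both assertions follow from it: if \<open>M\<close> is a maximal rigid object, then
  \<open>add M\<close> is functorially finite with finitely many indecomposables, and conversely a maximal rigid
  subcategory with finitely many indecomposables is \<open>add\<close> of their direct sum.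

  The index of a rigid object \<open>Y\<close> comes from a triangle \<open>B \<rightarrow> Y \<rightarrow> Q \<rightarrow> B[1]\<close> with \<open>B\<close> in \<open>R\<close> and \<open>Q\<close> in
  \<open>R[1]\<close>; it is \<open>[B] - [Q[-1]]\<close>.  Such a triangle exists because the cone of a right
  \<open>R\<close>-approximation of \<open>Y\<close> is \<open>N[1]\<close> for an object \<open>N\<close> whose \<open>Ext\<^sup>1\<close> with \<open>R\<close> and with itself
  vanishes, the \<open>2\<close>-Calabi-Yau symmetry giving both orders, so that \<open>N\<close> lies in \<open>R\<close> by maximality
  (\<open>right_approximation_resolution\<close>).  Dually an object \<open>X\<close> of \<open>R\<close> has a left \<open>T\<close>-approximation
  with cone in \<open>T\<close>, which is a triangle \<open>X \<rightarrow> T\<^sub>0 \<rightarrow> T\<^sub>1 \<rightarrow> X[1]\<close> with \<open>T\<^sub>0\<close> and \<open>T\<^sub>1\<close> in \<open>T\<close>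
  (\<open>left_approximation_cone\<close>).  Resolve \<open>T\<^sub>0\<close> and \<open>T\<^sub>1\<close> by \<open>R\<close>.  Since \<open>Ext\<^sup>1\<close> vanishes on \<open>R\<close>, there
  are no nonzero maps from objects of \<open>R[1]\<close> to objects of \<open>R[2]\<close>, so the triangles between objects
  of \<open>R[1]\<close> that the octahedral axiom produces split; the outcome is an isomorphism of direct sums of
  objects of \<open>R[1]\<close> saying that \<open>[X]\<close> is the difference of the indices of \<open>T\<^sub>0\<close> and \<open>T\<^sub>1\<close>
  (\<open>resolution_triangle\<close>).  Resolutions can be added (\<open>resolution_direct_sum\<close>), so both indices are
  combinations of those of the indecomposables of \<open>T\<close>.

  Classes in the split Grothendieck group are read off as multiplicities of indecomposables.  That
  these are well defined is the Krull--Schmidt theorem (\<open>iso_count_le\<close>), obtained here from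
  Gaussian elimination over a local ring.
\<close>

section \<open>Local rings\<close>

locale local_ring = ring R for R (structure) +
  assumes one_not_zero: "\<one> \<noteq> \<zero>"
    and nonunit_add: "\<lbrakk>x \<in> carrier R; y \<in> carrier R; x \<notin> Units R; y \<notin> Units R\<rbrakk> \<Longrightarrow> x \<oplus> y \<notin> Units R"
begin

text \<open>Since \<open>e\<close> and \<open>\<one> - e\<close> have the unit \<open>\<one>\<close> as their sum, one of them is a unit; an idempotent that
  is a unit equals \<open>\<one>\<close>.\<close>

lemma idempotent_cases:
  assumes e: "e \<in> carrier R" "e \<otimes> e = e"
  shows "e = \<zero> \<or> e = \<one>"
proof -
  have f: "\<one> \<ominus> e \<in> carrier R" using e by simp
  have "e \<oplus> (\<one> \<ominus> e) = \<one>" using e by algebra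
  then have "e \<in> Units R \<or> \<one> \<ominus> e \<in> Units R"
    using nonunit_add[OF e(1) f] Units_one_closed by metis
  then show ?thesis
  proof
    assume u: "e \<in> Units R"
    have "e \<otimes> e = e \<otimes> \<one>" using e by simp
    then show ?thesis using Units_l_cancel[OF u e(1) one_closed] by simp
  next
    assume u: "\<one> \<ominus> e \<in> Units R"
    have "(\<one> \<ominus> e) \<otimes> e = e \<ominus> e \<otimes> e" using e(1) by algebra
    then have "(\<one> \<ominus> e) \<otimes> e = (\<one> \<ominus> e) \<otimes> \<zero>" using e by (simp add: r_neg a_minus_def)
    then show ?thesis using Units_l_cancel[OF u e(1) zero_closed] by simp
  qed
qed

text \<open>This reduces to \<open>x \<otimes> y = \<one>\<close>.  There \<open>y \<otimes> x\<close> is a nonzero idempotent, hence \<open>\<one>\<close>.  The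
  lemma says that the non-units absorb products.\<close>

lemma unit_factors:
  assumes xy: "x \<in> carrier R" "y \<in> carrier R" and u: "x \<otimes> y \<in> Units R"
  shows "x \<in> Units R" "y \<in> Units R"
proof -
  have main: "x \<in> Units R \<and> y \<in> Units R"
    if xy: "x \<in> carrier R" "y \<in> carrier R" and one: "x \<otimes> y = \<one>" for x y
  proof -
    have "(y \<otimes> x) \<otimes> (y \<otimes> x) = y \<otimes> (x \<otimes> y) \<otimes> x" using xy by (simp add: m_assoc)
    then have "(y \<otimes> x) \<otimes> (y \<otimes> x) = y \<otimes> x" using one xy by simp
    then have "y \<otimes> x = \<zero> \<or> y \<otimes> x = \<one>" using idempotent_cases xy by simp
    moreover have "x \<otimes> (y \<otimes> x) \<otimes> y = \<one>"
      using xy one by (metis l_one m_assoc m_closed)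
    then have "y \<otimes> x \<noteq> \<zero>" using xy one_not_zero by auto
    ultimately show ?thesis using xy one by (auto simp: Units_def)
  qed
  let ?v = "inv (x \<otimes> y)"
  have v: "?v \<in> carrier R" using u by simp
  have "x \<otimes> (y \<otimes> ?v) = \<one>" using xy v u by (metis Units_r_inv m_assoc)
  then show "x \<in> Units R" using main xy v by blast
  have "(?v \<otimes> x) \<otimes> y = \<one>" using xy v u by (metis Units_l_inv m_assoc)
  then show "y \<in> Units R" using main xy v by blast
qed

lemma zero_nonunit: "\<zero> \<notin> Units R"
  using Units_r_inv[of \<zero>] Units_inv_closed[of \<zero>] one_not_zero l_null by metis

lemma finsum_nonunit:
  assumes "finite A" "\<And>j. j \<in> A \<Longrightarrow> f j \<in> carrier R" "\<And>j. j \<in> A \<Longrightarrow> f j \<notin> Units R"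
  shows "(\<Oplus>j\<in>A. f j) \<notin> Units R"
  using assms
proof (induction A rule: finite_induct)
  case empty then show ?case by (simp add: zero_nonunit)
next
  case (insert a A)
  then have "(\<Oplus>j\<in>insert a A. f j) = f a \<oplus> (\<Oplus>j\<in>A. f j)"
    by (subst finsum_insert) auto
  then show ?case using insert nonunit_add[of "f a" "\<Oplus>j\<in>A. f j"] by (simp add: Pi_def)
qed

text \<open>Gaussian elimination modulo the ideal of non-units: a homogeneous system with fewer equations
  than unknowns has a solution in which some unknown is a unit.\<close>

lemma homogeneous_system:
  assumes "finite L" "finite J" "card L < card J"
    and "\<And>l j. l \<in> L \<Longrightarrow> j \<in> J \<Longrightarrow> a l j \<in> carrier R"
  shows "\<exists>c. (\<forall>j\<in>J. c j \<in> carrier R) \<and> (\<exists>j\<in>J. c j \<in> Units R) \<and>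
    (\<forall>l\<in>L. (\<Oplus>j\<in>J. a l j \<otimes> c j) \<notin> Units R)"
  using assms
proof (induction L arbitrary: J a rule: finite_induct)
  case empty
  then obtain j where "j \<in> J" by (metis card_gt_0_iff card.empty ex_in_conv)
  then show ?case by (auto intro!: exI[of _ "\<lambda>_. \<one>"])
next
  case (insert l L)
  show ?case
  proof (cases "\<forall>j\<in>J. a l j \<notin> Units R")
    case True
    have "card L < card J" using insert by simp
    then obtain c where c: "\<forall>j\<in>J. c j \<in> carrier R" "\<exists>j\<in>J. c j \<in> Units R"
      "\<forall>l\<in>L. (\<Oplus>j\<in>J. a l j \<otimes> c j) \<notin> Units R"
      using insert.IH[OF insert.prems(1), of a] insert.prems(3) by blast
    have "(\<Oplus>j\<in>J. a l j \<otimes> c j) \<notin> Units R"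
    proof (rule finsum_nonunit[OF insert.prems(1)])
      fix j assume "j \<in> J"
      then have "a l j \<in> carrier R" "c j \<in> carrier R" "a l j \<notin> Units R"
        using insert.prems(3) c(1) True by blast+
      then show "a l j \<otimes> c j \<in> carrier R" "a l j \<otimes> c j \<notin> Units R"
        using unit_factors(1) by blast+
    qed
    then show ?thesis using c by auto
  next
    case False
    then obtain k where k: "k \<in> J" "a l k \<in> Units R" by auto
    define u where "u = inv (a l k)"
    have uc: "u \<in> carrier R" using k u_def by simp
    let ?J = "J - {k}"
    \<comment> \<open>The pivot \<open>a l k\<close> is a unit; \<open>b\<close> is the system after elimination of the \<open>k\<close>-th unknown.\<close>
    define b where "b m j = a m j \<ominus> a m k \<otimes> (u \<otimes> a l j)" for m j
    have ac: "\<And>m j. m \<in> insert l L \<Longrightarrow> j \<in> J \<Longrightarrow> a m j \<in> carrier R" using insert.prems(3) by auto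
    have bc: "\<And>m j. m \<in> L \<Longrightarrow> j \<in> ?J \<Longrightarrow> b m j \<in> carrier R"
      using ac k uc by (simp add: b_def)
    have "card L < card ?J" using insert k by (simp add: card_Diff_singleton)
    then obtain c where c: "\<forall>j\<in>?J. c j \<in> carrier R" "\<exists>j\<in>?J. c j \<in> Units R"
      "\<forall>m\<in>L. (\<Oplus>j\<in>?J. b m j \<otimes> c j) \<notin> Units R"
      using insert.IH[of ?J b] bc insert.prems(1) by blast
    define s where "s = (\<Oplus>j\<in>?J. a l j \<otimes> c j)"
    have sc: "s \<in> carrier R" unfolding s_def using c(1) ac by (intro finsum_closed) auto
    define d where "d j = (if j = k then \<ominus> (u \<otimes> s) else c j)" for j
    have dc: "\<forall>j\<in>J. d j \<in> carrier R" using c(1) uc sc by (auto simp: d_def)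
    have split: "(\<Oplus>j\<in>J. a m j \<otimes> d j) = \<ominus> (a m k \<otimes> (u \<otimes> s)) \<oplus> (\<Oplus>j\<in>?J. a m j \<otimes> c j)"
      if m: "m \<in> insert l L" for m
    proof -
      have "(\<Oplus>j\<in>J. a m j \<otimes> d j) = (\<Oplus>j\<in>insert k ?J. a m j \<otimes> d j)"
        using k by (simp add: insert_absorb)
      also have "\<dots> = a m k \<otimes> d k \<oplus> (\<Oplus>j\<in>?J. a m j \<otimes> d j)"
        using insert.prems(1) ac[OF m] dc k by (subst finsum_insert) auto
      also have "(\<Oplus>j\<in>?J. a m j \<otimes> d j) = (\<Oplus>j\<in>?J. a m j \<otimes> c j)"
        using ac[OF m] c(1) by (intro finsum_cong') (auto simp: d_def)
      finally show ?thesis using ac[OF m] k uc sc by (simp add: d_def r_minus)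
    qed
    have "(\<Oplus>j\<in>J. a l j \<otimes> d j) = \<zero>"
    proof -
      have "a l k \<otimes> (u \<otimes> s) = s" using ac k uc sc by (simp add: u_def flip: m_assoc)
      then show ?thesis using split[of l] sc by (simp add: s_def[symmetric] l_neg)
    qed
    moreover have "(\<Oplus>j\<in>J. a m j \<otimes> d j) \<notin> Units R" if m: "m \<in> L" for m
    proof -
      have am: "a m j \<in> carrier R" if "j \<in> J" for j using ac m that by simp
      have "(\<Oplus>j\<in>?J. b m j \<otimes> c j) = (\<Oplus>j\<in>?J. a m j \<otimes> c j \<oplus> (\<ominus> (a m k \<otimes> u)) \<otimes> (a l j \<otimes> c j))"
        using am ac[of l] c(1) uc k
        by (intro finsum_cong') (auto simp: b_def a_minus_def l_distr l_minus m_assoc)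
      also have "\<dots> = (\<Oplus>j\<in>?J. a m j \<otimes> c j) \<oplus> (\<Oplus>j\<in>?J. (\<ominus> (a m k \<otimes> u)) \<otimes> (a l j \<otimes> c j))"
        using am ac[of l] c(1) uc k by (intro finsum_addf) auto
      also have "(\<Oplus>j\<in>?J. (\<ominus> (a m k \<otimes> u)) \<otimes> (a l j \<otimes> c j)) = (\<ominus> (a m k \<otimes> u)) \<otimes> s"
        unfolding s_def using am ac[of l] c(1) uc k insert.prems(1)
        by (intro finsum_rdistr[symmetric]) auto
      also have "\<dots> = \<ominus> (a m k \<otimes> (u \<otimes> s))"
        using am k uc sc by (simp add: l_minus m_assoc)
      also have "(\<Oplus>j\<in>?J. a m j \<otimes> c j) \<oplus> \<ominus> (a m k \<otimes> (u \<otimes> s)) = (\<Oplus>j\<in>J. a m j \<otimes> d j)"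
        using split[of m] m am k uc sc c(1) by (simp add: a_comm)
      finally show ?thesis using c(3) m by metis
    qed
    moreover have "\<exists>j\<in>J. d j \<in> Units R" using c(2) by (auto simp: d_def)
    ultimately show ?thesis using dc zero_nonunit by auto
  qed
qed

end

section \<open>Linear categories\<close>

lemma linear_map_group_hom:
  assumes "module K M" "module K N" "linear_map K M N f"
  shows "group_hom (add_monoid M) (add_monoid N) f"
proof -
  interpret M: module K M by fact
  interpret N: module K N by fact
  have "f \<in> hom (add_monoid M) (add_monoid N)"
    using assms(3) unfolding linear_map_def hom_def by simp
  then show ?thesis
    unfolding group_hom_def group_hom_axioms_def using M.a_group N.a_group by blast
qed

lemma linear_map_zero:
  assumes "module K M" "module K N" "linear_map K M N f"
  shows "f \<zero>\<^bsub>M\<^esub> = \<zero>\<^bsub>N\<^esub>"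
  using group_hom.hom_one[OF linear_map_group_hom[OF assms]] by simp

lemma linear_map_minus:
  assumes "module K M" "module K N" "linear_map K M N f" "x \<in> carrier M"
  shows "f (\<ominus>\<^bsub>M\<^esub> x) = \<ominus>\<^bsub>N\<^esub> f x"
  using group_hom.hom_inv[OF linear_map_group_hom[OF assms(1-3)]] assms(4) by (simp add: a_inv_def)

lemma linear_map_finsum:
  assumes "module K M" "module K N" and f: "linear_map K M N f"
    and "finite A" "g \<in> A \<rightarrow> carrier M"
  shows "f (\<Oplus>\<^bsub>M\<^esub>j\<in>A. g j) = (\<Oplus>\<^bsub>N\<^esub>j\<in>A. f (g j))"
proof -
  interpret M: module K M by fact
  interpret N: module K N by fact
  have fc: "f x \<in> carrier N" if "x \<in> carrier M" for x using f that by (auto simp: linear_map_def)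
  have fadd: "f (x \<oplus>\<^bsub>M\<^esub> y) = f x \<oplus>\<^bsub>N\<^esub> f y" if "x \<in> carrier M" "y \<in> carrier M" for x y
    using f that by (auto simp: linear_map_def)
  show ?thesis using assms(4,5)
  proof (induction A rule: finite_induct)
    case empty then show ?case by (simp add: linear_map_zero[OF assms(1-3)])
  next
    case (insert a A)
    then have "finsum M g (insert a A) = g a \<oplus>\<^bsub>M\<^esub> finsum M g A"
      "finsum N (\<lambda>j. f (g j)) (insert a A) = f (g a) \<oplus>\<^bsub>N\<^esub> finsum N (\<lambda>j. f (g j)) A"
      by (auto simp: Pi_iff fc)
    moreover have "finsum M g A \<in> carrier M" using insert.prems by (intro M.finsum_closed) auto
    ultimately show ?case using insert by (simp add: fadd)
  qed
qed

context linear_category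
begin

lemma Hom_abelian_group: "\<lbrakk>X \<in> obj C; Y \<in> obj C\<rbrakk> \<Longrightarrow> abelian_group (Hom C X Y)"
  using Hom_module module.axioms(2) by blast

lemma zero_mor [simp]: "\<lbrakk>X \<in> obj C; Y \<in> obj C\<rbrakk> \<Longrightarrow> \<zero>\<^bsub>Hom C X Y\<^esub> \<in> mor C X Y"
  using abelian_monoid.zero_closed[OF abelian_group.axioms(1)[OF Hom_abelian_group]] by (simp add: mor_def)

lemma add_mor [simp]: "\<lbrakk>X \<in> obj C; Y \<in> obj C; f \<in> mor C X Y; g \<in> mor C X Y\<rbrakk>
    \<Longrightarrow> f \<oplus>\<^bsub>Hom C X Y\<^esub> g \<in> mor C X Y"
  using abelian_monoid.a_closed[OF abelian_group.axioms(1)[OF Hom_abelian_group]] by (simp add: mor_def)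

lemma minus_mor [simp]: "\<lbrakk>X \<in> obj C; Y \<in> obj C; f \<in> mor C X Y\<rbrakk> \<Longrightarrow> \<ominus>\<^bsub>Hom C X Y\<^esub> f \<in> mor C X Y"
  using abelian_group.a_inv_closed[OF Hom_abelian_group] by (simp add: mor_def)

lemma sum_mor [simp]: "\<lbrakk>X \<in> obj C; Y \<in> obj C; \<And>j. j \<in> A \<Longrightarrow> f j \<in> mor C X Y\<rbrakk>
    \<Longrightarrow> (\<Oplus>\<^bsub>Hom C X Y\<^esub>j\<in>A. f j) \<in> mor C X Y"
  using abelian_monoid.finsum_closed[OF abelian_group.axioms(1)[OF Hom_abelian_group], of X Y f A]
  by (auto simp: mor_def)

declare ident_mor [simp] cmp_mor [simp] cmp_ident_left [simp] cmp_ident_right [simp]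

lemma add_zero_right [simp]: "\<lbrakk>X \<in> obj C; Y \<in> obj C; f \<in> mor C X Y\<rbrakk> \<Longrightarrow> f \<oplus>\<^bsub>Hom C X Y\<^esub> \<zero>\<^bsub>Hom C X Y\<^esub> = f"
  using abelian_monoid.r_zero[OF abelian_group.axioms(1)[OF Hom_abelian_group]] by (simp add: mor_def)

lemma add_zero_left [simp]: "\<lbrakk>X \<in> obj C; Y \<in> obj C; f \<in> mor C X Y\<rbrakk> \<Longrightarrow> \<zero>\<^bsub>Hom C X Y\<^esub> \<oplus>\<^bsub>Hom C X Y\<^esub> f = f"
  using abelian_monoid.l_zero[OF abelian_group.axioms(1)[OF Hom_abelian_group]] by (simp add: mor_def)

lemma minus_zero [simp]: "\<lbrakk>X \<in> obj C; Y \<in> obj C\<rbrakk> \<Longrightarrow> \<ominus>\<^bsub>Hom C X Y\<^esub> \<zero>\<^bsub>Hom C X Y\<^esub> = \<zero>\<^bsub>Hom C X Y\<^esub>"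
  using abelian_group.minus_equality[OF Hom_abelian_group, of X Y "\<zero>\<^bsub>Hom C X Y\<^esub>" "\<zero>\<^bsub>Hom C X Y\<^esub>"]
    zero_mor[of X Y] add_zero_left[of X Y] by (simp add: mor_def)

lemma minus_eq_zero_iff [simp]: "\<lbrakk>X \<in> obj C; Y \<in> obj C; f \<in> mor C X Y\<rbrakk>
    \<Longrightarrow> \<ominus>\<^bsub>Hom C X Y\<^esub> f = \<zero>\<^bsub>Hom C X Y\<^esub> \<longleftrightarrow> f = \<zero>\<^bsub>Hom C X Y\<^esub>"
  using abelian_group.minus_minus[OF Hom_abelian_group, of X Y f] minus_zero[of X Y]
  by (auto simp: mor_def)

lemma minus_minus_mor [simp]: "\<lbrakk>X \<in> obj C; Y \<in> obj C; f \<in> mor C X Y\<rbrakk>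
    \<Longrightarrow> \<ominus>\<^bsub>Hom C X Y\<^esub> (\<ominus>\<^bsub>Hom C X Y\<^esub> f) = f"
  using abelian_group.minus_minus[OF Hom_abelian_group] by (simp add: mor_def)

lemma add_minus_mor [simp]: "\<lbrakk>X \<in> obj C; Y \<in> obj C; f \<in> mor C X Y\<rbrakk>
    \<Longrightarrow> f \<oplus>\<^bsub>Hom C X Y\<^esub> \<ominus>\<^bsub>Hom C X Y\<^esub> f = \<zero>\<^bsub>Hom C X Y\<^esub>"
  using abelian_group.r_neg[OF Hom_abelian_group] by (simp add: mor_def)

lemma add_minus_eq_zero_iff: "\<lbrakk>X \<in> obj C; Y \<in> obj C; f \<in> mor C X Y; g \<in> mor C X Y\<rbrakk>
    \<Longrightarrow> f \<oplus>\<^bsub>Hom C X Y\<^esub> \<ominus>\<^bsub>Hom C X Y\<^esub> g = \<zero>\<^bsub>Hom C X Y\<^esub> \<longleftrightarrow> f = g"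
  using abelian_group.minus_equality[OF Hom_abelian_group, of X Y f "\<ominus>\<^bsub>Hom C X Y\<^esub> g"]
    minus_minus_mor[of X Y f] minus_minus_mor[of X Y g] minus_mor[of X Y g] add_minus_mor[of X Y g]
  by (metis mor_def)

lemma add_minus_cancel: "\<lbrakk>X \<in> obj C; Y \<in> obj C; f \<in> mor C X Y; g \<in> mor C X Y\<rbrakk>
    \<Longrightarrow> (f \<oplus>\<^bsub>Hom C X Y\<^esub> \<ominus>\<^bsub>Hom C X Y\<^esub> g) \<oplus>\<^bsub>Hom C X Y\<^esub> g = f"
  using abelian_group.l_neg[OF Hom_abelian_group, of X Y g]
    abelian_monoid.a_assoc[OF abelian_group.axioms(1)[OF Hom_abelian_group], of X Y f "\<ominus>\<^bsub>Hom C X Y\<^esub> g" g]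
    abelian_group.a_inv_closed[OF Hom_abelian_group, of X Y g]
  by (simp add: mor_def abelian_monoid.r_zero[OF abelian_group.axioms(1)[OF Hom_abelian_group]])

lemma cmp_add_left: "\<lbrakk>X \<in> obj C; Y \<in> obj C; Z \<in> obj C; f \<in> mor C X Y; g \<in> mor C Y Z; h \<in> mor C Y Z\<rbrakk>
    \<Longrightarrow> cmp C X Y Z (g \<oplus>\<^bsub>Hom C Y Z\<^esub> h) f = cmp C X Y Z g f \<oplus>\<^bsub>Hom C X Z\<^esub> cmp C X Y Z h f"
  using cmp_linear_left by (auto simp: linear_map_def mor_def)

lemma cmp_add_right: "\<lbrakk>X \<in> obj C; Y \<in> obj C; Z \<in> obj C; f \<in> mor C X Y; h \<in> mor C X Y; g \<in> mor C Y Z\<rbrakk>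
    \<Longrightarrow> cmp C X Y Z g (f \<oplus>\<^bsub>Hom C X Y\<^esub> h) = cmp C X Y Z g f \<oplus>\<^bsub>Hom C X Z\<^esub> cmp C X Y Z g h"
  using cmp_linear_right by (auto simp: linear_map_def mor_def)

lemma cmp_zero_left [simp]: "\<lbrakk>X \<in> obj C; Y \<in> obj C; Z \<in> obj C; f \<in> mor C X Y\<rbrakk>
    \<Longrightarrow> cmp C X Y Z \<zero>\<^bsub>Hom C Y Z\<^esub> f = \<zero>\<^bsub>Hom C X Z\<^esub>"
  by (rule linear_map_zero[OF Hom_module Hom_module cmp_linear_left])

lemma cmp_zero_right [simp]: "\<lbrakk>X \<in> obj C; Y \<in> obj C; Z \<in> obj C; g \<in> mor C Y Z\<rbrakk>
    \<Longrightarrow> cmp C X Y Z g \<zero>\<^bsub>Hom C X Y\<^esub> = \<zero>\<^bsub>Hom C X Z\<^esub>"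
  by (rule linear_map_zero[OF Hom_module Hom_module cmp_linear_right])

lemma cmp_minus_left: "\<lbrakk>X \<in> obj C; Y \<in> obj C; Z \<in> obj C; f \<in> mor C X Y; g \<in> mor C Y Z\<rbrakk>
    \<Longrightarrow> cmp C X Y Z (\<ominus>\<^bsub>Hom C Y Z\<^esub> g) f = \<ominus>\<^bsub>Hom C X Z\<^esub> cmp C X Y Z g f"
  using linear_map_minus[OF Hom_module Hom_module cmp_linear_left] by (simp add: mor_def)

lemma cmp_minus_right: "\<lbrakk>X \<in> obj C; Y \<in> obj C; Z \<in> obj C; f \<in> mor C X Y; g \<in> mor C Y Z\<rbrakk>
    \<Longrightarrow> cmp C X Y Z g (\<ominus>\<^bsub>Hom C X Y\<^esub> f) = \<ominus>\<^bsub>Hom C X Z\<^esub> cmp C X Y Z g f"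
  using linear_map_minus[OF Hom_module Hom_module cmp_linear_right] by (simp add: mor_def)

lemma cmp_sum_left: "\<lbrakk>X \<in> obj C; Y \<in> obj C; Z \<in> obj C; f \<in> mor C X Y; finite A; \<And>j. j \<in> A \<Longrightarrow> g j \<in> mor C Y Z\<rbrakk>
    \<Longrightarrow> cmp C X Y Z (\<Oplus>\<^bsub>Hom C Y Z\<^esub>j\<in>A. g j) f = (\<Oplus>\<^bsub>Hom C X Z\<^esub>j\<in>A. cmp C X Y Z (g j) f)"
  by (rule linear_map_finsum[OF Hom_module Hom_module cmp_linear_left]) (auto simp: mor_def)

lemma cmp_sum_right: "\<lbrakk>X \<in> obj C; Y \<in> obj C; Z \<in> obj C; g \<in> mor C Y Z; finite A; \<And>j. j \<in> A \<Longrightarrow> f j \<in> mor C X Y\<rbrakk>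
    \<Longrightarrow> cmp C X Y Z g (\<Oplus>\<^bsub>Hom C X Y\<^esub>j\<in>A. f j) = (\<Oplus>\<^bsub>Hom C X Z\<^esub>j\<in>A. cmp C X Y Z g (f j))"
  by (rule linear_map_finsum[OF Hom_module Hom_module cmp_linear_right]) (auto simp: mor_def)

lemma sum_mor_cong: "\<lbrakk>X \<in> obj C; Y \<in> obj C; \<And>j. j \<in> A \<Longrightarrow> f j = g j; \<And>j. j \<in> A \<Longrightarrow> g j \<in> mor C X Y\<rbrakk>
    \<Longrightarrow> (\<Oplus>\<^bsub>Hom C X Y\<^esub>j\<in>A. f j) = (\<Oplus>\<^bsub>Hom C X Y\<^esub>j\<in>A. g j)"
  using abelian_monoid.finsum_cong'[OF abelian_group.axioms(1)[OF Hom_abelian_group], of X Y A A g f]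
  by (auto simp: mor_def)

lemma sum_mor_zero: "\<lbrakk>X \<in> obj C; Y \<in> obj C; \<And>j. j \<in> A \<Longrightarrow> f j = \<zero>\<^bsub>Hom C X Y\<^esub>\<rbrakk>
    \<Longrightarrow> (\<Oplus>\<^bsub>Hom C X Y\<^esub>j\<in>A. f j) = \<zero>\<^bsub>Hom C X Y\<^esub>"
  using abelian_monoid.finsum_zero[OF abelian_group.axioms(1)[OF Hom_abelian_group], of X Y A]
    sum_mor_cong[of X Y A f "\<lambda>_. \<zero>\<^bsub>Hom C X Y\<^esub>"] by simp

lemma sum_mor_singleton: "\<lbrakk>X \<in> obj C; Y \<in> obj C; finite A; k \<in> A; f k \<in> mor C X Y\<rbrakk>
    \<Longrightarrow> (\<Oplus>\<^bsub>Hom C X Y\<^esub>j\<in>A. if j = k then f j else \<zero>\<^bsub>Hom C X Y\<^esub>) = f k"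
proof -
  assume a: "X \<in> obj C" "Y \<in> obj C" "finite A" "k \<in> A" "f k \<in> mor C X Y"
  interpret H: abelian_group "Hom C X Y" using Hom_abelian_group a by simp
  let ?f = "\<lambda>j. if j = k then f j else \<zero>\<^bsub>Hom C X Y\<^esub>"
  have "finsum (Hom C X Y) ?f (insert k (A - {k})) = f k \<oplus>\<^bsub>Hom C X Y\<^esub> finsum (Hom C X Y) ?f (A - {k})"
    using a by (subst H.finsum_insert) (auto simp: mor_def)
  also have "finsum (Hom C X Y) ?f (A - {k}) = \<zero>\<^bsub>Hom C X Y\<^esub>" using a by (intro sum_mor_zero) auto
  finally show ?thesis using a by (simp add: insert_absorb)
qed

text \<open>Rewriting \<open>g \<circ> f = k\<close> inside a right-associated composite.\<close>

lemma cmp_reassoc: "\<lbrakk>cmp C X Y Z g f = k; W \<in> obj C; X \<in> obj C; Y \<in> obj C; Z \<in> obj C;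
      h \<in> mor C W X; f \<in> mor C X Y; g \<in> mor C Y Z\<rbrakk>
    \<Longrightarrow> cmp C W Y Z g (cmp C W X Y f h) = cmp C W X Z k h"
  using cmp_assoc[of W X Y Z h f g] by simp

section \<open>Isomorphisms and direct sums\<close>

lemma iso_morI: "\<lbrakk>f \<in> mor C X Y; g \<in> mor C Y X; cmp C X Y X g f = ident C X; cmp C Y X Y f g = ident C Y\<rbrakk>
    \<Longrightarrow> iso_mor C X Y f"
  by (auto simp: iso_mor_def)

lemma iso_mor_ident: "X \<in> obj C \<Longrightarrow> iso_mor C X X (ident C X)"
  by (auto simp: iso_mor_def intro!: bexI[of _ "ident C X"])

lemma iso_mor_cmp:
  assumes "X \<in> obj C" "Y \<in> obj C" "Z \<in> obj C" "iso_mor C X Y f" "iso_mor C Y Z g"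
  shows "iso_mor C X Z (cmp C X Y Z g f)"
proof -
  obtain f' g' where f: "f \<in> mor C X Y" "f' \<in> mor C Y X" "cmp C X Y X f' f = ident C X" "cmp C Y X Y f f' = ident C Y"
    and g: "g \<in> mor C Y Z" "g' \<in> mor C Z Y" "cmp C Y Z Y g' g = ident C Y" "cmp C Z Y Z g g' = ident C Z"
    using assms by (auto simp: iso_mor_def)
  show ?thesis
    by (rule iso_morI[of _ _ _ "cmp C Z Y X f' g'"])
      (use assms f g in \<open>simp_all add: cmp_assoc cmp_reassoc[OF f(3)] cmp_reassoc[OF f(4)] cmp_reassoc[OF g(3)] cmp_reassoc[OF g(4)]\<close>)
qed

lemma isomorphicI: "\<lbrakk>X \<in> obj C; Y \<in> obj C; iso_mor C X Y f\<rbrakk> \<Longrightarrow> isomorphic C X Y"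
  by (auto simp: isomorphic_def)

lemma isomorphicE:
  assumes "isomorphic C X Y"
  obtains f g where "X \<in> obj C" "Y \<in> obj C" "f \<in> mor C X Y" "g \<in> mor C Y X"
    "cmp C X Y X g f = ident C X" "cmp C Y X Y f g = ident C Y"
  using assms by (auto simp: isomorphic_def iso_mor_def)

lemma isomorphic_refl: "X \<in> obj C \<Longrightarrow> isomorphic C X X"
  using iso_mor_ident by (auto simp: isomorphic_def)

lemma isomorphic_sym: "isomorphic C X Y \<Longrightarrow> isomorphic C Y X"
  by (auto simp: isomorphic_def iso_mor_def)

lemma isomorphic_trans: "isomorphic C X Y \<Longrightarrow> isomorphic C Y Z \<Longrightarrow> isomorphic C X Z"
  unfolding isomorphic_def using iso_mor_cmp by blast

lemma iso_rel_equiv: "equiv (obj C) (iso_rel C)"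
proof (rule equivI)
  show "iso_rel C \<subseteq> obj C \<times> obj C" by (auto simp: iso_rel_def isomorphic_def)
  show "refl_on (obj C) (iso_rel C)" by (auto simp: refl_on_def iso_rel_def isomorphic_refl)
  show "sym (iso_rel C)" by (auto simp: sym_def iso_rel_def intro: isomorphic_sym)
  show "trans (iso_rel C)" by (auto simp: trans_def iso_rel_def intro: isomorphic_trans)
qed

definition retract :: "'o \<Rightarrow> 'o \<Rightarrow> bool" where
  "retract X Y \<longleftrightarrow> X \<in> obj C \<and> Y \<in> obj C \<and> (\<exists>i\<in>mor C X Y. \<exists>p\<in>mor C Y X. cmp C X Y X p i = ident C X)"

lemma retractI: "\<lbrakk>X \<in> obj C; Y \<in> obj C; i \<in> mor C X Y; p \<in> mor C Y X; cmp C X Y X p i = ident C X\<rbrakk> \<Longrightarrow> retract X Y"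
  by (auto simp: retract_def)

lemma isomorphic_retract: "isomorphic C X Y \<Longrightarrow> retract X Y"
  by (elim isomorphicE) (auto intro: retractI)

lemma retract_trans:
  assumes "retract X Y" "retract Y Z"
  shows "retract X Z"
proof -
  obtain i p j q where o: "X \<in> obj C" "Y \<in> obj C" "Z \<in> obj C"
    and i: "i \<in> mor C X Y" "p \<in> mor C Y X" "cmp C X Y X p i = ident C X"
    and j: "j \<in> mor C Y Z" "q \<in> mor C Z Y" "cmp C Y Z Y q j = ident C Y"
    using assms by (auto simp: retract_def)
  show ?thesis
    by (rule retractI[of _ _ "cmp C X Y Z j i" "cmp C Z Y X p q"])
      (use o i j in \<open>simp_all add: cmp_assoc cmp_reassoc[OF j(3)]\<close>)
qed

text \<open>Direct sum data in a form without sums: instead of \<open>\<Sum> \<iota>\<^sub>j \<pi>\<^sub>j = id\<close> it is enough that the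
  projections are jointly monic.\<close>

definition dsum :: "'o \<Rightarrow> 'o list \<Rightarrow> (nat \<Rightarrow> 'm) \<Rightarrow> (nat \<Rightarrow> 'm) \<Rightarrow> bool" where
  "dsum X Ys \<iota> \<pi> \<longleftrightarrow> X \<in> obj C \<and> set Ys \<subseteq> obj C \<and>
     (\<forall>j<length Ys. \<iota> j \<in> mor C (Ys ! j) X \<and> \<pi> j \<in> mor C X (Ys ! j)) \<and>
     (\<forall>j<length Ys. \<forall>l<length Ys. cmp C (Ys ! l) X (Ys ! j) (\<pi> j) (\<iota> l) =
        (if j = l then ident C (Ys ! j) else \<zero>\<^bsub>Hom C (Ys ! l) (Ys ! j)\<^esub>)) \<and>
     (\<forall>W\<in>obj C. \<forall>f\<in>mor C W X. (\<forall>j<length Ys. cmp C W X (Ys ! j) (\<pi> j) f = \<zero>\<^bsub>Hom C W (Ys ! j)\<^esub>)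
        \<longrightarrow> f = \<zero>\<^bsub>Hom C W X\<^esub>)"

context
  fixes X Ys \<iota> \<pi> assumes ds: "dsum X Ys \<iota> \<pi>"
begin

lemma dsum_obj: "X \<in> obj C" "j < length Ys \<Longrightarrow> Ys ! j \<in> obj C"
  using ds by (auto simp: dsum_def)

lemma dsum_mor: "j < length Ys \<Longrightarrow> \<iota> j \<in> mor C (Ys ! j) X" "j < length Ys \<Longrightarrow> \<pi> j \<in> mor C X (Ys ! j)"
  using ds by (auto simp: dsum_def)

lemma dsum_cmp: "\<lbrakk>j < length Ys; l < length Ys\<rbrakk> \<Longrightarrow> cmp C (Ys ! l) X (Ys ! j) (\<pi> j) (\<iota> l) =
    (if j = l then ident C (Ys ! j) else \<zero>\<^bsub>Hom C (Ys ! l) (Ys ! j)\<^esub>)"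
  using ds by (auto simp: dsum_def)

lemma dsum_kernel: "\<lbrakk>W \<in> obj C; f \<in> mor C W X;
    \<And>j. j < length Ys \<Longrightarrow> cmp C W X (Ys ! j) (\<pi> j) f = \<zero>\<^bsub>Hom C W (Ys ! j)\<^esub>\<rbrakk> \<Longrightarrow> f = \<zero>\<^bsub>Hom C W X\<^esub>"
  using ds unfolding dsum_def by blast

lemma dsum_monic: "\<lbrakk>W \<in> obj C; f \<in> mor C W X; g \<in> mor C W X;
    \<And>j. j < length Ys \<Longrightarrow> cmp C W X (Ys ! j) (\<pi> j) f = cmp C W X (Ys ! j) (\<pi> j) g\<rbrakk> \<Longrightarrow> f = g"
proof -
  assume a: "W \<in> obj C" "f \<in> mor C W X" "g \<in> mor C W X"
    "\<And>j. j < length Ys \<Longrightarrow> cmp C W X (Ys ! j) (\<pi> j) f = cmp C W X (Ys ! j) (\<pi> j) g"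
  have "f \<oplus>\<^bsub>Hom C W X\<^esub> \<ominus>\<^bsub>Hom C W X\<^esub> g = \<zero>\<^bsub>Hom C W X\<^esub>"
    by (rule dsum_kernel) (use a in \<open>simp_all add: cmp_add_right cmp_minus_right dsum_obj dsum_mor\<close>)
  then show ?thesis using a by (simp add: add_minus_eq_zero_iff dsum_obj)
qed

lemma dsum_sum_mor:
  assumes "W \<in> obj C" "\<And>j. j < length Ys \<Longrightarrow> f j \<in> mor C W (Ys ! j)"
  shows "(\<Oplus>\<^bsub>Hom C W X\<^esub>j\<in>{..<length Ys}. cmp C W (Ys ! j) X (\<iota> j) (f j)) \<in> mor C W X"
  using assms by (intro sum_mor cmp_mor) (auto intro: dsum_obj dsum_mor)

lemma dsum_cosum_mor:
  assumes "W \<in> obj C" "\<And>j. j < length Ys \<Longrightarrow> f j \<in> mor C (Ys ! j) W"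
  shows "(\<Oplus>\<^bsub>Hom C X W\<^esub>j\<in>{..<length Ys}. cmp C X (Ys ! j) W (f j) (\<pi> j)) \<in> mor C X W"
  using assms by (intro sum_mor cmp_mor) (auto intro: dsum_obj dsum_mor)

lemma dsum_pair:
  assumes "W \<in> obj C" "\<And>j. j < length Ys \<Longrightarrow> f j \<in> mor C W (Ys ! j)" "l < length Ys"
  shows "cmp C W X (Ys ! l) (\<pi> l) (\<Oplus>\<^bsub>Hom C W X\<^esub>j\<in>{..<length Ys}. cmp C W (Ys ! j) X (\<iota> j) (f j)) = f l"
proof -
  have "cmp C W X (Ys ! l) (\<pi> l) (\<Oplus>\<^bsub>Hom C W X\<^esub>j\<in>{..<length Ys}. cmp C W (Ys ! j) X (\<iota> j) (f j))
      = (\<Oplus>\<^bsub>Hom C W (Ys ! l)\<^esub>j\<in>{..<length Ys}. cmp C W X (Ys ! l) (\<pi> l) (cmp C W (Ys ! j) X (\<iota> j) (f j)))"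
    using assms by (intro cmp_sum_right) (simp_all add: dsum_mor dsum_obj)
  also have "\<dots> = (\<Oplus>\<^bsub>Hom C W (Ys ! l)\<^esub>j\<in>{..<length Ys}. if j = l then f j else \<zero>\<^bsub>Hom C W (Ys ! l)\<^esub>)"
  proof (rule sum_mor_cong)
    fix j assume "j \<in> {..<length Ys}"
    then have j: "j < length Ys" by simp
    show "cmp C W X (Ys ! l) (\<pi> l) (cmp C W (Ys ! j) X (\<iota> j) (f j)) = (if j = l then f j else \<zero>\<^bsub>Hom C W (Ys ! l)\<^esub>)"
      using cmp_reassoc[OF dsum_cmp[OF assms(3) j], of W "f j"] assms j by (auto simp: dsum_mor dsum_obj)
    show "(if j = l then f j else \<zero>\<^bsub>Hom C W (Ys ! l)\<^esub>) \<in> mor C W (Ys ! l)"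
      using assms j by (auto simp: dsum_mor dsum_obj)
  qed (use assms in \<open>simp_all add: dsum_obj\<close>)
  also have "\<dots> = f l"
    using assms by (intro sum_mor_singleton) (simp_all add: dsum_obj)
  finally show ?thesis .
qed

lemma dsum_sum: "(\<Oplus>\<^bsub>Hom C X X\<^esub>j\<in>{..<length Ys}. cmp C X (Ys ! j) X (\<iota> j) (\<pi> j)) = ident C X"
  by (rule dsum_monic[OF _ dsum_sum_mor]) (simp_all add: dsum_obj dsum_mor dsum_pair)

lemma dsum_is_direct_sum: "is_direct_sum C X Ys"
  unfolding is_direct_sum_def using ds dsum_sum unfolding dsum_def by blast

lemma dsum_copair:
  assumes "W \<in> obj C" "\<And>j. j < length Ys \<Longrightarrow> f j \<in> mor C (Ys ! j) W" "l < length Ys"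
  shows "cmp C (Ys ! l) X W (\<Oplus>\<^bsub>Hom C X W\<^esub>j\<in>{..<length Ys}. cmp C X (Ys ! j) W (f j) (\<pi> j)) (\<iota> l) = f l"
proof -
  have "cmp C (Ys ! l) X W (\<Oplus>\<^bsub>Hom C X W\<^esub>j\<in>{..<length Ys}. cmp C X (Ys ! j) W (f j) (\<pi> j)) (\<iota> l)
      = (\<Oplus>\<^bsub>Hom C (Ys ! l) W\<^esub>j\<in>{..<length Ys}. cmp C (Ys ! l) X W (cmp C X (Ys ! j) W (f j) (\<pi> j)) (\<iota> l))"
    using assms by (intro cmp_sum_left) (simp_all add: dsum_mor dsum_obj)
  also have "\<dots> = (\<Oplus>\<^bsub>Hom C (Ys ! l) W\<^esub>j\<in>{..<length Ys}. if j = l then f j else \<zero>\<^bsub>Hom C (Ys ! l) W\<^esub>)"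
    using assms by (intro sum_mor_cong) (simp_all add: dsum_mor dsum_obj cmp_assoc dsum_cmp)
  also have "\<dots> = f l"
    using assms by (intro sum_mor_singleton) (simp_all add: dsum_obj)
  finally show ?thesis .
qed

lemma dsum_expand_left:
  assumes "W \<in> obj C" "f \<in> mor C W X"
  shows "f = (\<Oplus>\<^bsub>Hom C W X\<^esub>j\<in>{..<length Ys}. cmp C W (Ys ! j) X (\<iota> j) (cmp C W X (Ys ! j) (\<pi> j) f))"
  by (rule dsum_monic[OF _ _ dsum_sum_mor]) (use assms in \<open>simp_all add: dsum_obj dsum_mor dsum_pair\<close>)

lemma dsum_expand_right:
  assumes "W \<in> obj C" "f \<in> mor C X W"
  shows "f = (\<Oplus>\<^bsub>Hom C X W\<^esub>j\<in>{..<length Ys}. cmp C X (Ys ! j) W (cmp C (Ys ! j) X W f (\<iota> j)) (\<pi> j))"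
proof -
  have "f = cmp C X X W f (\<Oplus>\<^bsub>Hom C X X\<^esub>j\<in>{..<length Ys}. cmp C X (Ys ! j) X (\<iota> j) (\<pi> j))"
    using assms by (simp add: dsum_sum dsum_obj)
  also have "\<dots> = (\<Oplus>\<^bsub>Hom C X W\<^esub>j\<in>{..<length Ys}. cmp C X X W f (cmp C X (Ys ! j) X (\<iota> j) (\<pi> j)))"
    using assms by (intro cmp_sum_right) (simp_all add: dsum_mor dsum_obj)
  also have "\<dots> = (\<Oplus>\<^bsub>Hom C X W\<^esub>j\<in>{..<length Ys}. cmp C X (Ys ! j) W (cmp C (Ys ! j) X W f (\<iota> j)) (\<pi> j))"
    using assms by (intro sum_mor_cong) (simp_all add: dsum_mor dsum_obj cmp_assoc)
  finally show ?thesis .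
qed

lemma dsum_epic: "\<lbrakk>W \<in> obj C; f \<in> mor C X W; g \<in> mor C X W;
    \<And>j. j < length Ys \<Longrightarrow> cmp C (Ys ! j) X W f (\<iota> j) = cmp C (Ys ! j) X W g (\<iota> j)\<rbrakk> \<Longrightarrow> f = g"
proof -
  assume a: "W \<in> obj C" "f \<in> mor C X W" "g \<in> mor C X W"
    "\<And>j. j < length Ys \<Longrightarrow> cmp C (Ys ! j) X W f (\<iota> j) = cmp C (Ys ! j) X W g (\<iota> j)"
  have "(\<Oplus>\<^bsub>Hom C X W\<^esub>j\<in>{..<length Ys}. cmp C X (Ys ! j) W (cmp C (Ys ! j) X W f (\<iota> j)) (\<pi> j))
      = (\<Oplus>\<^bsub>Hom C X W\<^esub>j\<in>{..<length Ys}. cmp C X (Ys ! j) W (cmp C (Ys ! j) X W g (\<iota> j)) (\<pi> j))"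
    using a by (intro sum_mor_cong) (simp_all add: dsum_obj dsum_mor)
  then show ?thesis
    using dsum_expand_right[OF a(1,2)] dsum_expand_right[OF a(1,3)] by metis
qed

lemma dsum_factor:
  assumes "W \<in> obj C" "\<And>j. j < length Ys \<Longrightarrow> f j \<in> mor C W (Ys ! j)"
  obtains g where "g \<in> mor C W X" "\<And>j. j < length Ys \<Longrightarrow> cmp C W X (Ys ! j) (\<pi> j) g = f j"
  using that[of "\<Oplus>\<^bsub>Hom C W X\<^esub>j\<in>{..<length Ys}. cmp C W (Ys ! j) X (\<iota> j) (f j)"]
    dsum_pair dsum_sum_mor assms by blast

lemma dsum_cofactor:
  assumes "W \<in> obj C" "\<And>j. j < length Ys \<Longrightarrow> f j \<in> mor C (Ys ! j) W"
  obtains g where "g \<in> mor C X W" "\<And>j. j < length Ys \<Longrightarrow> cmp C (Ys ! j) X W g (\<iota> j) = f j"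
  using that[of "\<Oplus>\<^bsub>Hom C X W\<^esub>j\<in>{..<length Ys}. cmp C X (Ys ! j) W (f j) (\<pi> j)"]
    dsum_copair dsum_cosum_mor assms by blast

end

lemma is_direct_sum_dsum:
  assumes "is_direct_sum C X Ys"
  obtains \<iota> \<pi> where "dsum X Ys \<iota> \<pi>"
proof -
  obtain \<iota> \<pi> where o: "X \<in> obj C" "set Ys \<subseteq> obj C"
    and m: "\<forall>j<length Ys. \<iota> j \<in> mor C (Ys ! j) X \<and> \<pi> j \<in> mor C X (Ys ! j)"
    and c: "\<forall>j<length Ys. \<forall>l<length Ys. cmp C (Ys ! l) X (Ys ! j) (\<pi> j) (\<iota> l) =
             (if j = l then ident C (Ys ! j) else \<zero>\<^bsub>Hom C (Ys ! l) (Ys ! j)\<^esub>)"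
    and s: "(\<Oplus>\<^bsub>Hom C X X\<^esub>j\<in>{..<length Ys}. cmp C X (Ys ! j) X (\<iota> j) (\<pi> j)) = ident C X"
    using assms unfolding is_direct_sum_def by blast
  have oj: "\<And>j. j < length Ys \<Longrightarrow> Ys ! j \<in> obj C" using o by auto
  have "f = \<zero>\<^bsub>Hom C W X\<^esub>"
    if W: "W \<in> obj C" "f \<in> mor C W X"
      and z: "\<forall>j<length Ys. cmp C W X (Ys ! j) (\<pi> j) f = \<zero>\<^bsub>Hom C W (Ys ! j)\<^esub>" for W f
  proof -
    have "f = cmp C W X X (\<Oplus>\<^bsub>Hom C X X\<^esub>j\<in>{..<length Ys}. cmp C X (Ys ! j) X (\<iota> j) (\<pi> j)) f"
      using W o by (simp add: s)
    also have "\<dots> = (\<Oplus>\<^bsub>Hom C W X\<^esub>j\<in>{..<length Ys}. cmp C W X X (cmp C X (Ys ! j) X (\<iota> j) (\<pi> j)) f)"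
      using W o m oj by (intro cmp_sum_left) auto
    also have "\<dots> = \<zero>\<^bsub>Hom C W X\<^esub>"
      using W o m oj z by (intro sum_mor_zero) (auto simp: cmp_assoc)
    finally show ?thesis .
  qed
  then have "dsum X Ys \<iota> \<pi>" unfolding dsum_def using o m c by blast
  then show thesis by (rule that)
qed

lemma direct_sum_obj: "is_direct_sum C X Ys \<Longrightarrow> X \<in> obj C" "is_direct_sum C X Ys \<Longrightarrow> set Ys \<subseteq> obj C"
  by (auto simp: is_direct_sum_def)

lemma binary_direct_sumE:
  assumes "is_direct_sum C X [Y, Z]"
  obtains i j p q where "X \<in> obj C" "Y \<in> obj C" "Z \<in> obj C"
    "i \<in> mor C Y X" "j \<in> mor C Z X" "p \<in> mor C X Y" "q \<in> mor C X Z"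
    "cmp C Y X Y p i = ident C Y" "cmp C Z X Z q j = ident C Z"
    "cmp C Z X Y p j = \<zero>\<^bsub>Hom C Z Y\<^esub>" "cmp C Y X Z q i = \<zero>\<^bsub>Hom C Y Z\<^esub>"
    "cmp C X Y X i p \<oplus>\<^bsub>Hom C X X\<^esub> cmp C X Z X j q = ident C X"
proof -
  obtain \<iota> \<pi> where ds: "dsum X [Y, Z] \<iota> \<pi>" using assms by (rule is_direct_sum_dsum)
  have o: "X \<in> obj C" "Y \<in> obj C" "Z \<in> obj C" using ds by (auto simp: dsum_def)
  have m: "\<iota> 0 \<in> mor C Y X" "\<iota> 1 \<in> mor C Z X" "\<pi> 0 \<in> mor C X Y" "\<pi> 1 \<in> mor C X Z"
    using dsum_mor[OF ds, of 0] dsum_mor[OF ds, of 1] by auto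
  have c: "cmp C Y X Y (\<pi> 0) (\<iota> 0) = ident C Y" "cmp C Z X Z (\<pi> 1) (\<iota> 1) = ident C Z"
    "cmp C Z X Y (\<pi> 0) (\<iota> 1) = \<zero>\<^bsub>Hom C Z Y\<^esub>" "cmp C Y X Z (\<pi> 1) (\<iota> 0) = \<zero>\<^bsub>Hom C Y Z\<^esub>"
    using dsum_cmp[OF ds, of 0 0] dsum_cmp[OF ds, of 1 1] dsum_cmp[OF ds, of 0 1] dsum_cmp[OF ds, of 1 0] by auto
  interpret H: abelian_group "Hom C X X" using Hom_abelian_group o by simp
  have "{..<length [Y, Z]} = insert 0 {1}" by auto
  then have "cmp C X Y X (\<iota> 0) (\<pi> 0) \<oplus>\<^bsub>Hom C X X\<^esub> cmp C X Z X (\<iota> 1) (\<pi> 1) = ident C X"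
    using dsum_sum[OF ds] o m cmp_mor[of X Y X] cmp_mor[of X Z X] by (simp add: H.finsum_insert mor_def)
  then show thesis using o m c by (rule that[rotated -1])
qed

lemma binary_direct_sumI:
  assumes o: "X \<in> obj C" "Y \<in> obj C" "Z \<in> obj C"
    and m: "i \<in> mor C Y X" "j \<in> mor C Z X" "p \<in> mor C X Y" "q \<in> mor C X Z"
    and c: "cmp C Y X Y p i = ident C Y" "cmp C Z X Z q j = ident C Z"
    "cmp C Z X Y p j = \<zero>\<^bsub>Hom C Z Y\<^esub>" "cmp C Y X Z q i = \<zero>\<^bsub>Hom C Y Z\<^esub>"
    and s: "cmp C X Y X i p \<oplus>\<^bsub>Hom C X X\<^esub> cmp C X Z X j q = ident C X"
  shows "is_direct_sum C X [Y, Z]"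
proof -
  define \<iota> where "\<iota> k = (if k = (0::nat) then i else j)" for k
  define \<pi> where "\<pi> k = (if k = (0::nat) then p else q)" for k
  interpret H: abelian_group "Hom C X X" using Hom_abelian_group o by simp
  have "{..<length [Y, Z]} = insert 0 {1}" by auto
  then have "(\<Oplus>\<^bsub>Hom C X X\<^esub>k\<in>{..<length [Y, Z]}. cmp C X ([Y, Z] ! k) X (\<iota> k) (\<pi> k)) = ident C X"
    using s o m cmp_mor[of X Y X] cmp_mor[of X Z X] by (simp add: H.finsum_insert mor_def \<iota>_def \<pi>_def)
  moreover have "\<forall>k<length [Y, Z]. \<iota> k \<in> mor C ([Y, Z] ! k) X \<and> \<pi> k \<in> mor C X ([Y, Z] ! k)"
    using m by (auto simp: \<iota>_def \<pi>_def less_Suc_eq)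
  moreover have "\<forall>k<length [Y, Z]. \<forall>l<length [Y, Z]. cmp C ([Y, Z] ! l) X ([Y, Z] ! k) (\<pi> k) (\<iota> l) =
             (if k = l then ident C ([Y, Z] ! k) else \<zero>\<^bsub>Hom C ([Y, Z] ! l) ([Y, Z] ! k)\<^esub>)"
    using c by (auto simp: \<iota>_def \<pi>_def less_Suc_eq)
  moreover have "set [Y, Z] \<subseteq> obj C" using o by simp
  ultimately show ?thesis unfolding is_direct_sum_def using o(1)
    by (intro conjI exI[of _ \<iota>] exI[of _ \<pi>])
qed

lemma direct_sum_singleton:
  assumes "Y \<in> obj C" shows "is_direct_sum C Y [Y]"
proof -
  interpret H: abelian_group "Hom C Y Y" using Hom_abelian_group assms by simp
  have "{..<length [Y]} = {0}" by auto
  then have "(\<Oplus>\<^bsub>Hom C Y Y\<^esub>k\<in>{..<length [Y]}. cmp C Y ([Y] ! k) Y (ident C Y) (ident C Y)) = ident C Y"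
    using assms ident_mor[OF assms] by (simp add: H.finsum_insert mor_def)
  then show ?thesis
    unfolding is_direct_sum_def using assms
    by (intro conjI exI[of _ "\<lambda>_. ident C Y"]) (simp_all add: less_Suc_eq)
qed

text \<open>The empty sum is \<open>0\<close>, so an object is a direct sum of no objects iff its identity is zero.\<close>

lemma zero_object_iff: "zero_object C X \<longleftrightarrow> X \<in> obj C \<and> ident C X = \<zero>\<^bsub>Hom C X X\<^esub>"
proof (cases "X \<in> obj C")
  case True
  interpret H: abelian_group "Hom C X X" using Hom_abelian_group True by simp
  show ?thesis using True by (auto simp: zero_object_def is_direct_sum_def)
qed (auto simp: zero_object_def is_direct_sum_def)

lemma mor_into_zero: "\<lbrakk>zero_object C Z; X \<in> obj C; f \<in> mor C X Z\<rbrakk> \<Longrightarrow> f = \<zero>\<^bsub>Hom C X Z\<^esub>"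
  using cmp_ident_left[of X Z f] by (simp add: zero_object_iff)

lemma zero_object_retract: "retract X Y \<Longrightarrow> zero_object C Y \<Longrightarrow> zero_object C X"
proof -
  assume "retract X Y" and Y: "zero_object C Y"
  then obtain i p where i: "X \<in> obj C" "Y \<in> obj C" "i \<in> mor C X Y" "p \<in> mor C Y X" "cmp C X Y X p i = ident C X"
    by (auto simp: retract_def)
  then have "i = \<zero>\<^bsub>Hom C X Y\<^esub>" using mor_into_zero[OF Y] by simp
  then show ?thesis using i by (simp add: zero_object_iff)
qed

lemma direct_sum_with_zero:
  assumes "is_direct_sum C X [Y, Z]" "zero_object C Z"
  shows "isomorphic C Y X"
proof -
  obtain i j p q where o: "X \<in> obj C" "Y \<in> obj C" "Z \<in> obj C"
    and m: "i \<in> mor C Y X" "j \<in> mor C Z X" "p \<in> mor C X Y" "q \<in> mor C X Z"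
    and c: "cmp C Y X Y p i = ident C Y" "cmp C X Y X i p \<oplus>\<^bsub>Hom C X X\<^esub> cmp C X Z X j q = ident C X"
    using assms(1) by (rule binary_direct_sumE)
  have "q = \<zero>\<^bsub>Hom C X Z\<^esub>" using mor_into_zero[OF assms(2)] o m by simp
  then have "cmp C X Y X i p = ident C X" using c o m by simp
  then show ?thesis using iso_morI[of i Y X p] o m c isomorphicI by blast
qed

lemma direct_sum_component: "is_direct_sum C X Ys \<Longrightarrow> Y \<in> set Ys \<Longrightarrow> retract Y X"
proof -
  assume "is_direct_sum C X Ys" and Y: "Y \<in> set Ys"
  then obtain \<iota> \<pi> where ds: "dsum X Ys \<iota> \<pi>" by (auto elim: is_direct_sum_dsum)
  obtain k where k: "k < length Ys" "Y = Ys ! k" using Y by (auto simp: in_set_conv_nth)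
  show ?thesis
    using k dsum_obj[OF ds] dsum_mor[OF ds k(1)] dsum_cmp[OF ds k(1) k(1)] by (auto intro: retractI)
qed

lemma direct_summand_retract: "direct_summand C X Y \<Longrightarrow> retract X Y"
  unfolding direct_summand_def using direct_sum_component by fastforce

text \<open>The maps \<open>a\<^sub>k\<close> on the components assemble to a map between direct sums, characterised by its
  composites with the projections; a componentwise left inverse assembles to a left inverse.  This
  compares direct sums along retractions and isomorphisms of their components.\<close>

lemma diagonal_map:
  assumes X: "dsum X Ys \<iota> \<pi>" and X': "dsum X' Ys' \<iota>' \<pi>'" and len: "length Ys' = length Ys"
    and a: "\<And>k. k < length Ys \<Longrightarrow> a k \<in> mor C (Ys ! k) (Ys' ! k)"
  obtains f where "f \<in> mor C X X'"
    "\<And>k. k < length Ys \<Longrightarrow> cmp C X X' (Ys' ! k) (\<pi>' k) f = cmp C X (Ys ! k) (Ys' ! k) (a k) (\<pi> k)"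
proof -
  have "cmp C X (Ys ! k) (Ys' ! k) (a k) (\<pi> k) \<in> mor C X (Ys' ! k)" if "k < length Ys'" for k
    using that len a dsum_obj[OF X] dsum_obj[OF X'] dsum_mor[OF X] by simp
  then show thesis
    using dsum_factor[OF X' dsum_obj(1)[OF X], of "\<lambda>k. cmp C X (Ys ! k) (Ys' ! k) (a k) (\<pi> k)" thesis] that
    unfolding len by blast
qed

lemma diagonal_inverse:
  assumes X: "dsum X Ys \<iota> \<pi>" and X': "dsum X' Ys' \<iota>' \<pi>'" and len: "length Ys' = length Ys"
    and a: "\<And>k. k < length Ys \<Longrightarrow> a k \<in> mor C (Ys ! k) (Ys' ! k)"
    and b: "\<And>k. k < length Ys \<Longrightarrow> b k \<in> mor C (Ys' ! k) (Ys ! k)"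
    and ba: "\<And>k. k < length Ys \<Longrightarrow> cmp C (Ys ! k) (Ys' ! k) (Ys ! k) (b k) (a k) = ident C (Ys ! k)"
    and f: "f \<in> mor C X X'" "\<And>k. k < length Ys \<Longrightarrow> cmp C X X' (Ys' ! k) (\<pi>' k) f = cmp C X (Ys ! k) (Ys' ! k) (a k) (\<pi> k)"
    and g: "g \<in> mor C X' X" "\<And>k. k < length Ys \<Longrightarrow> cmp C X' X (Ys ! k) (\<pi> k) g = cmp C X' (Ys' ! k) (Ys ! k) (b k) (\<pi>' k)"
  shows "cmp C X X' X g f = ident C X"
proof (rule dsum_monic[OF X])
  have o: "X \<in> obj C" "X' \<in> obj C" using dsum_obj[OF X] dsum_obj[OF X'] by auto
  show "X \<in> obj C" "cmp C X X' X g f \<in> mor C X X" "ident C X \<in> mor C X X" using o f g by auto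
  fix k assume k: "k < length Ys"
  have ok: "Ys ! k \<in> obj C" "Ys' ! k \<in> obj C" using k len dsum_obj[OF X] dsum_obj[OF X'] by auto
  have m: "\<pi> k \<in> mor C X (Ys ! k)" "\<pi>' k \<in> mor C X' (Ys' ! k)"
    using k len dsum_mor[OF X] dsum_mor[OF X'] by auto
  show "cmp C X X (Ys ! k) (\<pi> k) (cmp C X X' X g f) = cmp C X X (Ys ! k) (\<pi> k) (ident C X)"
    using o ok m a[OF k] b[OF k] f(1) g(1)
    by (simp add: cmp_reassoc[OF g(2)[OF k]] cmp_assoc f(2)[OF k] cmp_reassoc[OF ba[OF k]])
qed

lemma direct_sum_retract:
  assumes X: "is_direct_sum C X Ys" and X': "is_direct_sum C X' Ys'" and len: "length Ys' = length Ys"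
    and r: "\<And>k. k < length Ys \<Longrightarrow> retract (Ys ! k) (Ys' ! k)"
  shows "retract X X'"
proof -
  obtain \<iota> \<pi> \<iota>' \<pi>' where ds: "dsum X Ys \<iota> \<pi>" "dsum X' Ys' \<iota>' \<pi>'"
    using X X' by (auto elim!: is_direct_sum_dsum)
  have "\<forall>k. \<exists>a b. k < length Ys \<longrightarrow> a \<in> mor C (Ys ! k) (Ys' ! k) \<and> b \<in> mor C (Ys' ! k) (Ys ! k) \<and> cmp C (Ys ! k) (Ys' ! k) (Ys ! k) b a = ident C (Ys ! k)"
    using r unfolding retract_def by blast
  then obtain a b where ab: "\<And>k. k < length Ys \<Longrightarrow> a k \<in> mor C (Ys ! k) (Ys' ! k)"
    "\<And>k. k < length Ys \<Longrightarrow> b k \<in> mor C (Ys' ! k) (Ys ! k)"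
    "\<And>k. k < length Ys \<Longrightarrow> cmp C (Ys ! k) (Ys' ! k) (Ys ! k) (b k) (a k) = ident C (Ys ! k)"
    by metis
  obtain f where f: "f \<in> mor C X X'"
    "\<And>k. k < length Ys \<Longrightarrow> cmp C X X' (Ys' ! k) (\<pi>' k) f = cmp C X (Ys ! k) (Ys' ! k) (a k) (\<pi> k)"
    using diagonal_map[OF ds len ab(1)] by blast
  obtain g where g: "g \<in> mor C X' X"
    "\<And>k. k < length Ys \<Longrightarrow> cmp C X' X (Ys ! k) (\<pi> k) g = cmp C X' (Ys' ! k) (Ys ! k) (b k) (\<pi>' k)"
    using diagonal_map[OF ds(2,1) len[symmetric], of b, unfolded len, OF ab(2)] by blast
  show ?thesis
    by (rule retractI[OF dsum_obj(1)[OF ds(1)] dsum_obj(1)[OF ds(2)] f(1) g(1) diagonal_inverse[OF ds len ab f g]])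
qed

lemma direct_sum_isomorphic:
  assumes X: "is_direct_sum C X Ys" and X': "is_direct_sum C X' Ys'" and len: "length Ys' = length Ys"
    and r: "\<And>k. k < length Ys \<Longrightarrow> isomorphic C (Ys ! k) (Ys' ! k)"
  shows "isomorphic C X X'"
proof -
  obtain \<iota> \<pi> \<iota>' \<pi>' where ds: "dsum X Ys \<iota> \<pi>" "dsum X' Ys' \<iota>' \<pi>'"
    using X X' by (auto elim!: is_direct_sum_dsum)
  have "\<forall>k. \<exists>a b. k < length Ys \<longrightarrow> a \<in> mor C (Ys ! k) (Ys' ! k) \<and> b \<in> mor C (Ys' ! k) (Ys ! k) \<and> cmp C (Ys ! k) (Ys' ! k) (Ys ! k) b a = ident C (Ys ! k) \<and> cmp C (Ys' ! k) (Ys ! k) (Ys' ! k) a b = ident C (Ys' ! k)"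
    using r unfolding isomorphic_def iso_mor_def by blast
  then obtain a b where ab: "\<And>k. k < length Ys \<Longrightarrow> a k \<in> mor C (Ys ! k) (Ys' ! k)"
    "\<And>k. k < length Ys \<Longrightarrow> b k \<in> mor C (Ys' ! k) (Ys ! k)"
    "\<And>k. k < length Ys \<Longrightarrow> cmp C (Ys ! k) (Ys' ! k) (Ys ! k) (b k) (a k) = ident C (Ys ! k)"
    "\<And>k. k < length Ys \<Longrightarrow> cmp C (Ys' ! k) (Ys ! k) (Ys' ! k) (a k) (b k) = ident C (Ys' ! k)"
    by metis
  obtain f where f: "f \<in> mor C X X'"
    "\<And>k. k < length Ys \<Longrightarrow> cmp C X X' (Ys' ! k) (\<pi>' k) f = cmp C X (Ys ! k) (Ys' ! k) (a k) (\<pi> k)"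
    using diagonal_map[OF ds len ab(1)] by blast
  obtain g where g: "g \<in> mor C X' X"
    "\<And>k. k < length Ys \<Longrightarrow> cmp C X' X (Ys ! k) (\<pi> k) g = cmp C X' (Ys' ! k) (Ys ! k) (b k) (\<pi>' k)"
    using diagonal_map[OF ds(2,1) len[symmetric], of b, unfolded len, OF ab(2)] by blast
  have "cmp C X X' X g f = ident C X" "cmp C X' X X' f g = ident C X'"
    by (rule diagonal_inverse[OF ds len ab(1-3) f g], assumption+)
      (rule diagonal_inverse[OF ds(2,1) len[symmetric], of b a g f, unfolded len, OF ab(2,1,4) g f], assumption+)
  then show ?thesis
    using isomorphicI[OF dsum_obj(1)[OF ds(1)] dsum_obj(1)[OF ds(2)] iso_morI[OF f(1) g(1)]] by blast
qed

lemma direct_sum_unique: "is_direct_sum C X Ys \<Longrightarrow> is_direct_sum C X' Ys \<Longrightarrow> isomorphic C X X'"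
  using direct_sum_isomorphic[of X Ys X' Ys] isomorphic_refl direct_sum_obj(2) nth_mem by blast

lemma direct_sum_transfer:
  assumes "is_direct_sum C X Ys" "isomorphic C X X'"
  shows "is_direct_sum C X' Ys"
proof -
  obtain \<iota> \<pi> where ds: "dsum X Ys \<iota> \<pi>" using assms(1) by (rule is_direct_sum_dsum)
  obtain f g where o: "X \<in> obj C" "X' \<in> obj C" and m: "f \<in> mor C X X'" "g \<in> mor C X' X"
    and c: "cmp C X X' X g f = ident C X" "cmp C X' X X' f g = ident C X'"
    using assms(2) by (rule isomorphicE)
  have oj: "j < length Ys \<Longrightarrow> Ys ! j \<in> obj C" for j using dsum_obj[OF ds] by simp
  note mj = dsum_mor[OF ds]
  define \<iota>' where "\<iota>' j = cmp C (Ys ! j) X X' f (\<iota> j)" for j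
  define \<pi>' where "\<pi>' j = cmp C X' X (Ys ! j) (\<pi> j) g" for j
  have "h = \<zero>\<^bsub>Hom C W X'\<^esub>"
    if W: "W \<in> obj C" "h \<in> mor C W X'" and z: "\<forall>j<length Ys. cmp C W X' (Ys ! j) (\<pi>' j) h = \<zero>\<^bsub>Hom C W (Ys ! j)\<^esub>" for W h
  proof -
    have "cmp C W X (Ys ! j) (\<pi> j) (cmp C W X' X g h) = \<zero>\<^bsub>Hom C W (Ys ! j)\<^esub>" if j: "j < length Ys" for j
      using z[rule_format, OF j] o W m mj[OF j] oj[OF j] by (simp add: \<pi>'_def cmp_assoc)
    then have "cmp C W X' X g h = \<zero>\<^bsub>Hom C W X\<^esub>" using dsum_kernel[OF ds W(1)] W m o by simp
    then have "cmp C W X X' f (cmp C W X' X g h) = \<zero>\<^bsub>Hom C W X'\<^esub>" using W m o by simp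
    then show ?thesis using W m o by (simp add: cmp_reassoc[OF c(2)])
  qed
  moreover have "cmp C (Ys ! l) X' (Ys ! j) (\<pi>' j) (\<iota>' l) = (if j = l then ident C (Ys ! j) else \<zero>\<^bsub>Hom C (Ys ! l) (Ys ! j)\<^esub>)"
    if "j < length Ys" "l < length Ys" for j l
  proof -
    have "cmp C (Ys ! l) X' (Ys ! j) (\<pi>' j) (\<iota>' l) = cmp C (Ys ! l) X (Ys ! j) (\<pi> j) (\<iota> l)"
      unfolding \<pi>'_def \<iota>'_def using that m mj oj o by (simp add: cmp_assoc cmp_reassoc[OF c(1)])
    then show ?thesis using dsum_cmp[OF ds that] by simp
  qed
  moreover have "\<forall>j<length Ys. \<iota>' j \<in> mor C (Ys ! j) X' \<and> \<pi>' j \<in> mor C X' (Ys ! j)"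
    using m mj oj o by (simp add: \<iota>'_def \<pi>'_def)
  ultimately have "dsum X' Ys \<iota>' \<pi>'"
    unfolding dsum_def using o direct_sum_obj(2)[OF assms(1)] by blast
  then show ?thesis by (rule dsum_is_direct_sum)
qed

text \<open>The new inclusions and projections are composites; orthogonality is checked in the four blocks,
  and joint monicity needs no manipulation of sums.\<close>

lemma direct_sum_append:
  assumes X: "is_direct_sum C X [Y, Z]" and Y: "is_direct_sum C Y Ys" and Z: "is_direct_sum C Z Zs"
  shows "is_direct_sum C X (Ys @ Zs)"
proof -
  obtain i j p q where o: "X \<in> obj C" "Y \<in> obj C" "Z \<in> obj C"
    and m: "i \<in> mor C Y X" "j \<in> mor C Z X" "p \<in> mor C X Y" "q \<in> mor C X Z"
    and c: "cmp C Y X Y p i = ident C Y" "cmp C Z X Z q j = ident C Z"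
      "cmp C Z X Y p j = \<zero>\<^bsub>Hom C Z Y\<^esub>" "cmp C Y X Z q i = \<zero>\<^bsub>Hom C Y Z\<^esub>"
    and s: "cmp C X Y X i p \<oplus>\<^bsub>Hom C X X\<^esub> cmp C X Z X j q = ident C X"
    using X by (rule binary_direct_sumE)
  obtain \<iota>Y \<pi>Y \<iota>Z \<pi>Z where dY: "dsum Y Ys \<iota>Y \<pi>Y" and dZ: "dsum Z Zs \<iota>Z \<pi>Z"
    using Y Z by (auto elim!: is_direct_sum_dsum)
  let ?L = "Ys @ Zs" and ?n = "length Ys"
  define \<iota> where "\<iota> k = (if k < ?n then cmp C (Ys ! k) Y X i (\<iota>Y k) else cmp C (Zs ! (k - ?n)) Z X j (\<iota>Z (k - ?n)))" for k
  define \<pi> where "\<pi> k = (if k < ?n then cmp C X Y (Ys ! k) (\<pi>Y k) p else cmp C X Z (Zs ! (k - ?n)) (\<pi>Z (k - ?n)) q)" for k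
  note oY = dsum_obj(2)[OF dY] and oZ = dsum_obj(2)[OF dZ]
  note mY = dsum_mor[OF dY] and mZ = dsum_mor[OF dZ]
  have mem: "\<forall>k<length ?L. \<iota> k \<in> mor C (?L ! k) X \<and> \<pi> k \<in> mor C X (?L ! k)"
    using o m oY oZ mY mZ by (auto simp: \<iota>_def \<pi>_def nth_append)
  have YY: "cmp C (Ys ! l) X (Ys ! k) (cmp C X Y (Ys ! k) (\<pi>Y k) p) (cmp C (Ys ! l) Y X i (\<iota>Y l))
      = cmp C (Ys ! l) Y (Ys ! k) (\<pi>Y k) (\<iota>Y l)" if "k < ?n" "l < ?n" for k l
    using that o m oY mY by (simp add: cmp_assoc cmp_reassoc[OF c(1)])
  have ZZ: "cmp C (Zs ! l) X (Zs ! k) (cmp C X Z (Zs ! k) (\<pi>Z k) q) (cmp C (Zs ! l) Z X j (\<iota>Z l))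
      = cmp C (Zs ! l) Z (Zs ! k) (\<pi>Z k) (\<iota>Z l)" if "k < length Zs" "l < length Zs" for k l
    using that o m oZ mZ by (simp add: cmp_assoc cmp_reassoc[OF c(2)])
  have YZ: "cmp C (Zs ! l) X (Ys ! k) (cmp C X Y (Ys ! k) (\<pi>Y k) p) (cmp C (Zs ! l) Z X j (\<iota>Z l))
      = \<zero>\<^bsub>Hom C (Zs ! l) (Ys ! k)\<^esub>" if "k < ?n" "l < length Zs" for k l
    using that o m oY oZ mY mZ by (simp add: cmp_assoc cmp_reassoc[OF c(3)])
  have ZY: "cmp C (Ys ! l) X (Zs ! k) (cmp C X Z (Zs ! k) (\<pi>Z k) q) (cmp C (Ys ! l) Y X i (\<iota>Y l))
      = \<zero>\<^bsub>Hom C (Ys ! l) (Zs ! k)\<^esub>" if "k < length Zs" "l < ?n" for k l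
    using that o m oY oZ mY mZ by (simp add: cmp_assoc cmp_reassoc[OF c(4)])
  have orth: "cmp C (?L ! l) X (?L ! k) (\<pi> k) (\<iota> l) = (if k = l then ident C (?L ! k) else \<zero>\<^bsub>Hom C (?L ! l) (?L ! k)\<^esub>)"
    if "k < length ?L" "l < length ?L" for k l
  proof (cases "k < ?n"; cases "l < ?n")
    assume a: "k < ?n" "l < ?n"
    then show ?thesis using YY[OF a] dsum_cmp[OF dY a] by (simp add: \<iota>_def \<pi>_def nth_append)
  next
    assume a: "k < ?n" "\<not> l < ?n"
    then show ?thesis using YZ[of k "l - ?n"] that by (auto simp: \<iota>_def \<pi>_def nth_append)
  next
    assume a: "\<not> k < ?n" "l < ?n"
    then show ?thesis using ZY[of "k - ?n" l] that by (auto simp: \<iota>_def \<pi>_def nth_append)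
  next
    assume a: "\<not> k < ?n" "\<not> l < ?n"
    then have b: "k - ?n < length Zs" "l - ?n < length Zs" using that by auto
    have "k - ?n = l - ?n \<longleftrightarrow> k = l" using a by auto
    then show ?thesis using ZZ[OF b] dsum_cmp[OF dZ b] a by (simp add: \<iota>_def \<pi>_def nth_append)
  qed
  have monic: "h = \<zero>\<^bsub>Hom C W X\<^esub>"
    if W: "W \<in> obj C" "h \<in> mor C W X" and z: "\<forall>k<length ?L. cmp C W X (?L ! k) (\<pi> k) h = \<zero>\<^bsub>Hom C W (?L ! k)\<^esub>" for W h
  proof -
    have "cmp C W X Y p h = \<zero>\<^bsub>Hom C W Y\<^esub>"
    proof (rule dsum_kernel[OF dY W(1)])
      fix k assume k: "k < ?n"
      then have "cmp C W X (Ys ! k) (cmp C X Y (Ys ! k) (\<pi>Y k) p) h = \<zero>\<^bsub>Hom C W (Ys ! k)\<^esub>"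
        using z[rule_format, of k] by (simp add: \<pi>_def nth_append)
      then show "cmp C W Y (Ys ! k) (\<pi>Y k) (cmp C W X Y p h) = \<zero>\<^bsub>Hom C W (Ys ! k)\<^esub>"
        using o m W oY mY k by (simp add: cmp_assoc)
    qed (use o m W in simp)
    moreover have "cmp C W X Z q h = \<zero>\<^bsub>Hom C W Z\<^esub>"
    proof (rule dsum_kernel[OF dZ W(1)])
      fix k assume k: "k < length Zs"
      then have "cmp C W X (Zs ! k) (cmp C X Z (Zs ! k) (\<pi>Z k) q) h = \<zero>\<^bsub>Hom C W (Zs ! k)\<^esub>"
        using z[rule_format, of "?n + k"] by (simp add: \<pi>_def nth_append)
      then show "cmp C W Z (Zs ! k) (\<pi>Z k) (cmp C W X Z q h) = \<zero>\<^bsub>Hom C W (Zs ! k)\<^esub>"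
        using o m W oZ mZ k by (simp add: cmp_assoc)
    qed (use o m W in simp)
    moreover have "h = cmp C W X X (cmp C X Y X i p \<oplus>\<^bsub>Hom C X X\<^esub> cmp C X Z X j q) h"
      using s o m W by simp
    then have "h = cmp C W Y X i (cmp C W X Y p h) \<oplus>\<^bsub>Hom C W X\<^esub> cmp C W Z X j (cmp C W X Z q h)"
      using o m W by (simp add: cmp_add_left cmp_assoc)
    ultimately show ?thesis using o m W by simp
  qed
  have "dsum X ?L \<iota> \<pi>"
    unfolding dsum_def
  proof (intro conjI)
    show "set ?L \<subseteq> obj C" using direct_sum_obj(2)[OF Y] direct_sum_obj(2)[OF Z] by simp
  qed (use o mem orth monic in blast)+
  then show ?thesis by (rule dsum_is_direct_sum)
qed

end

section \<open>Local endomorphism rings and the Krull--Schmidt theorem\<close>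

context linear_category
begin

definition End_ring :: "'o \<Rightarrow> ('k, 'm) module" where
  "End_ring X = (Hom C X X) \<lparr>monoid.mult := cmp C X X X, one := ident C X\<rparr>"

lemma End_ring_simps [simp]:
  "carrier (End_ring X) = mor C X X" "f \<otimes>\<^bsub>End_ring X\<^esub> g = cmp C X X X f g"
  "\<one>\<^bsub>End_ring X\<^esub> = ident C X" "\<zero>\<^bsub>End_ring X\<^esub> = \<zero>\<^bsub>Hom C X X\<^esub>"
  "f \<oplus>\<^bsub>End_ring X\<^esub> g = f \<oplus>\<^bsub>Hom C X X\<^esub> g"
  by (simp_all add: End_ring_def mor_def)

lemma End_ring_add_monoid: "add_monoid (End_ring X) = add_monoid (Hom C X X)"
  by (simp add: End_ring_def mor_def)

lemma End_ring_sum [simp]: "(\<Oplus>\<^bsub>End_ring X\<^esub>j\<in>A. f j) = (\<Oplus>\<^bsub>Hom C X X\<^esub>j\<in>A. f j)"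
  by (simp only: finsum_def End_ring_add_monoid)

lemma End_ring_ring:
  assumes "X \<in> obj C" shows "ring (End_ring X)"
proof (rule ringI)
  show "abelian_group (End_ring X)"
    using Hom_abelian_group[OF assms assms]
    by (simp only: abelian_group_def abelian_monoid_def abelian_group_axioms_def End_ring_add_monoid)
  show "monoid (End_ring X)"
    by (rule monoidI) (use assms in \<open>simp_all add: cmp_assoc\<close>)
qed (use assms in \<open>simp_all add: cmp_add_left cmp_add_right\<close>)

lemma Units_End_ring: "f \<in> Units (End_ring X) \<longleftrightarrow> iso_mor C X X f"
  by (auto simp: Units_def iso_mor_def)

lemma local_End_ring:
  assumes "X \<in> obj C" "local_End C X" shows "local_ring (End_ring X)"
  by (intro local_ring.intro local_ring_axioms.intro End_ring_ring)
    (use assms in \<open>simp_all add: local_End_def Units_End_ring\<close>)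

lemma local_nonzero: "local_End C X \<Longrightarrow> \<not> zero_object C X"
  by (simp add: local_End_def zero_object_iff)

lemma local_idempotent:
  assumes "X \<in> obj C" "local_End C X" "e \<in> mor C X X" "cmp C X X X e e = e"
  shows "e = \<zero>\<^bsub>Hom C X X\<^esub> \<or> e = ident C X"
  using local_ring.idempotent_cases[OF local_End_ring, of X e] assms by simp

text \<open>The composite \<open>i \<circ> p\<close> is a nonzero idempotent of the local ring \<open>End(Z)\<close>, hence the identity.\<close>

lemma retract_of_local:
  assumes Z: "local_End C Z" and r: "retract Y Z" and Y: "\<not> zero_object C Y"
  shows "isomorphic C Y Z"
proof -
  obtain i p where o: "Y \<in> obj C" "Z \<in> obj C" and m: "i \<in> mor C Y Z" "p \<in> mor C Z Y"
    and c: "cmp C Y Z Y p i = ident C Y"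
    using r by (auto simp: retract_def)
  have "cmp C Z Z Z (cmp C Z Y Z i p) (cmp C Z Y Z i p) = cmp C Z Y Z i p"
    using o m by (simp add: cmp_assoc cmp_reassoc[OF c])
  then have "cmp C Z Y Z i p = \<zero>\<^bsub>Hom C Z Z\<^esub> \<or> cmp C Z Y Z i p = ident C Z"
    using local_idempotent[OF o(2) Z] o m by simp
  moreover have "cmp C Z Y Z i p \<noteq> \<zero>\<^bsub>Hom C Z Z\<^esub>"
  proof
    assume z: "cmp C Z Y Z i p = \<zero>\<^bsub>Hom C Z Z\<^esub>"
    have "i = cmp C Y Z Z (cmp C Z Y Z i p) i" using o m c by (simp add: cmp_assoc)
    then have "i = \<zero>\<^bsub>Hom C Y Z\<^esub>" using o m by (simp add: z)
    then show False using c Y o m by (simp add: zero_object_iff)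
  qed
  ultimately show ?thesis using o m c iso_morI isomorphicI by metis
qed

lemma retract_of_unit:
  assumes o: "Y \<in> obj C" "Z \<in> obj C" and m: "f \<in> mor C Y Z" "g \<in> mor C Z Y"
    and u: "iso_mor C Y Y (cmp C Y Z Y g f)"
  shows "retract Y Z"
proof -
  obtain v where v: "v \<in> mor C Y Y" "cmp C Y Y Y v (cmp C Y Z Y g f) = ident C Y"
    using u by (auto simp: iso_mor_def)
  then have "cmp C Y Z Y (cmp C Z Y Y v g) f = ident C Y" using o m by (simp add: cmp_assoc)
  then show ?thesis by (rule retractI[OF o m(1), rotated]) (use o m v in simp)
qed

text \<open>Conjugation with the isomorphism identifies the two endomorphism rings.\<close>

lemma local_iso:
  assumes X: "local_End C X" and iso: "isomorphic C X Y"
  shows "local_End C Y"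
proof -
  obtain h g where o: "X \<in> obj C" "Y \<in> obj C" and m: "h \<in> mor C X Y" "g \<in> mor C Y X"
    and c: "cmp C X Y X g h = ident C X" "cmp C Y X Y h g = ident C Y"
    using iso by (rule isomorphicE)
  have hg: "iso_mor C X Y h" "iso_mor C Y X g" using m c iso_morI by blast+
  define \<phi> where "\<phi> f = cmp C X Y X g (cmp C X Y Y f h)" for f
  have \<phi>m: "\<phi> f \<in> mor C X X" if "f \<in> mor C Y Y" for f using that o m by (simp add: \<phi>_def)
  have inv: "f = cmp C Y X Y h (cmp C Y X X (\<phi> f) g)" if "f \<in> mor C Y Y" for f
    using that o m c by (simp add: \<phi>_def cmp_assoc cmp_reassoc[OF c(2)])
  have iff: "iso_mor C X X (\<phi> f) \<longleftrightarrow> iso_mor C Y Y f" if f: "f \<in> mor C Y Y" for f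
  proof
    assume "iso_mor C Y Y f"
    then show "iso_mor C X X (\<phi> f)" unfolding \<phi>_def using iso_mor_cmp hg o by blast
  next
    assume "iso_mor C X X (\<phi> f)"
    then have "iso_mor C Y Y (cmp C Y X Y h (cmp C Y X X (\<phi> f) g))" using iso_mor_cmp hg o by blast
    then show "iso_mor C Y Y f" using inv[OF f] by simp
  qed
  have \<phi>_add: "\<phi> (f \<oplus>\<^bsub>Hom C Y Y\<^esub> f') = \<phi> f \<oplus>\<^bsub>Hom C X X\<^esub> \<phi> f'" if "f \<in> mor C Y Y" "f' \<in> mor C Y Y" for f f'
    using that o m by (simp add: \<phi>_def cmp_add_left cmp_add_right)
  have "\<not> zero_object C Y"
    using isomorphic_retract[OF iso] zero_object_retract local_nonzero[OF X] by blast
  then have nonzero: "ident C Y \<noteq> \<zero>\<^bsub>Hom C Y Y\<^esub>" using o by (simp add: zero_object_iff)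
  have "\<not> iso_mor C Y Y (f \<oplus>\<^bsub>Hom C Y Y\<^esub> f')"
    if f: "f \<in> mor C Y Y" "f' \<in> mor C Y Y" and n: "\<not> iso_mor C Y Y f" "\<not> iso_mor C Y Y f'" for f f'
  proof -
    have "\<not> iso_mor C X X (\<phi> f \<oplus>\<^bsub>Hom C X X\<^esub> \<phi> f')"
      using X n \<phi>m f iff unfolding local_End_def by blast
    then show ?thesis using iff[of "f \<oplus>\<^bsub>Hom C Y Y\<^esub> f'"] \<phi>_add f o by simp
  qed
  then show ?thesis using nonzero unfolding local_End_def by blast
qed

definition iso_count :: "'o \<Rightarrow> 'o list \<Rightarrow> nat" where
  "iso_count I Ys = length (filter (isomorphic C I) Ys)"

definition local_decomposition :: "'o \<Rightarrow> 'o list \<Rightarrow> bool" where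
  "local_decomposition X Ys \<longleftrightarrow> is_direct_sum C X Ys \<and> (\<forall>Y\<in>set Ys. local_End C Y)"

text \<open>Choose the inclusions \<open>s\<^sub>j : I \<rightarrow> X\<close> of the \<open>Y\<^sub>j \<cong> I\<close> and the projections \<open>r\<^sub>l : X \<rightarrow> I\<close> onto the
  \<open>Z\<^sub>l \<cong> I\<close>.  If there were fewer \<open>Z\<^sub>l\<close> than \<open>Y\<^sub>j\<close>, the system with coefficients \<open>r\<^sub>l \<circ> s\<^sub>j\<close> would have
  a solution \<open>c\<close> modulo the non-units of \<open>End(I)\<close> with some \<open>c\<^sub>k\<close> a unit.  But \<open>c\<^sub>k\<close> is the
  composite of \<open>\<alpha> = \<Sum> s\<^sub>j \<circ> c\<^sub>j\<close> with the projection \<open>\<beta>\<close> onto \<open>Y\<^sub>k\<close>, and inserting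
  \<open>id = \<Sum> \<iota>'\<^sub>l \<circ> \<pi>'\<^sub>l\<close> writes it as a sum of non-units: the summand of a \<open>Z\<^sub>l\<close> not isomorphic to \<open>I\<close> is
  no unit because \<open>I\<close> is no retract of \<open>Z\<^sub>l\<close>, the others by the choice of \<open>c\<close>.\<close>

lemma iso_count_le:
  assumes I: "I \<in> obj C" "local_End C I"
    and Ys: "local_decomposition X Ys" and Zs: "local_decomposition X Zs"
  shows "iso_count I Ys \<le> iso_count I Zs"
proof (rule ccontr)
  define J where "J = {j. j < length Ys \<and> isomorphic C I (Ys ! j)}"
  define L where "L = {l. l < length Zs \<and> isomorphic C I (Zs ! l)}"
  assume "\<not> iso_count I Ys \<le> iso_count I Zs"
  then have card: "card L < card J" by (simp add: iso_count_def length_filter_conv_card J_def L_def)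
  have fin: "finite L" "finite J" by (auto simp: L_def J_def)
  interpret E: local_ring "End_ring I" using local_End_ring I by simp
  obtain \<iota> \<pi> \<iota>' \<pi>' where Y: "dsum X Ys \<iota> \<pi>" and Z: "dsum X Zs \<iota>' \<pi>'"
    using Ys Zs unfolding local_decomposition_def by (auto elim!: is_direct_sum_dsum)
  note X = dsum_obj(1)[OF Y]
  note oY = dsum_obj(2)[OF Y] and oZ = dsum_obj(2)[OF Z]
  note mY = dsum_mor[OF Y] and mZ = dsum_mor[OF Z]
  have "\<forall>j. \<exists>f g. j \<in> J \<longrightarrow> f \<in> mor C I (Ys ! j) \<and> g \<in> mor C (Ys ! j) I \<and> cmp C I (Ys ! j) I g f = ident C I"
    unfolding J_def isomorphic_def iso_mor_def by blast
  then obtain \<phi> \<phi>' where \<phi>: "\<And>j. j \<in> J \<Longrightarrow> \<phi> j \<in> mor C I (Ys ! j)" "\<And>j. j \<in> J \<Longrightarrow> \<phi>' j \<in> mor C (Ys ! j) I"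
    "\<And>j. j \<in> J \<Longrightarrow> cmp C I (Ys ! j) I (\<phi>' j) (\<phi> j) = ident C I"
    by metis
  have "\<forall>l. \<exists>f g. l \<in> L \<longrightarrow> f \<in> mor C I (Zs ! l) \<and> g \<in> mor C (Zs ! l) I \<and> cmp C (Zs ! l) I (Zs ! l) f g = ident C (Zs ! l)"
    unfolding L_def isomorphic_def iso_mor_def by blast
  then obtain \<psi> \<psi>' where \<psi>: "\<And>l. l \<in> L \<Longrightarrow> \<psi> l \<in> mor C I (Zs ! l)" "\<And>l. l \<in> L \<Longrightarrow> \<psi>' l \<in> mor C (Zs ! l) I"
    "\<And>l. l \<in> L \<Longrightarrow> cmp C (Zs ! l) I (Zs ! l) (\<psi> l) (\<psi>' l) = ident C (Zs ! l)"
    by metis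
  have Jl: "j < length Ys" if "j \<in> J" for j using that by (simp add: J_def)
  have Ll: "l < length Zs" if "l \<in> L" for l using that by (simp add: L_def)
  define s where "s j = cmp C I (Ys ! j) X (\<iota> j) (\<phi> j)" for j
  have sm: "s j \<in> mor C I X" if "j \<in> J" for j using that \<phi> Jl oY mY I X by (simp add: s_def)
  define r where "r l = cmp C X (Zs ! l) I (\<psi>' l) (\<pi>' l)" for l
  have rm: "r l \<in> mor C X I" if "l \<in> L" for l using that \<psi> Ll oZ mZ I X by (simp add: r_def)
  define a where "a l j = cmp C I X I (r l) (s j)" for l j
  have am: "a l j \<in> mor C I I" if "l \<in> L" "j \<in> J" for l j using that sm rm I X by (simp add: a_def)
  obtain c where cm: "\<And>j. j \<in> J \<Longrightarrow> c j \<in> mor C I I" and cu: "\<exists>j\<in>J. c j \<in> Units (End_ring I)"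
    and cn: "\<And>l. l \<in> L \<Longrightarrow> (\<Oplus>\<^bsub>Hom C I I\<^esub>j\<in>J. cmp C I I I (a l j) (c j)) \<notin> Units (End_ring I)"
  proof -
    obtain c where "\<forall>j\<in>J. c j \<in> carrier (End_ring I)" "\<exists>j\<in>J. c j \<in> Units (End_ring I)"
      "\<forall>l\<in>L. (\<Oplus>\<^bsub>End_ring I\<^esub>j\<in>J. a l j \<otimes>\<^bsub>End_ring I\<^esub> c j) \<notin> Units (End_ring I)"
      using E.homogeneous_system[OF fin card, of a] am unfolding End_ring_simps by blast
    then show thesis using that unfolding End_ring_simps End_ring_sum by blast
  qed
  obtain k where k: "k \<in> J" "c k \<in> Units (End_ring I)" using cu by blast
  define \<alpha> where "\<alpha> = (\<Oplus>\<^bsub>Hom C I X\<^esub>j\<in>J. cmp C I I X (s j) (c j))"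
  have \<alpha>: "\<alpha> \<in> mor C I X" unfolding \<alpha>_def using sm cm I X by (intro sum_mor cmp_mor) auto
  define \<beta> where "\<beta> = cmp C X (Ys ! k) I (\<phi>' k) (\<pi> k)"
  have \<beta>: "\<beta> \<in> mor C X I" unfolding \<beta>_def using \<phi>(2)[OF k(1)] Jl[OF k(1)] oY mY I X by simp
  have bs: "cmp C I X I \<beta> (s j) = (if j = k then ident C I else \<zero>\<^bsub>Hom C I I\<^esub>)" if j: "j \<in> J" for j
  proof -
    have "cmp C I X I \<beta> (s j) = cmp C I (Ys ! k) I (\<phi>' k) (cmp C I X (Ys ! k) (\<pi> k) (cmp C I (Ys ! j) X (\<iota> j) (\<phi> j)))"
      unfolding \<beta>_def s_def using I X \<phi>(1)[OF j] \<phi>(2)[OF k(1)] Jl[OF j] Jl[OF k(1)] oY mY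
      by (simp add: cmp_assoc)
    also have "cmp C I X (Ys ! k) (\<pi> k) (cmp C I (Ys ! j) X (\<iota> j) (\<phi> j))
      = cmp C I (Ys ! j) (Ys ! k) (if k = j then ident C (Ys ! k) else \<zero>\<^bsub>Hom C (Ys ! j) (Ys ! k)\<^esub>) (\<phi> j)"
      using I X \<phi>(1)[OF j] Jl[OF j] Jl[OF k(1)] oY mY
      by (intro cmp_reassoc[OF dsum_cmp[OF Y]]) simp_all
    finally show ?thesis
      using I \<phi>(1)[OF j] \<phi>(2,3)[OF k(1)] Jl[OF j] Jl[OF k(1)] oY by (auto split: if_splits)
  qed
  have "c k = cmp C I X I \<beta> \<alpha>"
  proof -
    have "cmp C I X I \<beta> \<alpha> = (\<Oplus>\<^bsub>Hom C I I\<^esub>j\<in>J. cmp C I X I \<beta> (cmp C I I X (s j) (c j)))"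
      unfolding \<alpha>_def using I X \<beta> sm cm fin by (intro cmp_sum_right) auto
    also have "\<dots> = (\<Oplus>\<^bsub>Hom C I I\<^esub>j\<in>J. if j = k then c j else \<zero>\<^bsub>Hom C I I\<^esub>)"
    proof (rule sum_mor_cong[OF I(1) I(1)])
      fix j assume j: "j \<in> J"
      show "cmp C I X I \<beta> (cmp C I I X (s j) (c j)) = (if j = k then c j else \<zero>\<^bsub>Hom C I I\<^esub>)"
        using cmp_reassoc[OF bs[OF j], of I "c j"] I X \<beta> sm[OF j] cm[OF j] by auto
      show "(if j = k then c j else \<zero>\<^bsub>Hom C I I\<^esub>) \<in> mor C I I" using I cm[OF j] by auto
    qed
    also have "\<dots> = c k" using I fin k cm by (intro sum_mor_singleton) auto
    finally show ?thesis by simp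
  qed
  also have "cmp C I X I \<beta> \<alpha> = (\<Oplus>\<^bsub>Hom C I I\<^esub>l\<in>{..<length Zs}.
      cmp C I (Zs ! l) I (cmp C (Zs ! l) X I \<beta> (\<iota>' l)) (cmp C I X (Zs ! l) (\<pi>' l) \<alpha>))"
  proof -
    have "cmp C I X I \<beta> \<alpha> = cmp C I X I \<beta> (\<Oplus>\<^bsub>Hom C I X\<^esub>l\<in>{..<length Zs}. cmp C I (Zs ! l) X (\<iota>' l) (cmp C I X (Zs ! l) (\<pi>' l) \<alpha>))"
      using dsum_expand_left[OF Z I(1) \<alpha>] by simp
    also have "\<dots> = (\<Oplus>\<^bsub>Hom C I I\<^esub>l\<in>{..<length Zs}. cmp C I X I \<beta> (cmp C I (Zs ! l) X (\<iota>' l) (cmp C I X (Zs ! l) (\<pi>' l) \<alpha>)))"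
      using I X \<alpha> \<beta> by (intro cmp_sum_right) (simp_all add: oZ mZ)
    also have "\<dots> = (\<Oplus>\<^bsub>Hom C I I\<^esub>l\<in>{..<length Zs}.
      cmp C I (Zs ! l) I (cmp C (Zs ! l) X I \<beta> (\<iota>' l)) (cmp C I X (Zs ! l) (\<pi>' l) \<alpha>))"
      using I X \<alpha> \<beta> by (intro sum_mor_cong) (simp_all add: oZ mZ cmp_assoc)
    finally show ?thesis .
  qed
  also have "\<dots> \<notin> Units (End_ring I)"
    unfolding End_ring_sum[symmetric]
  proof (rule E.finsum_nonunit)
    fix l assume "l \<in> {..<length Zs}"
    then have l: "l < length Zs" by simp
    note ml = mZ[OF l] and ol = oZ[OF l]
    show "cmp C I (Zs ! l) I (cmp C (Zs ! l) X I \<beta> (\<iota>' l)) (cmp C I X (Zs ! l) (\<pi>' l) \<alpha>) \<in> carrier (End_ring I)"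
      using I X \<alpha> \<beta> ml ol by simp
    show "cmp C I (Zs ! l) I (cmp C (Zs ! l) X I \<beta> (\<iota>' l)) (cmp C I X (Zs ! l) (\<pi>' l) \<alpha>) \<notin> Units (End_ring I)"
    proof (cases "l \<in> L")
      case False
      have loc: "local_End C (Zs ! l)" using Zs l unfolding local_decomposition_def by simp
      show ?thesis
      proof
        assume "cmp C I (Zs ! l) I (cmp C (Zs ! l) X I \<beta> (\<iota>' l)) (cmp C I X (Zs ! l) (\<pi>' l) \<alpha>) \<in> Units (End_ring I)"
        then have "retract I (Zs ! l)"
          unfolding Units_End_ring using I X \<alpha> \<beta> ml ol by (intro retract_of_unit[of I "Zs ! l"]) simp_all
        then have "isomorphic C I (Zs ! l)" using retract_of_local[OF loc] local_nonzero[OF I(2)] by simp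
        then show False using False l by (simp add: L_def)
      qed
    next
      case True
      have e: "cmp C I X I (r l) \<alpha> = (\<Oplus>\<^bsub>Hom C I I\<^esub>j\<in>J. cmp C I I I (a l j) (c j))"
      proof -
        have "cmp C I X I (r l) \<alpha> = (\<Oplus>\<^bsub>Hom C I I\<^esub>j\<in>J. cmp C I X I (r l) (cmp C I I X (s j) (c j)))"
          unfolding \<alpha>_def using I X rm[OF True] sm cm fin by (intro cmp_sum_right) auto
        also have "\<dots> = (\<Oplus>\<^bsub>Hom C I I\<^esub>j\<in>J. cmp C I I I (a l j) (c j))"
          using I X rm[OF True] sm cm by (intro sum_mor_cong) (simp_all add: a_def cmp_assoc)
        finally show ?thesis .
      qed
      have "cmp C I (Zs ! l) I (cmp C (Zs ! l) X I \<beta> (\<iota>' l)) (cmp C I X (Zs ! l) (\<pi>' l) \<alpha>)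
        = cmp C I I I (cmp C I (Zs ! l) I (cmp C (Zs ! l) X I \<beta> (\<iota>' l)) (\<psi> l)) (cmp C I X I (r l) \<alpha>)"
        unfolding r_def using I X \<alpha> \<beta> ml ol \<psi>(1,2)[OF True]
        by (simp add: cmp_assoc cmp_reassoc[OF \<psi>(3)[OF True]])
      moreover have "cmp C I X I (r l) \<alpha> \<notin> Units (End_ring I)" using cn[OF True] unfolding e .
      moreover have "cmp C I X I (r l) \<alpha> \<in> mor C I I" "cmp C I (Zs ! l) I (cmp C (Zs ! l) X I \<beta> (\<iota>' l)) (\<psi> l) \<in> mor C I I"
        using rm[OF True] I X \<alpha> \<beta> ml ol \<psi>(1)[OF True] by simp_all
      ultimately show ?thesis using E.unit_factors(2) unfolding End_ring_simps by metis
    qed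
  qed simp
  finally show False using k(2) by simp
qed

lemma local_decomposition_append:
  assumes "is_direct_sum C X [Y, Z]" "local_decomposition Y Ys" "local_decomposition Z Zs"
  shows "local_decomposition X (Ys @ Zs)"
  using assms direct_sum_append unfolding local_decomposition_def by auto

text \<open>The choice of decomposition is immaterial by \<open>iso_count_le\<close>.\<close>

definition mult_of :: "'o \<Rightarrow> 'o \<Rightarrow> nat" where
  "mult_of I X = iso_count I (SOME Ys. local_decomposition X Ys)"

lemma mult_of_eq:
  assumes "I \<in> obj C" "local_End C I" "local_decomposition X Ys"
  shows "mult_of I X = iso_count I Ys"
proof -
  have "local_decomposition X (SOME Ys. local_decomposition X Ys)" using assms(3) by (rule someI)
  then show ?thesis
    unfolding mult_of_def using iso_count_le[OF assms(1,2)] assms(3) by (intro antisym) blast+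
qed

lemma mult_of_local:
  assumes "I \<in> obj C" "local_End C I" "Y \<in> obj C" "local_End C Y"
  shows "mult_of I Y = (if isomorphic C I Y then 1 else 0)"
proof -
  have "local_decomposition Y [Y]"
    using assms direct_sum_singleton by (simp add: local_decomposition_def)
  then show ?thesis using mult_of_eq[OF assms(1,2)] by (simp add: iso_count_def)
qed

text \<open>The projection onto a direct summand is an idempotent of a local ring, hence zero or the identity.\<close>

lemma local_indecomposable:
  assumes X: "X \<in> obj C" "local_End C X"
  shows "indecomposable C X"
  unfolding indecomposable_def
proof (intro conjI ballI impI)
  show "\<not> zero_object C X" using local_nonzero X by simp
  fix Y Z assume s: "is_direct_sum C X [Y, Z]"
  obtain i j p q where o: "X \<in> obj C" "Y \<in> obj C" "Z \<in> obj C"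
    and m: "i \<in> mor C Y X" "j \<in> mor C Z X" "p \<in> mor C X Y" "q \<in> mor C X Z"
    and c: "cmp C Y X Y p i = ident C Y" "cmp C Z X Z q j = ident C Z" "cmp C Y X Z q i = \<zero>\<^bsub>Hom C Y Z\<^esub>"
    using s by (rule binary_direct_sumE)
  have "cmp C X X X (cmp C X Y X i p) (cmp C X Y X i p) = cmp C X Y X i p"
    using o m by (simp add: cmp_assoc cmp_reassoc[OF c(1)])
  then have "cmp C X Y X i p = \<zero>\<^bsub>Hom C X X\<^esub> \<or> cmp C X Y X i p = ident C X"
    using local_idempotent[OF X] o m by simp
  then show "zero_object C Y \<or> zero_object C Z"
  proof
    assume z: "cmp C X Y X i p = \<zero>\<^bsub>Hom C X X\<^esub>"
    have "i = cmp C Y X X (cmp C X Y X i p) i" using o m c by (simp add: cmp_assoc)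
    then have "i = \<zero>\<^bsub>Hom C Y X\<^esub>" using o m by (simp add: z)
    then show ?thesis using c o m by (simp add: zero_object_iff)
  next
    assume e: "cmp C X Y X i p = ident C X"
    have "q = cmp C X X Z q (cmp C X Y X i p)" using o m e by simp
    also have "\<dots> = \<zero>\<^bsub>Hom C X Z\<^esub>" using o m by (simp add: cmp_reassoc[OF c(3)])
    finally show ?thesis using c o m by (simp add: zero_object_iff)
  qed
qed (use X in simp)

end

context additive_linear_category
begin

text \<open>Build \<open>Y \<oplus> \<Oplus> Ys\<close> and compare with \<open>X\<close> by uniqueness of direct sums.\<close>

lemma direct_sum_Cons:
  assumes "is_direct_sum C X (Y # Ys)"
  obtains Z where "is_direct_sum C X [Y, Z]" "is_direct_sum C Z Ys"
proof -
  have o: "Y \<in> obj C" "set Ys \<subseteq> obj C" using direct_sum_obj(2)[OF assms] by auto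
  obtain Z where Z: "is_direct_sum C Z Ys" using finite_direct_sums o by blast
  then obtain X' where X': "is_direct_sum C X' [Y, Z]"
    using finite_direct_sums[of "[Y, Z]"] o direct_sum_obj(1)[OF Z] by auto
  have "is_direct_sum C X' (Y # Ys)"
    using direct_sum_append[OF X' direct_sum_singleton[OF o(1)] Z] by simp
  then have "isomorphic C X' X" using direct_sum_unique assms by blast
  then show thesis using that direct_sum_transfer[OF X'] Z by blast
qed

end

locale krull_schmidt_category = additive_linear_category +
  assumes krull_schmidt: "Krull_Remak_Schmidt C"
begin

lemma local_decomposition_exists:
  assumes "X \<in> obj C" obtains Ys where "local_decomposition X Ys"
  using krull_schmidt assms unfolding Krull_Remak_Schmidt_def local_decomposition_def by blast

text \<open>An indecomposable object is isomorphic to any nonzero member of its decomposition into objects with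
  local endomorphism rings.\<close>

lemma indecomposable_local:
  assumes X: "indecomposable C X"
  shows "local_End C X"
proof -
  have o: "X \<in> obj C" "\<not> zero_object C X" using X by (auto simp: indecomposable_def)
  obtain Ys where Ys: "is_direct_sum C X Ys" "\<forall>Y\<in>set Ys. local_End C Y"
    by (rule local_decomposition_exists[OF o(1), unfolded local_decomposition_def]) blast
  show ?thesis
  proof (cases Ys)
    case Nil
    then show ?thesis using Ys o by (simp add: zero_object_def)
  next
    case (Cons Y Ys')
    obtain Z where s: "is_direct_sum C X [Y, Z]" by (rule direct_sum_Cons[OF Ys(1)[unfolded Cons]])
    then have "zero_object C Y \<or> zero_object C Z"
      using X direct_sum_obj(2)[OF s] unfolding indecomposable_def by simp
    then have "zero_object C Z" using local_nonzero Ys(2) Cons by auto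
    then have "isomorphic C Y X" using direct_sum_with_zero s by blast
    then show ?thesis using local_iso Ys(2) Cons by auto
  qed
qed

lemma indecomposable_iff: "indecomposable C X \<longleftrightarrow> X \<in> obj C \<and> local_End C X"
  using indecomposable_local[of X] local_indecomposable[of X] unfolding indecomposable_def by blast

lemma mult_of_direct_sum:
  assumes I: "I \<in> obj C" "local_End C I" and X: "is_direct_sum C X [Y, Z]"
  shows "mult_of I X = mult_of I Y + mult_of I Z"
proof -
  have o: "Y \<in> obj C" "Z \<in> obj C" using direct_sum_obj(2)[OF X] by auto
  obtain Ys where d1: "local_decomposition Y Ys" using o(1) by (rule local_decomposition_exists)
  obtain Zs where d2: "local_decomposition Z Zs" using o(2) by (rule local_decomposition_exists)
  note d = d1 d2
  show ?thesis
    using mult_of_eq[OF I local_decomposition_append[OF X d]] mult_of_eq[OF I d(1)] mult_of_eq[OF I d(2)]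
    by (simp add: iso_count_def)
qed

end

section \<open>Triangulated categories\<close>

context triangulated_category
begin

declare shift_obj [simp] shift_ident [simp]

lemma shift_linear: "\<lbrakk>X \<in> obj C; Y \<in> obj C\<rbrakk>
    \<Longrightarrow> linear_map K (Hom C X Y) (Hom C (shift C X) (shift C Y)) (shift_mor C X Y)"
  using shift_fully_faithful by (simp add: linear_iso_def)

lemma shift_mor_mor [simp]: "\<lbrakk>X \<in> obj C; Y \<in> obj C; f \<in> mor C X Y\<rbrakk>
    \<Longrightarrow> shift_mor C X Y f \<in> mor C (shift C X) (shift C Y)"
  using shift_linear[of X Y] by (auto simp: linear_map_def mor_def)

lemma shift_zero [simp]: "\<lbrakk>X \<in> obj C; Y \<in> obj C\<rbrakk>
    \<Longrightarrow> shift_mor C X Y \<zero>\<^bsub>Hom C X Y\<^esub> = \<zero>\<^bsub>Hom C (shift C X) (shift C Y)\<^esub>"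
  by (rule linear_map_zero[OF Hom_module Hom_module shift_linear]) simp_all

lemma shift_minus: "\<lbrakk>X \<in> obj C; Y \<in> obj C; f \<in> mor C X Y\<rbrakk>
    \<Longrightarrow> shift_mor C X Y (\<ominus>\<^bsub>Hom C X Y\<^esub> f) = \<ominus>\<^bsub>Hom C (shift C X) (shift C Y)\<^esub> shift_mor C X Y f"
  by (rule linear_map_minus[OF Hom_module Hom_module shift_linear]) (simp_all add: mor_def)

lemma shift_add: "\<lbrakk>X \<in> obj C; Y \<in> obj C; f \<in> mor C X Y; g \<in> mor C X Y\<rbrakk>
    \<Longrightarrow> shift_mor C X Y (f \<oplus>\<^bsub>Hom C X Y\<^esub> g) =
      shift_mor C X Y f \<oplus>\<^bsub>Hom C (shift C X) (shift C Y)\<^esub> shift_mor C X Y g"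
  using shift_linear[of X Y] by (simp add: linear_map_def mor_def)

lemma shift_sum: "\<lbrakk>X \<in> obj C; Y \<in> obj C; finite A; \<And>j. j \<in> A \<Longrightarrow> f j \<in> mor C X Y\<rbrakk>
    \<Longrightarrow> shift_mor C X Y (\<Oplus>\<^bsub>Hom C X Y\<^esub>j\<in>A. f j)
      = (\<Oplus>\<^bsub>Hom C (shift C X) (shift C Y)\<^esub>j\<in>A. shift_mor C X Y (f j))"
  by (rule linear_map_finsum[OF Hom_module Hom_module shift_linear]) (auto simp: mor_def)

lemma shift_inject: "\<lbrakk>X \<in> obj C; Y \<in> obj C; f \<in> mor C X Y; g \<in> mor C X Y; shift_mor C X Y f = shift_mor C X Y g\<rbrakk>
    \<Longrightarrow> f = g"
  using shift_fully_faithful[of X Y] unfolding linear_iso_def mor_def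
  by (meson bij_betw_imp_inj_on inj_onD)

lemma shift_surject:
  assumes "X \<in> obj C" "Y \<in> obj C" "g \<in> mor C (shift C X) (shift C Y)"
  obtains f where "f \<in> mor C X Y" "g = shift_mor C X Y f"
  using shift_fully_faithful[OF assms(1,2)] assms(3) that unfolding linear_iso_def mor_def bij_betw_def
  by blast

lemma shift_direct_sum:
  assumes "is_direct_sum C X Ys"
  shows "is_direct_sum C (shift C X) (map (shift C) Ys)"
proof -
  obtain \<iota> \<pi> where ds: "dsum X Ys \<iota> \<pi>" using assms by (rule is_direct_sum_dsum)
  note o = dsum_obj[OF ds] and m = dsum_mor[OF ds]
  define \<iota>' where "\<iota>' j = shift_mor C (Ys ! j) X (\<iota> j)" for j
  define \<pi>' where "\<pi>' j = shift_mor C X (Ys ! j) (\<pi> j)" for j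
  let ?Y = "\<lambda>j. shift C (Ys ! j)"
  have mem: "\<forall>j<length Ys. \<iota>' j \<in> mor C (?Y j) (shift C X) \<and> \<pi>' j \<in> mor C (shift C X) (?Y j)"
    using o m by (simp add: \<iota>'_def \<pi>'_def)
  have orth: "\<forall>j<length Ys. \<forall>l<length Ys. cmp C (?Y l) (shift C X) (?Y j) (\<pi>' j) (\<iota>' l) =
      (if j = l then ident C (?Y j) else \<zero>\<^bsub>Hom C (?Y l) (?Y j)\<^esub>)"
  proof (intro allI impI)
    fix j l assume jl: "j < length Ys" "l < length Ys"
    have "cmp C (?Y l) (shift C X) (?Y j) (\<pi>' j) (\<iota>' l) = shift_mor C (Ys ! l) (Ys ! j) (cmp C (Ys ! l) X (Ys ! j) (\<pi> j) (\<iota> l))"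
      using jl o m by (simp add: \<iota>'_def \<pi>'_def shift_cmp)
    then show "cmp C (?Y l) (shift C X) (?Y j) (\<pi>' j) (\<iota>' l) =
      (if j = l then ident C (?Y j) else \<zero>\<^bsub>Hom C (?Y l) (?Y j)\<^esub>)"
      using jl o dsum_cmp[OF ds jl] by simp
  qed
  have "(\<Oplus>\<^bsub>Hom C (shift C X) (shift C X)\<^esub>j\<in>{..<length Ys}. cmp C (shift C X) (?Y j) (shift C X) (\<iota>' j) (\<pi>' j))
     = (\<Oplus>\<^bsub>Hom C (shift C X) (shift C X)\<^esub>j\<in>{..<length Ys}. shift_mor C X X (cmp C X (Ys ! j) X (\<iota> j) (\<pi> j)))"
    using o m by (intro sum_mor_cong) (simp_all add: \<iota>'_def \<pi>'_def shift_cmp)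
  also have "\<dots> = shift_mor C X X (\<Oplus>\<^bsub>Hom C X X\<^esub>j\<in>{..<length Ys}. cmp C X (Ys ! j) X (\<iota> j) (\<pi> j))"
    using o m by (intro shift_sum[symmetric]) simp_all
  finally have sum: "(\<Oplus>\<^bsub>Hom C (shift C X) (shift C X)\<^esub>j\<in>{..<length Ys}. cmp C (shift C X) (?Y j) (shift C X) (\<iota>' j) (\<pi>' j))
     = ident C (shift C X)"
    using dsum_sum[OF ds] o by simp
  have sum': "(\<Oplus>\<^bsub>Hom C (shift C X) (shift C X)\<^esub>j\<in>{..<length Ys}.
      cmp C (shift C X) (map (shift C) Ys ! j) (shift C X) (\<iota>' j) (\<pi>' j)) = ident C (shift C X)"
    unfolding sum[symmetric] using o mem by (intro sum_mor_cong) simp_all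
  have "set (map (shift C) Ys) \<subseteq> obj C" using direct_sum_obj(2)[OF assms] by auto
  moreover have "\<forall>j<length (map (shift C) Ys). \<iota>' j \<in> mor C (map (shift C) Ys ! j) (shift C X) \<and> \<pi>' j \<in> mor C (shift C X) (map (shift C) Ys ! j)"
    using mem by simp
  moreover have "\<forall>j<length (map (shift C) Ys). \<forall>l<length (map (shift C) Ys).
      cmp C (map (shift C) Ys ! l) (shift C X) (map (shift C) Ys ! j) (\<pi>' j) (\<iota>' l) =
      (if j = l then ident C (map (shift C) Ys ! j) else \<zero>\<^bsub>Hom C (map (shift C) Ys ! l) (map (shift C) Ys ! j)\<^esub>)"
    using orth by simp
  ultimately show ?thesis
    unfolding is_direct_sum_def using shift_obj[OF o(1)] sum' unfolding length_map by blast
qed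

lemma shift_zero_object: "zero_object C X \<Longrightarrow> zero_object C (shift C X)"
  using shift_direct_sum[of X "[]"] by (simp add: zero_object_def)

lemma shift_iso_mor:
  assumes "X \<in> obj C" "Y \<in> obj C" "f \<in> mor C X Y"
  shows "iso_mor C (shift C X) (shift C Y) (shift_mor C X Y f) \<longleftrightarrow> iso_mor C X Y f"
proof
  assume "iso_mor C X Y f"
  then obtain g where g: "g \<in> mor C Y X" "cmp C X Y X g f = ident C X" "cmp C Y X Y f g = ident C Y"
    by (auto simp: iso_mor_def)
  show "iso_mor C (shift C X) (shift C Y) (shift_mor C X Y f)"
    by (rule iso_morI[of _ _ _ "shift_mor C Y X g"]) (use assms g in \<open>simp_all flip: shift_cmp\<close>)
next
  assume "iso_mor C (shift C X) (shift C Y) (shift_mor C X Y f)"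
  then obtain g' where g': "g' \<in> mor C (shift C Y) (shift C X)"
    "cmp C (shift C X) (shift C Y) (shift C X) g' (shift_mor C X Y f) = ident C (shift C X)"
    "cmp C (shift C Y) (shift C X) (shift C Y) (shift_mor C X Y f) g' = ident C (shift C Y)"
    by (auto simp: iso_mor_def)
  obtain g where g: "g \<in> mor C Y X" "g' = shift_mor C Y X g" using shift_surject[OF assms(2,1) g'(1)] .
  have "cmp C X Y X g f = ident C X"
    by (rule shift_inject[of X X]) (use assms g g' in \<open>simp_all add: shift_cmp\<close>)
  moreover have "cmp C Y X Y f g = ident C Y"
    by (rule shift_inject[of Y Y]) (use assms g g' in \<open>simp_all add: shift_cmp\<close>)
  ultimately show "iso_mor C X Y f" using assms g iso_morI by blast
qed

lemma shift_isomorphic_iff: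
  assumes "X \<in> obj C" "Y \<in> obj C"
  shows "isomorphic C (shift C X) (shift C Y) \<longleftrightarrow> isomorphic C X Y"
proof
  assume "isomorphic C (shift C X) (shift C Y)"
  then obtain g where g: "iso_mor C (shift C X) (shift C Y) g" by (auto simp: isomorphic_def)
  then have "g \<in> mor C (shift C X) (shift C Y)" by (simp add: iso_mor_def)
  then obtain f where "f \<in> mor C X Y" "g = shift_mor C X Y f" by (rule shift_surject[OF assms])
  then show "isomorphic C X Y" using shift_iso_mor assms g isomorphicI by blast
next
  assume "isomorphic C X Y"
  then obtain f where f: "iso_mor C X Y f" by (auto simp: isomorphic_def)
  then have "f \<in> mor C X Y" by (simp add: iso_mor_def)
  then show "isomorphic C (shift C X) (shift C Y)"
    using shift_iso_mor[OF assms] f isomorphicI[OF shift_obj[OF assms(1)] shift_obj[OF assms(2)]] by blast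
qed

lemma shift_local:
  assumes X: "X \<in> obj C" "local_End C X"
  shows "local_End C (shift C X)"
  unfolding local_End_def
proof (intro conjI ballI impI)
  show "ident C (shift C X) \<noteq> \<zero>\<^bsub>Hom C (shift C X) (shift C X)\<^esub>"
    using X shift_inject[of X X "ident C X" "\<zero>\<^bsub>Hom C X X\<^esub>"] by (auto simp: local_End_def)
  fix f g assume "f \<in> mor C (shift C X) (shift C X)" "g \<in> mor C (shift C X) (shift C X)"
    and n: "\<not> iso_mor C (shift C X) (shift C X) f" "\<not> iso_mor C (shift C X) (shift C X) g"
  then obtain f' g' where f: "f' \<in> mor C X X" "f = shift_mor C X X f'" and g: "g' \<in> mor C X X" "g = shift_mor C X X g'"
    using shift_surject[OF X(1) X(1)] by metis
  have "\<not> iso_mor C X X (f' \<oplus>\<^bsub>Hom C X X\<^esub> g')"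
    using n f g X shift_iso_mor unfolding local_End_def by blast
  then show "\<not> iso_mor C (shift C X) (shift C X) (f \<oplus>\<^bsub>Hom C (shift C X) (shift C X)\<^esub> g)"
    using shift_iso_mor[OF X(1) X(1), of "f' \<oplus>\<^bsub>Hom C X X\<^esub> g'"] f g X(1) by (simp add: shift_add)
qed

subsection \<open>Exactness\<close>

abbreviation triangle :: "'o \<Rightarrow> 'o \<Rightarrow> 'o \<Rightarrow> 'm \<Rightarrow> 'm \<Rightarrow> 'm \<Rightarrow> bool" where
  "triangle X Y Z u v w \<equiv> (X, Y, Z, u, v, w) \<in> triangles C"

lemma triangleD:
  assumes "triangle X Y Z u v w"
  shows "X \<in> obj C" "Y \<in> obj C" "Z \<in> obj C" "u \<in> mor C X Y" "v \<in> mor C Y Z" "w \<in> mor C Z (shift C X)"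
  using triangles_candidate[OF assms] by (simp_all add: candidate_triangle_def)

lemma rotate: "triangle X Y Z u v w \<Longrightarrow>
    triangle Y Z (shift C X) v w (\<ominus>\<^bsub>Hom C (shift C X) (shift C Y)\<^esub> shift_mor C X Y u)"
  using TR2_rotation triangles_candidate by blast

lemma cone_exists:
  assumes "X \<in> obj C" "Y \<in> obj C" "u \<in> mor C X Y"
  obtains Z v w where "triangle X Y Z u v w"
  using TR1_cone[OF assms] by blast

lemma zero_object_exists: obtains Z where "zero_object C Z"
  using finite_direct_sums[of "[]"] by (auto simp: zero_object_def)

lemma zero_object_obj: "zero_object C Z \<Longrightarrow> Z \<in> obj C"
  by (simp add: zero_object_iff)

text \<open>The triangle of an identity, rotated backwards; comparison with it turns axiom TR3 into the
  exactness statements below.\<close>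

lemma zero_ident_triangle:
  assumes "W \<in> obj C" "zero_object C Z"
  shows "triangle Z W W \<zero>\<^bsub>Hom C Z W\<^esub> (ident C W) \<zero>\<^bsub>Hom C W (shift C Z)\<^esub>"
proof -
  have Z: "Z \<in> obj C" using assms by (simp add: zero_object_obj)
  have "candidate_triangle C Z W W \<zero>\<^bsub>Hom C Z W\<^esub> (ident C W) \<zero>\<^bsub>Hom C W (shift C Z)\<^esub>"
    using assms(1) Z by (simp add: candidate_triangle_def)
  then show ?thesis
    using TR2_rotation TR1_ident[OF assms(1) shift_zero_object[OF assms(2)]] assms(1) Z by simp
qed

lemma triangle_comp_zero:
  assumes t: "triangle X Y Z u v w"
  shows "cmp C X Y Z v u = \<zero>\<^bsub>Hom C X Z\<^esub>"
proof -
  note t' = triangleD[OF t]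
  obtain N where N: "zero_object C N" by (rule zero_object_exists)
  note N' = zero_object_obj[OF N]
  obtain c where "triangle_morphism C (X, X, N, ident C X, \<zero>\<^bsub>Hom C X N\<^esub>, \<zero>\<^bsub>Hom C N (shift C X)\<^esub>) (X, Y, Z, u, v, w) (ident C X) u c"
    using TR3_morphism[OF TR1_ident[OF t'(1) N] t, of "ident C X" u] t' by auto
  then show ?thesis using t' N' by (auto simp: triangle_morphism_def)
qed

lemma triangle_comp_zero': "triangle X Y Z u v w \<Longrightarrow> cmp C Y Z (shift C X) w v = \<zero>\<^bsub>Hom C Y (shift C X)\<^esub>"
  using triangle_comp_zero rotate by blast

lemma triangle_comp_zero'':
  assumes t: "triangle X Y Z u v w"
  shows "cmp C Z (shift C X) (shift C Y) (shift_mor C X Y u) w = \<zero>\<^bsub>Hom C Z (shift C Y)\<^esub>"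
  using triangle_comp_zero'[OF rotate[OF t]] triangleD[OF t] by (simp add: cmp_minus_left)

lemma weak_cokernel:
  assumes t: "triangle X Y Z u v w" and W: "W \<in> obj C" and g: "g \<in> mor C Y W" "cmp C X Y W g u = \<zero>\<^bsub>Hom C X W\<^esub>"
  obtains h where "h \<in> mor C Z W" "g = cmp C Y Z W h v"
proof -
  note t' = triangleD[OF t]
  obtain N where N: "zero_object C N" by (rule zero_object_exists)
  note N' = zero_object_obj[OF N]
  obtain c where "triangle_morphism C (X, Y, Z, u, v, w) (N, W, W, \<zero>\<^bsub>Hom C N W\<^esub>, ident C W, \<zero>\<^bsub>Hom C W (shift C N)\<^esub>) \<zero>\<^bsub>Hom C X N\<^esub> g c"
    using TR3_morphism[OF t zero_ident_triangle[OF W N], of "\<zero>\<^bsub>Hom C X N\<^esub>" g] t' N' W g by auto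
  then have "c \<in> mor C Z W" "cmp C Y Z W c v = cmp C Y W W (ident C W) g"
    by (simp_all add: triangle_morphism_def)
  then show thesis using that[of c] t'(2) W g(1) by simp
qed

lemma weak_cokernel':
  assumes t: "triangle X Y Z u v w" and W: "W \<in> obj C" and g: "g \<in> mor C Z W" "cmp C Y Z W g v = \<zero>\<^bsub>Hom C Y W\<^esub>"
  obtains h where "h \<in> mor C (shift C X) W" "g = cmp C Z (shift C X) W h w"
  using weak_cokernel[OF rotate[OF t] W g] that by blast

text \<open>Compare with \<open>W \<rightarrow> 0 \<rightarrow> W[1] \<rightarrow> W[1]\<close>, mapped to the rotated triangle.  Axiom TR3 yields a map
  \<open>W[1] \<rightarrow> X[1]\<close>, which is a shift because the shift functor is full; both triangles carry a sign in the
  last map, and the signs cancel.\<close>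

lemma weak_kernel:
  assumes t: "triangle X Y Z u v w" and W: "W \<in> obj C" and g: "g \<in> mor C W Y" "cmp C W Y Z v g = \<zero>\<^bsub>Hom C W Z\<^esub>"
  obtains h where "h \<in> mor C W X" "g = cmp C W X Y u h"
proof -
  note t' = triangleD[OF t]
  obtain N where N: "zero_object C N" by (rule zero_object_exists)
  note N' = zero_object_obj[OF N]
  note s = rotate[OF TR1_ident[OF W N]]
  obtain c where c: "triangle_morphism C (W, N, shift C W, \<zero>\<^bsub>Hom C W N\<^esub>, \<zero>\<^bsub>Hom C N (shift C W)\<^esub>,
      \<ominus>\<^bsub>Hom C (shift C W) (shift C W)\<^esub> shift_mor C W W (ident C W))
      (Y, Z, shift C X, v, w, \<ominus>\<^bsub>Hom C (shift C X) (shift C Y)\<^esub> shift_mor C X Y u) g \<zero>\<^bsub>Hom C N Z\<^esub> c"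
    using TR3_morphism[OF s rotate[OF t], of g "\<zero>\<^bsub>Hom C N Z\<^esub>"] t' N' W g by auto
  then have cm: "c \<in> mor C (shift C W) (shift C X)" by (simp add: triangle_morphism_def)
  obtain h where h: "h \<in> mor C W X" "c = shift_mor C W X h" using shift_surject[OF W t'(1) cm] .
  have "\<ominus>\<^bsub>Hom C (shift C W) (shift C Y)\<^esub> shift_mor C W Y g = \<ominus>\<^bsub>Hom C (shift C W) (shift C Y)\<^esub> shift_mor C W Y (cmp C W X Y u h)"
    using c t' W g h by (simp add: triangle_morphism_def cmp_minus_right cmp_minus_left shift_cmp)
  then have "shift_mor C W Y g = shift_mor C W Y (cmp C W X Y u h)"
    using minus_minus_mor[of "shift C W" "shift C Y"] t' W g h
    by (metis cmp_mor shift_mor_mor shift_obj)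
  then have "g = cmp C W X Y u h" by (rule shift_inject[rotated -1]) (use t' W g h in simp_all)
  then show thesis using that h by blast
qed

lemma weak_kernel':
  assumes t: "triangle X Y Z u v w" and W: "W \<in> obj C"
    and g: "g \<in> mor C W Z" "cmp C W Z (shift C X) w g = \<zero>\<^bsub>Hom C W (shift C X)\<^esub>"
  obtains h where "h \<in> mor C W Y" "g = cmp C W Y Z v h"
  using weak_kernel[OF rotate[OF t] W g] that by blast

subsection \<open>Split triangles\<close>

text \<open>As \<open>w = 0\<close>, the identity of \<open>Z\<close> lifts to a section \<open>s\<close> of \<open>v\<close>.  The endomorphism \<open>id - s \<circ> v\<close> of
  \<open>Y\<close> is killed by \<open>v\<close>, so it factors through \<open>u\<close>, and the factor is the projection onto \<open>X\<close>.\<close>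

lemma split_triangle:
  assumes t: "triangle X Y Z u v \<zero>\<^bsub>Hom C Z (shift C X)\<^esub>"
  shows "is_direct_sum C Y [X, Z]"
proof -
  note o = triangleD(1-3)[OF t] and m = triangleD(4-6)[OF t]
  obtain s where s: "s \<in> mor C Z Y" "ident C Z = cmp C Z Y Z v s"
    using weak_kernel'[OF t o(3), of "ident C Z"] o by auto
  note vs = s(2)[symmetric] and vu = triangle_comp_zero[OF t]
  \<comment> \<open>The vanishing of \<open>w\<close> also makes \<open>u\<close> monic.\<close>
  have mono: "f = g" if "W \<in> obj C" "f \<in> mor C W X" "g \<in> mor C W X" "cmp C W X Y u f = cmp C W X Y u g" for W f g
  proof -
    let ?d = "f \<oplus>\<^bsub>Hom C W X\<^esub> \<ominus>\<^bsub>Hom C W X\<^esub> g"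
    note W = that(1)
    have d: "?d \<in> mor C W X" using that o by simp
    have "cmp C W X Y u ?d = \<zero>\<^bsub>Hom C W Y\<^esub>" using that o m by (simp add: cmp_add_right cmp_minus_right)
    then have "cmp C (shift C W) (shift C X) (shift C Y) (\<ominus>\<^bsub>Hom C (shift C X) (shift C Y)\<^esub> shift_mor C X Y u) (shift_mor C W X ?d)
      = \<zero>\<^bsub>Hom C (shift C W) (shift C Y)\<^esub>"
      using that o m d by (simp add: cmp_minus_left flip: shift_cmp)
    then obtain h where "h \<in> mor C (shift C W) Z" "shift_mor C W X ?d = cmp C (shift C W) Z (shift C X) \<zero>\<^bsub>Hom C Z (shift C X)\<^esub> h"
      by (rule weak_kernel'[OF rotate[OF t] shift_obj[OF W] shift_mor_mor[OF W o(1) d]])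
    then have "shift_mor C W X ?d = shift_mor C W X \<zero>\<^bsub>Hom C W X\<^esub>" using that o by simp
    then have "?d = \<zero>\<^bsub>Hom C W X\<^esub>" by (rule shift_inject[rotated -1]) (use that o d in simp_all)
    then show ?thesis using that o add_minus_eq_zero_iff by simp
  qed
  let ?e = "ident C Y \<oplus>\<^bsub>Hom C Y Y\<^esub> \<ominus>\<^bsub>Hom C Y Y\<^esub> cmp C Y Z Y s v"
  have e: "?e \<in> mor C Y Y" using o m s by simp
  have "cmp C Y Y Z v ?e = \<zero>\<^bsub>Hom C Y Z\<^esub>"
    using o m s(1) by (simp add: cmp_add_right cmp_minus_right cmp_reassoc[OF vs])
  then obtain r where r: "r \<in> mor C Y X" "?e = cmp C Y X Y u r"
    using weak_kernel[OF t o(2) e] by blast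
  have eu: "cmp C X Y Y ?e u = u"
    using o m s(1) by (simp add: cmp_add_left cmp_minus_left cmp_assoc vu)
  have es: "cmp C Z Y Y ?e s = \<zero>\<^bsub>Hom C Z Y\<^esub>"
    using o m s(1) by (simp add: cmp_add_left cmp_minus_left cmp_assoc vs)
  have ru: "cmp C X Y X r u = ident C X"
    using eu o m r(1) unfolding r(2) by - (rule mono[OF o(1)], simp_all add: cmp_assoc)
  have rs: "cmp C Z Y X r s = \<zero>\<^bsub>Hom C Z X\<^esub>"
    using es o m s(1) r(1) unfolding r(2) by - (rule mono[OF o(3)], simp_all add: cmp_assoc)
  have "cmp C Y X Y u r \<oplus>\<^bsub>Hom C Y Y\<^esub> cmp C Y Z Y s v = ident C Y"
    unfolding r(2)[symmetric] using o m s(1) by (simp add: add_minus_cancel)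
  then show ?thesis
    using binary_direct_sumI[OF o(2,1,3) m(1) s(1) r(1) m(2) ru vs rs vu] by simp
qed

lemma zero_map_cone:
  assumes t: "triangle X Y Z \<zero>\<^bsub>Hom C X Y\<^esub> v w"
  shows "is_direct_sum C Z [Y, shift C X]"
  using rotate[OF t] triangleD(1,2)[OF t] by (intro split_triangle[of _ _ _ v w]) simp

text \<open>The composite \<open>u[1] \<circ> w\<close> is zero and \<open>u[1]\<close> has a left inverse.\<close>

lemma split_mono_cone:
  assumes t: "triangle X Y Z u v w" and r: "r \<in> mor C Y X" "cmp C X Y X r u = ident C X"
  shows "w = \<zero>\<^bsub>Hom C Z (shift C X)\<^esub>"
proof -
  note o = triangleD(1-3)[OF t] and m = triangleD(4-6)[OF t]
  have c: "cmp C (shift C X) (shift C Y) (shift C X) (shift_mor C Y X r) (shift_mor C X Y u) = ident C (shift C X)"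
    using o m r by (simp flip: shift_cmp)
  have "w = cmp C Z (shift C Y) (shift C X) (shift_mor C Y X r) (cmp C Z (shift C X) (shift C Y) (shift_mor C X Y u) w)"
    using o m r(1) by (simp add: cmp_reassoc[OF c])
  then show ?thesis using triangle_comp_zero''[OF t] o r(1) by simp
qed

text \<open>The complement of \<open>X\<close> is the cone of the split monomorphism.\<close>

lemma retract_direct_summand:
  assumes "retract X Y" shows "direct_summand C X Y"
proof -
  obtain i p where o: "X \<in> obj C" "Y \<in> obj C" and m: "i \<in> mor C X Y" "p \<in> mor C Y X"
    and c: "cmp C X Y X p i = ident C X"
    using assms by (auto simp: retract_def)
  obtain Z v w where t: "triangle X Y Z i v w" using cone_exists[OF o m(1)] .
  have "is_direct_sum C Y [X, Z]"
    using split_triangle t split_mono_cone[OF t m(2) c] by simp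
  then show ?thesis using triangleD(3)[OF t] by (auto simp: direct_summand_def)
qed

lemma retract_iff_direct_summand: "retract X Y \<longleftrightarrow> direct_summand C X Y"
  using retract_direct_summand direct_summand_retract by blast

lemma triangle_change_third:
  assumes t: "triangle X Y Z u v w" and iso: "isomorphic C Z Z'"
  obtains v' w' where "triangle X Y Z' u v' w'"
proof -
  note o = triangleD(1-3)[OF t] and m = triangleD(4-6)[OF t]
  obtain e d where Z': "Z' \<in> obj C" and ed: "e \<in> mor C Z Z'" "d \<in> mor C Z' Z"
    "cmp C Z Z' Z d e = ident C Z" "cmp C Z' Z Z' e d = ident C Z'"
    using iso by (rule isomorphicE)
  have "triangle X Y Z' u (cmp C Y Z Z' e v) (cmp C Z' Z (shift C X) w d)"
  proof (rule TR1_iso[OF t])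
    show "candidate_triangle C X Y Z' u (cmp C Y Z Z' e v) (cmp C Z' Z (shift C X) w d)"
      using o m Z' ed by (simp add: candidate_triangle_def)
    show "triangle_morphism C (X, Y, Z, u, v, w) (X, Y, Z', u, cmp C Y Z Z' e v, cmp C Z' Z (shift C X) w d) (ident C X) (ident C Y) e"
      using o m Z' ed by (simp add: triangle_morphism_def cmp_assoc)
    show "iso_mor C Z Z' e" using ed iso_morI by blast
  qed (use o iso_mor_ident in auto)
  then show thesis by (rule that)
qed

lemma triangle_change_second:
  assumes t: "triangle X Y Z u v w" and iso: "isomorphic C Y Y'"
  obtains u' v' where "triangle X Y' Z u' v' w"
proof -
  note o = triangleD(1-3)[OF t] and m = triangleD(4-6)[OF t]
  obtain e d where Y': "Y' \<in> obj C" and ed: "e \<in> mor C Y Y'" "d \<in> mor C Y' Y"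
    "cmp C Y Y' Y d e = ident C Y" "cmp C Y' Y Y' e d = ident C Y'"
    using iso by (rule isomorphicE)
  have "triangle X Y' Z (cmp C X Y Y' e u) (cmp C Y' Y Z v d) w"
  proof (rule TR1_iso[OF t])
    show "candidate_triangle C X Y' Z (cmp C X Y Y' e u) (cmp C Y' Y Z v d) w"
      using o m Y' ed by (simp add: candidate_triangle_def)
    show "triangle_morphism C (X, Y, Z, u, v, w) (X, Y', Z, cmp C X Y Y' e u, cmp C Y' Y Z v d, w) (ident C X) e (ident C Z)"
      using o m Y' ed by (simp add: triangle_morphism_def cmp_assoc)
    show "iso_mor C Y Y' e" using ed iso_morI by blast
  qed (use o iso_mor_ident in auto)
  then show thesis by (rule that)
qed

text \<open>Fullness of the shift exhibits the connecting map as \<open>- u[1]\<close>, so that axiom TR2 applies backwards.\<close>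

lemma inverse_rotate:
  assumes t: "triangle Y Z X' v w u'" and iso: "isomorphic C (shift C X) X'" and X: "X \<in> obj C"
  obtains u w' where "triangle X Y Z u v w'"
proof -
  obtain w' u'' where s: "triangle Y Z (shift C X) v w' u''"
    using triangle_change_third[OF t isomorphic_sym[OF iso]] .
  note o = triangleD(1-3)[OF s] and m = triangleD(4-6)[OF s]
  obtain u where u: "u \<in> mor C X Y" "u'' = shift_mor C X Y u" using shift_surject[OF X o(1) m(3)] .
  let ?u = "\<ominus>\<^bsub>Hom C X Y\<^esub> u"
  have "candidate_triangle C X Y Z ?u v w'" using X o m u by (simp add: candidate_triangle_def)
  then have "triangle X Y Z ?u v w'"
    using TR2_rotation[of X Y Z ?u v w'] s u X o by (simp add: shift_minus)
  then show thesis by (rule that)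
qed

text \<open>The cone of the inclusion of \<open>X\<close> is isomorphic to \<open>Z\<close>: the projection \<open>q\<close> factors through it, with
  inverse \<open>v \<circ> j\<close>.\<close>

lemma direct_sum_triangle:
  assumes s: "is_direct_sum C Y [X, Z]"
  obtains u v where "triangle X Y Z u v \<zero>\<^bsub>Hom C Z (shift C X)\<^esub>"
proof -
  obtain i j p q where o: "Y \<in> obj C" "X \<in> obj C" "Z \<in> obj C"
    and m: "i \<in> mor C X Y" "j \<in> mor C Z Y" "p \<in> mor C Y X" "q \<in> mor C Y Z"
    and c: "cmp C X Y X p i = ident C X" "cmp C Z Y Z q j = ident C Z" "cmp C X Y Z q i = \<zero>\<^bsub>Hom C X Z\<^esub>"
      "cmp C Y X Y i p \<oplus>\<^bsub>Hom C Y Y\<^esub> cmp C Y Z Y j q = ident C Y"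
    using s by (rule binary_direct_sumE)
  obtain Z' v w where t: "triangle X Y Z' i v w" using cone_exists[OF o(2,1) m(1)] .
  note Z' = triangleD(3)[OF t] and v = triangleD(5)[OF t]
  have w: "w = \<zero>\<^bsub>Hom C Z' (shift C X)\<^esub>" using split_mono_cone[OF t m(3) c(1)] .
  note t0 = t[unfolded w]
  obtain e where e: "e \<in> mor C Z' Z" "q = cmp C Y Z' Z e v" using weak_cokernel[OF t o(3) m(4) c(3)] .
  let ?d = "cmp C Z Y Z' v j"
  have d: "?d \<in> mor C Z Z'" using o m Z' v by simp
  have ed: "cmp C Z Z' Z e ?d = ident C Z" using c(2) e o m Z' v by (simp add: cmp_assoc)
  have "v = cmp C Y Y Z' v (cmp C Y X Y i p \<oplus>\<^bsub>Hom C Y Y\<^esub> cmp C Y Z Y j q)" using c(4) o v Z' by simp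
  also have "\<dots> = cmp C Y Z Z' ?d q"
    using o m Z' v by (simp add: cmp_add_right cmp_reassoc[OF triangle_comp_zero[OF t]] cmp_assoc)
  finally have vd: "cmp C Y Z Z' ?d q = v" by simp
  obtain s where s: "s \<in> mor C Z' Y" "ident C Z' = cmp C Z' Y Z' v s"
    using weak_kernel'[OF t0 Z', of "ident C Z'"] Z' o by auto
  have "cmp C Z' Z Z' ?d e = cmp C Z' Z Z' ?d (cmp C Z' Z' Z e (cmp C Z' Y Z' v s))" using s(2)[symmetric] o e(1) Z' by simp
  also have "\<dots> = cmp C Z' Y Z' (cmp C Y Z Z' ?d q) s" unfolding e(2) using o e(1) Z' s(1) v d by (simp add: cmp_assoc)
  also have "\<dots> = ident C Z'" using vd s by simp
  finally have de: "cmp C Z' Z Z' ?d e = ident C Z'" .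
  have "isomorphic C Z' Z" by (rule isomorphicI[OF Z' o(3) iso_morI[OF e(1) d de ed]])
  then obtain v' w' where t1: "triangle X Y Z i v' w'" by (rule triangle_change_third[OF t])
  show thesis using that t1 split_mono_cone[OF t1 m(3) c(1)] by blast
qed

lemma direct_sum_swap: "is_direct_sum C X [Y, Z] \<Longrightarrow> is_direct_sum C X [Z, Y]"
proof -
  assume s: "is_direct_sum C X [Y, Z]"
  obtain i j p q where o: "X \<in> obj C" "Y \<in> obj C" "Z \<in> obj C"
    and m: "i \<in> mor C Y X" "j \<in> mor C Z X" "p \<in> mor C X Y" "q \<in> mor C X Z"
    and c: "cmp C Y X Y p i = ident C Y" "cmp C Z X Z q j = ident C Z"
    "cmp C Z X Y p j = \<zero>\<^bsub>Hom C Z Y\<^esub>" "cmp C Y X Z q i = \<zero>\<^bsub>Hom C Y Z\<^esub>"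
    and e: "cmp C X Y X i p \<oplus>\<^bsub>Hom C X X\<^esub> cmp C X Z X j q = ident C X"
    using s by (rule binary_direct_sumE)
  interpret H: abelian_group "Hom C X X" using Hom_abelian_group o by simp
  have "cmp C X Z X j q \<oplus>\<^bsub>Hom C X X\<^esub> cmp C X Y X i p = ident C X"
    using e o m cmp_mor[of X Y X p i] cmp_mor[of X Z X q j] H.a_comm unfolding mor_def by metis
  then show ?thesis by (rule binary_direct_sumI[OF o(1,3,2) m(2,1,4,3) c(2,1,4,3)])
qed

end

section \<open>Resolutions by a rigid subcategory\<close>

context triangulated_category
begin

definition Hom_vanishes :: "'o \<Rightarrow> 'o \<Rightarrow> bool" where
  "Hom_vanishes X Y \<longleftrightarrow> (\<forall>f\<in>mor C X Y. f = \<zero>\<^bsub>Hom C X Y\<^esub>)"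

lemma Hom_vanishesD: "Hom_vanishes X Y \<Longrightarrow> f \<in> mor C X Y \<Longrightarrow> f = \<zero>\<^bsub>Hom C X Y\<^esub>"
  by (simp add: Hom_vanishes_def)

lemma Ext1_carrier_zero_iff:
  "\<lbrakk>X \<in> obj C; Y \<in> obj C\<rbrakk> \<Longrightarrow> carrier (Ext1 C X Y) = {\<zero>\<^bsub>Ext1 C X Y\<^esub>} \<longleftrightarrow> Hom_vanishes X (shift C Y)"
  using zero_mor[of X "shift C Y"] unfolding Ext1_def Hom_vanishes_def mor_def by auto

lemma Hom_vanishes_iso:
  assumes v: "Hom_vanishes X Y" and X: "isomorphic C X X'" and Y: "isomorphic C Y Y'"
  shows "Hom_vanishes X' Y'"
  unfolding Hom_vanishes_def
proof
  fix f assume f: "f \<in> mor C X' Y'"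
  obtain a b where a: "X \<in> obj C" "X' \<in> obj C" "a \<in> mor C X X'" "b \<in> mor C X' X" "cmp C X' X X' a b = ident C X'"
    using X by (rule isomorphicE)
  obtain c d where c: "Y \<in> obj C" "Y' \<in> obj C" "c \<in> mor C Y Y'" "d \<in> mor C Y' Y" "cmp C Y' Y Y' c d = ident C Y'"
    using Y by (rule isomorphicE)
  let ?g = "cmp C X Y' Y d (cmp C X X' Y' f a)"
  have "f = cmp C X' Y Y' c (cmp C X' X Y ?g b)"
    using a c f by (simp add: cmp_assoc cmp_reassoc[OF c(5)])
  moreover have "?g = \<zero>\<^bsub>Hom C X Y\<^esub>" using a c f by (intro Hom_vanishesD[OF v]) simp
  ultimately show "f = \<zero>\<^bsub>Hom C X' Y'\<^esub>" using a c by simp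
qed

lemma Hom_vanishes_shift:
  assumes "X \<in> obj C" "Y \<in> obj C" "Hom_vanishes X Y"
  shows "Hom_vanishes (shift C X) (shift C Y)"
  unfolding Hom_vanishes_def
proof
  fix f assume "f \<in> mor C (shift C X) (shift C Y)"
  then obtain g where "g \<in> mor C X Y" and f: "f = shift_mor C X Y g" by (rule shift_surject[OF assms(1,2)])
  then have "g = \<zero>\<^bsub>Hom C X Y\<^esub>" using Hom_vanishesD[OF assms(3)] by simp
  then show "f = \<zero>\<^bsub>Hom C (shift C X) (shift C Y)\<^esub>" unfolding f using assms(1,2) by simp
qed

lemma Hom_vanishes_retract_left:
  assumes v: "Hom_vanishes X Y" and r: "retract X' X" and Y: "Y \<in> obj C"
  shows "Hom_vanishes X' Y"
  unfolding Hom_vanishes_def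
proof
  fix f assume f: "f \<in> mor C X' Y"
  obtain i p where r: "X' \<in> obj C" "X \<in> obj C" "i \<in> mor C X' X" "p \<in> mor C X X'" "cmp C X' X X' p i = ident C X'"
    using r by (auto simp: retract_def)
  have "f = cmp C X' X Y (cmp C X X' Y f p) i" using r Y f by (simp add: cmp_assoc)
  moreover have "cmp C X X' Y f p = \<zero>\<^bsub>Hom C X Y\<^esub>" using r Y f by (intro Hom_vanishesD[OF v]) simp
  ultimately show "f = \<zero>\<^bsub>Hom C X' Y\<^esub>" using r Y by simp
qed

lemma Hom_vanishes_direct_sum_left:
  assumes X: "is_direct_sum C X Xs" and v: "\<And>X'. X' \<in> set Xs \<Longrightarrow> Hom_vanishes X' Y" and Y: "Y \<in> obj C"
  shows "Hom_vanishes X Y"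
  unfolding Hom_vanishes_def
proof
  fix f assume f: "f \<in> mor C X Y"
  obtain \<iota> \<pi> where ds: "dsum X Xs \<iota> \<pi>" using X by (rule is_direct_sum_dsum)
  show "f = \<zero>\<^bsub>Hom C X Y\<^esub>"
  proof (rule dsum_epic[OF ds Y f])
    show "\<zero>\<^bsub>Hom C X Y\<^esub> \<in> mor C X Y" using dsum_obj[OF ds] Y by simp
    fix j assume j: "j < length Xs"
    then have "cmp C (Xs ! j) X Y f (\<iota> j) = \<zero>\<^bsub>Hom C (Xs ! j) Y\<^esub>"
      using dsum_obj[OF ds] dsum_mor[OF ds] Y f by (intro Hom_vanishesD[OF v]) simp_all
    then show "cmp C (Xs ! j) X Y f (\<iota> j) = cmp C (Xs ! j) X Y \<zero>\<^bsub>Hom C X Y\<^esub> (\<iota> j)"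
      using dsum_obj[OF ds] dsum_mor[OF ds] Y j by simp
  qed
qed

definition shifted :: "'o set \<Rightarrow> 'o set" where
  "shifted R = {Q. \<exists>A\<in>R. isomorphic C (shift C A) Q}"

text \<open>A resolution \<open>A \<rightarrow> B \<rightarrow> Y \<rightarrow> A[1]\<close> with \<open>A\<close> and \<open>B\<close> in \<open>R\<close> is recorded by \<open>B\<close> and \<open>Q \<cong> A[1]\<close>, because
  octahedra produce the cones of maps rather than their fibres.\<close>

definition resolution :: "'o set \<Rightarrow> 'o \<Rightarrow> 'o \<Rightarrow> 'o \<Rightarrow> bool" where
  "resolution R B Y Q \<longleftrightarrow> B \<in> R \<and> Q \<in> shifted R \<and> (\<exists>f g h. triangle B Y Q f g h)"

lemma rigidD:
  assumes "rigid C R"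
  shows "R \<subseteq> obj C" "\<forall>X Y. X \<in> R \<and> isomorphic C X Y \<longrightarrow> Y \<in> R"
    "\<forall>X Y. Y \<in> R \<and> direct_summand C X Y \<longrightarrow> X \<in> R"
    "\<forall>X Ys. set Ys \<subseteq> R \<and> is_direct_sum C X Ys \<longrightarrow> X \<in> R"
    "Ext1_vanishes C R R"
proof -
  have "(R \<subseteq> obj C \<and> (\<forall>X Y. X \<in> R \<and> isomorphic C X Y \<longrightarrow> Y \<in> R) \<and>
    (\<forall>X Y. Y \<in> R \<and> direct_summand C X Y \<longrightarrow> X \<in> R) \<and>
    (\<forall>X Ys. set Ys \<subseteq> R \<and> is_direct_sum C X Ys \<longrightarrow> X \<in> R)) \<and> Ext1_vanishes C R R"
    using assms unfolding rigid_def additive_subcategory_def .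
  note h = this[THEN conjunct1] this[THEN conjunct2]
  show "R \<subseteq> obj C" using h(1) by (rule conjunct1)
  show "\<forall>X Y. X \<in> R \<and> isomorphic C X Y \<longrightarrow> Y \<in> R" using h(1) by (elim conjE)
  show "\<forall>X Y. Y \<in> R \<and> direct_summand C X Y \<longrightarrow> X \<in> R" using h(1) by (elim conjE)
  show "\<forall>X Ys. set Ys \<subseteq> R \<and> is_direct_sum C X Ys \<longrightarrow> X \<in> R" using h(1) by (elim conjE)
  show "Ext1_vanishes C R R" by (rule h(2))
qed

lemma rigid_obj: "rigid C R \<Longrightarrow> X \<in> R \<Longrightarrow> X \<in> obj C"
  using rigidD(1) by blast

lemma rigid_direct_sum: "rigid C R \<Longrightarrow> set Xs \<subseteq> R \<Longrightarrow> is_direct_sum C X Xs \<Longrightarrow> X \<in> R"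
  by (drule rigidD(4)) blast

lemma rigid_retract: "rigid C R \<Longrightarrow> X \<in> R \<Longrightarrow> retract Y X \<Longrightarrow> Y \<in> R"
  by (drule rigidD(3), drule retract_direct_summand) blast

lemma rigid_vanishes:
  assumes R: "rigid C R" and "X \<in> R" "Y \<in> R" shows "Hom_vanishes X (shift C Y)"
  using rigidD(5)[OF R] assms Ext1_carrier_zero_iff[OF rigid_obj[OF R] rigid_obj[OF R]]
  unfolding Ext1_vanishes_def by blast

lemma shifted_obj: "Q \<in> shifted R \<Longrightarrow> Q \<in> obj C"
  by (auto simp: shifted_def isomorphic_def)

lemma shift_shifted: "rigid C R \<Longrightarrow> X \<in> R \<Longrightarrow> shift C X \<in> shifted R"
  unfolding shifted_def using isomorphic_refl rigid_obj shift_obj by blast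

lemma vanishes_shifted:
  assumes "rigid C R" "B \<in> R" "Q \<in> shifted R" shows "Hom_vanishes B Q"
proof -
  obtain A where A: "A \<in> R" "isomorphic C (shift C A) Q" using assms(3) by (auto simp: shifted_def)
  show ?thesis
    by (rule Hom_vanishes_iso[OF rigid_vanishes[OF assms(1,2) A(1)] isomorphic_refl[OF rigid_obj[OF assms(1,2)]] A(2)])
qed

text \<open>This vanishing is what makes the triangles between objects of \<open>R[1]\<close> split.\<close>

lemma shifted_vanishes_shift:
  assumes R: "rigid C R" and Q: "Q \<in> shifted R" "Q' \<in> shifted R" shows "Hom_vanishes Q (shift C Q')"
proof -
  obtain A A' where A: "A \<in> R" "A' \<in> R" and iso: "isomorphic C (shift C A) Q" "isomorphic C (shift C A') Q'"
    using Q by (auto simp: shifted_def)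
  have "Hom_vanishes (shift C A) (shift C (shift C A'))"
    using Hom_vanishes_shift rigid_vanishes[OF R A] rigid_obj[OF R] A by simp
  moreover have "isomorphic C (shift C (shift C A')) (shift C Q')"
    using shift_isomorphic_iff iso(2) rigid_obj[OF R A(2)] shifted_obj[OF Q(2)] by simp
  ultimately show ?thesis using Hom_vanishes_iso iso(1) by blast
qed

lemma shifted_direct_sum:
  assumes R: "rigid C R" and Q: "Q1 \<in> shifted R" "Q2 \<in> shifted R" and s: "is_direct_sum C Q [Q1, Q2]"
  shows "Q \<in> shifted R"
proof -
  obtain A1 A2 where A: "A1 \<in> R" "A2 \<in> R" and iso: "isomorphic C (shift C A1) Q1" "isomorphic C (shift C A2) Q2"
    using Q by (auto simp: shifted_def)
  obtain A where A': "is_direct_sum C A [A1, A2]"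
    using finite_direct_sums[of "[A1, A2]"] rigid_obj[OF R] A by auto
  have AR: "A \<in> R" using rigid_direct_sum[OF R _ A'] A by simp
  have "is_direct_sum C (shift C A) [shift C A1, shift C A2]" using shift_direct_sum[OF A'] by simp
  then have "isomorphic C (shift C A) Q"
    by (rule direct_sum_isomorphic[OF _ s]) (use iso in \<open>auto simp: less_Suc_eq\<close>)
  then show ?thesis using AR by (auto simp: shifted_def)
qed

lemma octahedron:
  assumes f: "triangle X Y P f p1 d1" and g: "triangle Y Z R g p3 d3"
    and gf: "triangle X Z Q (cmp C X Y Z g f) p2 d2"
  obtains a b where "triangle P Q R a b (cmp C R (shift C Y) (shift C P) (shift_mor C Y P p1) d3)"
  using TR4_octahedral[OF f gf g] by blast

text \<open>Let \<open>E\<close> be the cone of the composite \<open>Y \<rightarrow> Z \<rightarrow> Q'\<close>.  The octahedron on it gives a triangle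
  \<open>X[1] \<rightarrow> E \<rightarrow> B'[1]\<close>, which splits.  The composite \<open>B \<rightarrow> Y \<rightarrow> Q'\<close> is zero, so its cone \<open>G\<close> is the
  direct sum of \<open>Q'\<close> and \<open>B[1]\<close>; the octahedron on it gives a triangle \<open>Q \<rightarrow> G \<rightarrow> E\<close>, which splits
  as well.  The two decompositions of \<open>G\<close> are a form of Schanuel's lemma.\<close>

lemma resolution_triangle:
  assumes R: "rigid C R" and X: "X \<in> R" and t: "triangle X Y Z u v w"
    and rY: "resolution R B Y Q" and rZ: "resolution R B' Z Q'"
  obtains E G where "is_direct_sum C E [shift C X, shift C B']"
    "is_direct_sum C G [Q', shift C B]" "is_direct_sum C G [Q, E]"
proof -
  obtain f g h where tY: "triangle B Y Q f g h" and BQ: "B \<in> R" "Q \<in> shifted R"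
    using rY by (auto simp: resolution_def)
  obtain f' g' h' where tZ: "triangle B' Z Q' f' g' h'" and BQ': "B' \<in> R" "Q' \<in> shifted R"
    using rZ by (auto simp: resolution_def)
  note o = triangleD(1-3)[OF t] triangleD(1,3)[OF tY] triangleD(1,3)[OF tZ]
  note m = triangleD(4-6)[OF t] triangleD(4-6)[OF tY] triangleD(4-6)[OF tZ]
  have k: "cmp C Y Z Q' g' v \<in> mor C Y Q'" using o m by simp
  obtain E p d where tE: "triangle Y Q' E (cmp C Y Z Q' g' v) p d" using cone_exists[OF o(2,7) k] .
  note E = triangleD(3)[OF tE]
  obtain a b where "triangle (shift C X) E (shift C B') a b
      (cmp C (shift C B') (shift C Z) (shift C (shift C X)) (shift_mor C Z (shift C X) w)
        (\<ominus>\<^bsub>Hom C (shift C B') (shift C Z)\<^esub> shift_mor C B' Z f'))"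
    using octahedron[OF rotate[OF t] rotate[OF tZ] tE] .
  moreover have "cmp C (shift C B') (shift C Z) (shift C (shift C X)) (shift_mor C Z (shift C X) w)
        (\<ominus>\<^bsub>Hom C (shift C B') (shift C Z)\<^esub> shift_mor C B' Z f') = \<zero>\<^bsub>Hom C (shift C B') (shift C (shift C X))\<^esub>"
    using o m shift_shifted[OF R] X BQ'(1) by (intro Hom_vanishesD[OF shifted_vanishes_shift[OF R]]) simp_all
  ultimately have sE: "is_direct_sum C E [shift C X, shift C B']" using split_triangle by simp
  then have E': "E \<in> shifted R" using shifted_direct_sum[OF R] shift_shifted[OF R] X BQ'(1) by blast
  have k0: "cmp C B Y Q' (cmp C Y Z Q' g' v) f = \<zero>\<^bsub>Hom C B Q'\<^esub>"
    using o m k by (intro Hom_vanishesD[OF vanishes_shifted[OF R BQ(1) BQ'(2)]]) simp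
  obtain G q e where tG: "triangle B Q' G (cmp C B Y Q' (cmp C Y Z Q' g' v) f) q e"
    using cone_exists[OF o(4,7), of "cmp C B Y Q' (cmp C Y Z Q' g' v) f"] o m k by auto
  have "is_direct_sum C G [Q', shift C B]" using zero_map_cone tG unfolding k0 by blast
  moreover obtain a' b' where ab: "triangle Q G E a' b' (cmp C E (shift C Y) (shift C Q) (shift_mor C Y Q g) d)"
    using octahedron[OF tY tE tG] .
  have "cmp C E (shift C Y) (shift C Q) (shift_mor C Y Q g) d = \<zero>\<^bsub>Hom C E (shift C Q)\<^esub>"
    using triangleD(6)[OF ab] by (rule Hom_vanishesD[OF shifted_vanishes_shift[OF R E' BQ(2)]])
  then have "is_direct_sum C G [Q, E]" using ab split_triangle by simp
  ultimately show thesis using that sE by blast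
qed

text \<open>The direct sum of a triangle with \<open>V = V\<close>.  The octahedron on \<open>V \<oplus> Y \<rightarrow> Y \<rightarrow> Q\<close> identifies the
  cone of the composite with \<open>V[1] \<oplus> B[1]\<close>, and rotating back gives the triangle.\<close>

lemma triangle_add_identity:
  assumes t: "triangle B Y Q f g h" and N: "is_direct_sum C N [V, Y]" and B': "is_direct_sum C B' [V, B]"
  obtains f' g' h' where "triangle B' N Q f' g' h'"
proof -
  note o = triangleD(1-3)[OF t] and m = triangleD(4-6)[OF t]
  obtain i p where s: "triangle V N Y i p \<zero>\<^bsub>Hom C Y (shift C V)\<^esub>" using direct_sum_triangle[OF N] .
  note oN = triangleD(1,2)[OF s] and mN = triangleD(4,5)[OF s]
  have k: "cmp C N Y Q g p \<in> mor C N Q" using o m oN mN by simp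
  obtain D q d where tD: "triangle N Q D (cmp C N Y Q g p) q d" using cone_exists[OF oN(2) o(3) k] .
  obtain a b where "triangle (shift C V) D (shift C B) a b
      (cmp C (shift C B) (shift C Y) (shift C (shift C V)) (shift_mor C Y (shift C V) \<zero>\<^bsub>Hom C Y (shift C V)\<^esub>)
        (\<ominus>\<^bsub>Hom C (shift C B) (shift C Y)\<^esub> shift_mor C B Y f))"
    using octahedron[OF rotate[OF s] rotate[OF t] tD] .
  then have "is_direct_sum C D [shift C V, shift C B]" using split_triangle o m oN by simp
  moreover have "is_direct_sum C (shift C B') [shift C V, shift C B]" using shift_direct_sum[OF B'] by simp
  ultimately have "isomorphic C (shift C B') D" using direct_sum_unique by blast
  then show thesis using inverse_rotate[OF tD] that direct_sum_obj(1)[OF B'] by blast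
qed

text \<open>Factor \<open>B\<^sub>1 \<oplus> B\<^sub>2 \<rightarrow> Y\<^sub>1 \<oplus> Y\<^sub>2\<close> through \<open>Y\<^sub>1 \<oplus> B\<^sub>2\<close>.  The two factors have cones \<open>Q\<^sub>1\<close> and \<open>Q\<^sub>2\<close>, and
  in the octahedron the triangle \<open>Q\<^sub>1 \<rightarrow> Q \<rightarrow> Q\<^sub>2\<close> splits because there are no nonzero maps from \<open>Q\<^sub>2\<close>
  to \<open>Q\<^sub>1[1]\<close>.  This avoids the general fact that direct sums of triangles are triangles.\<close>

lemma resolution_direct_sum:
  assumes R: "rigid C R" and r1: "resolution R B1 Y1 Q1" and r2: "resolution R B2 Y2 Q2"
    and W: "is_direct_sum C W [Y1, Y2]"
  obtains B Q where "resolution R B W Q" "is_direct_sum C B [B1, B2]" "is_direct_sum C Q [Q1, Q2]"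
proof -
  obtain f1 g1 h1 where t1: "triangle B1 Y1 Q1 f1 g1 h1" and BQ1: "B1 \<in> R" "Q1 \<in> shifted R"
    using r1 by (auto simp: resolution_def)
  obtain f2 g2 h2 where t2: "triangle B2 Y2 Q2 f2 g2 h2" and BQ2: "B2 \<in> R" "Q2 \<in> shifted R"
    using r2 by (auto simp: resolution_def)
  note o = triangleD(1-3)[OF t1] triangleD(1-3)[OF t2]
  obtain N where N: "is_direct_sum C N [Y1, B2]" using finite_direct_sums[of "[Y1, B2]"] o by auto
  obtain B where B: "is_direct_sum C B [B1, B2]" using finite_direct_sums[of "[B1, B2]"] o by auto
  obtain f g h where t: "triangle B N Q1 f g h"
    using triangle_add_identity[OF t1 direct_sum_swap[OF N] direct_sum_swap[OF B]] .
  obtain f' g' h' where t': "triangle N W Q2 f' g' h'" using triangle_add_identity[OF t2 W N] .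
  have k: "cmp C B N W f' f \<in> mor C B W" using triangleD[OF t] triangleD[OF t'] by simp
  obtain Q p d where tQ: "triangle B W Q (cmp C B N W f' f) p d"
    using cone_exists[OF triangleD(1)[OF t] triangleD(2)[OF t'] k] .
  obtain a b where ab: "triangle Q1 Q Q2 a b (cmp C Q2 (shift C N) (shift C Q1) (shift_mor C N Q1 g) h')"
    using octahedron[OF t t' tQ] .
  have "cmp C Q2 (shift C N) (shift C Q1) (shift_mor C N Q1 g) h' = \<zero>\<^bsub>Hom C Q2 (shift C Q1)\<^esub>"
    using triangleD(6)[OF ab] by (rule Hom_vanishesD[OF shifted_vanishes_shift[OF R BQ2(2) BQ1(2)]])
  then have Q: "is_direct_sum C Q [Q1, Q2]" using ab split_triangle by simp
  have "B \<in> R" using rigid_direct_sum[OF R _ B] BQ1 BQ2 by simp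
  moreover have "Q \<in> shifted R" using shifted_direct_sum[OF R BQ1(2) BQ2(2) Q] .
  ultimately have "resolution R B W Q" using tQ by (auto simp: resolution_def)
  then show thesis using that B Q by blast
qed

lemma resolution_isomorphic:
  assumes "resolution R B Y Q" "isomorphic C Y Y'" shows "resolution R B Y' Q"
  using assms triangle_change_second unfolding resolution_def by metis

text \<open>The identity triangle of \<open>Y\<close>, whose third object may be taken to be the zero object \<open>Y[1]\<close>.\<close>

lemma resolution_zero:
  assumes R: "rigid C R" and Y: "zero_object C Y" shows "resolution R Y Y (shift C Y)"
proof -
  have "Y \<in> R" using rigid_direct_sum[OF R, of "[]"] Y by (simp add: zero_object_def)
  then show ?thesis
    using shift_shifted[OF R] TR1_ident[OF zero_object_obj[OF Y] shift_zero_object[OF Y]]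
    by (auto simp: resolution_def)
qed

end

section \<open>Approximations and maximal rigid subcategories\<close>

locale two_Calabi_Yau_category = triangulated_category K C
  for K :: "'k ring" and C :: "('o, 'm, 'k, 'z) tri_cat_scheme" +
  assumes two_CY: "two_Calabi_Yau K C"
begin

text \<open>A zero space has zero dual.\<close>

lemma Ext1_symmetric:
  assumes o: "X \<in> obj C" "Y \<in> obj C" and v: "Hom_vanishes X (shift C Y)"
  shows "Hom_vanishes Y (shift C X)"
proof -
  let ?M = "Ext1 C X Y"
  have M: "carrier ?M = {\<zero>\<^bsub>?M\<^esub>}" using Ext1_carrier_zero_iff o v by simp
  interpret M: module K ?M unfolding Ext1_def using Hom_module o by simp
  obtain \<Phi> where "linear_iso K (Ext1 C Y X) (dual_space K ?M) \<Phi>"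
    using two_CY o unfolding two_Calabi_Yau_def by blast
  then have inj: "inj_on \<Phi> (carrier (Ext1 C Y X))" and im: "\<And>x. x \<in> carrier (Ext1 C Y X) \<Longrightarrow> \<Phi> x \<in> carrier (dual_space K ?M)"
    unfolding linear_iso_def bij_betw_def by auto
  have zero: "\<phi> = (\<lambda>x\<in>carrier ?M. \<zero>\<^bsub>K\<^esub>)" if \<phi>: "\<phi> \<in> carrier (dual_space K ?M)" for \<phi>
  proof (rule ext)
    have e: "\<phi> \<in> carrier ?M \<rightarrow>\<^sub>E carrier K"
      and s': "\<forall>c\<in>carrier K. \<forall>x\<in>carrier ?M. \<phi> (c \<odot>\<^bsub>?M\<^esub> x) = c \<otimes>\<^bsub>K\<^esub> \<phi> x"
      using \<phi> by (simp_all add: dual_space_def)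
    have s: "\<phi> (\<zero>\<^bsub>K\<^esub> \<odot>\<^bsub>?M\<^esub> x) = \<zero>\<^bsub>K\<^esub> \<otimes>\<^bsub>K\<^esub> \<phi> x" if "x \<in> carrier ?M" for x
      using s' that M.R.zero_closed by blast
    fix x show "\<phi> x = (\<lambda>x\<in>carrier ?M. \<zero>\<^bsub>K\<^esub>) x"
    proof (cases "x \<in> carrier ?M")
      case True
      then have "x = \<zero>\<^bsub>K\<^esub> \<odot>\<^bsub>?M\<^esub> x" using M by auto
      then have "\<phi> x = \<zero>\<^bsub>K\<^esub> \<otimes>\<^bsub>K\<^esub> \<phi> x" using s[OF True] by simp
      then show ?thesis using True e by (auto simp: PiE_iff)
    next
      case False
      then show ?thesis using e by (auto simp: PiE_iff extensional_def)
    qed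
  qed
  have "x = y" if "x \<in> carrier (Ext1 C Y X)" "y \<in> carrier (Ext1 C Y X)" for x y
    using inj zero[OF im[OF that(1)]] zero[OF im[OF that(2)]] that by (simp add: inj_on_def)
  then show ?thesis using zero_mor[of Y "shift C X"] o by (auto simp: Hom_vanishes_def Ext1_def mor_def)
qed

text \<open>By the symmetry of \<open>Ext\<^sup>1\<close> and closure of its vanishing under direct sums and retracts, \<open>R\<close> and \<open>add N\<close>
  together are rigid.\<close>

lemma maximal_rigid_member:
  assumes R: "maximal_rigid C R" and N: "N \<in> obj C"
    and v: "\<And>X. X \<in> R \<Longrightarrow> Hom_vanishes X (shift C N)" and vN: "Hom_vanishes N (shift C N)"
  shows "N \<in> R"
proof -
  have r: "rigid C R" using R by (simp add: maximal_rigid_def)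
  have sum_left: "Hom_vanishes X (shift C W)" if X: "X \<in> add_subcat C N" and W: "W \<in> obj C" and NW: "Hom_vanishes N (shift C W)" for X W
  proof -
    obtain n Y where Y: "is_direct_sum C Y (replicate n N)" and XY: "direct_summand C X Y"
      using X by (auto simp: add_subcat_def)
    have "Hom_vanishes Y (shift C W)"
      by (rule Hom_vanishes_direct_sum_left[OF Y]) (use NW W in \<open>auto simp: set_replicate_conv_if split: if_splits\<close>)
    then show ?thesis using Hom_vanishes_retract_left direct_summand_retract[OF XY] W by simp
  qed
  have addo: "X \<in> obj C" if "X \<in> add_subcat C N" for X
    using that direct_summand_retract by (auto simp: add_subcat_def retract_def)
  have NX: "Hom_vanishes N (shift C X)" if "X \<in> R \<union> add_subcat C N" for X
    using that Ext1_symmetric[OF _ N v] Ext1_symmetric[OF addo N sum_left[OF _ N vN]] rigid_obj[OF r] by blast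
  have o: "X \<in> obj C" if "X \<in> R \<union> add_subcat C N" for X using that addo rigid_obj[OF r] by blast
  have all: "Hom_vanishes X (shift C Y)" if X: "X \<in> R \<union> add_subcat C N" and Y: "Y \<in> R \<union> add_subcat C N" for X Y
  proof (cases "X \<in> add_subcat C N")
    case True
    then show ?thesis using sum_left o[OF Y] NX[OF Y] by blast
  next
    case False
    then have XR: "X \<in> R" using X by simp
    show ?thesis
    proof (cases "Y \<in> add_subcat C N")
      case True
      then have "Hom_vanishes Y (shift C X)" using sum_left o[OF X] NX[OF X] by blast
      then show ?thesis using Ext1_symmetric o X Y by blast
    next
      case False
      then show ?thesis using XR Y rigid_vanishes[OF r] by blast
    qed
  qed
  have "Ext1_vanishes C (R \<union> add_subcat C N) (R \<union> add_subcat C N)"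
    unfolding Ext1_vanishes_def using Ext1_carrier_zero_iff o all by simp
  then show ?thesis using R N by (simp add: maximal_rigid_def)
qed

text \<open>Write the cone of the approximation \<open>f : B \<rightarrow> X\<close> as \<open>N[1]\<close>.  A map from an object of \<open>R\<close> to \<open>N[1]\<close>
  lifts to \<open>X\<close> because \<open>Ext\<^sup>1\<close> vanishes on \<open>R\<close>, hence through \<open>f\<close>, and is zero.  A map from \<open>N\<close>
  to \<open>N[1]\<close> lifts to some \<open>z : N \<rightarrow> X\<close> because \<open>Ext\<^sup>1(N, B) = 0\<close>.  As \<open>Ext\<^sup>1(X, X) = 0\<close>, the map
  \<open>z[1]\<close> extends along \<open>N[1] \<rightarrow> B[1]\<close> to a map \<open>B[1] \<rightarrow> X[1]\<close>, which factors through \<open>f[1]\<close>; so the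
  map is zero again.\<close>

lemma right_approximation_resolution:
  assumes R: "maximal_rigid C R" and a: "right_approximation C R B X f"
    and X: "X \<in> obj C" "Hom_vanishes X (shift C X)"
  shows "\<exists>Q. resolution R B X Q"
proof -
  have r: "rigid C R" using R by (simp add: maximal_rigid_def)
  have B: "B \<in> R" "B \<in> obj C" and f: "f \<in> mor C B X" using a rigid_obj[OF r] by (auto simp: right_approximation_def)
  obtain Q g h where t: "triangle B X Q f g h" using cone_exists[OF B(2) X(1) f] .
  note Q = triangleD(3)[OF t] and m = triangleD(5,6)[OF t]
  obtain N where N: "N \<in> obj C" and iso: "isomorphic C (shift C N) Q" using shift_ess_surj[OF Q] by blast
  obtain e d where e: "e \<in> mor C (shift C N) Q" "d \<in> mor C Q (shift C N)"
    "cmp C (shift C N) Q (shift C N) d e = ident C (shift C N)"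
    using iso by (rule isomorphicE)
  have gf: "cmp C B X Q g f = \<zero>\<^bsub>Hom C B Q\<^esub>" using triangle_comp_zero[OF t] .
  have zeroI: "x = \<zero>\<^bsub>Hom C W (shift C N)\<^esub>"
    if "W \<in> obj C" "x \<in> mor C W (shift C N)" "cmp C W (shift C N) Q e x = \<zero>\<^bsub>Hom C W Q\<^esub>" for W x
  proof -
    have "x = cmp C W Q (shift C N) d (cmp C W (shift C N) Q e x)"
      using that(1,2) e N Q by (simp add: cmp_reassoc[OF e(3)])
    then show ?thesis using that e N Q by simp
  qed
  have RN: "Hom_vanishes T (shift C N)" if T: "T \<in> R" for T
    unfolding Hom_vanishes_def
  proof
    fix x assume x: "x \<in> mor C T (shift C N)"
    note To = rigid_obj[OF r T]
    have y: "cmp C T (shift C N) Q e x \<in> mor C T Q" using x e N Q To by simp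
    have "cmp C T Q (shift C B) h (cmp C T (shift C N) Q e x) = \<zero>\<^bsub>Hom C T (shift C B)\<^esub>"
      using y m Q To B by (intro Hom_vanishesD[OF rigid_vanishes[OF r T B(1)]]) simp
    then obtain z where z: "z \<in> mor C T X" "cmp C T (shift C N) Q e x = cmp C T X Q g z"
      by (rule weak_kernel'[OF t To y])
    obtain s where s: "s \<in> mor C T B" "z = cmp C T B X f s"
      using a T z(1) unfolding right_approximation_def by blast
    have "cmp C T X Q g z = \<zero>\<^bsub>Hom C T Q\<^esub>"
      unfolding s(2) using s(1) To B X f m Q by (simp add: cmp_reassoc[OF gf])
    then show "x = \<zero>\<^bsub>Hom C T (shift C N)\<^esub>" using zeroI[OF To x] z by simp
  qed
  have NR: "Hom_vanishes N (shift C T)" if "T \<in> R" for T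
    using Ext1_symmetric[OF rigid_obj[OF r that] N RN[OF that]] .
  have NN: "Hom_vanishes N (shift C N)"
    unfolding Hom_vanishes_def
  proof
    fix x assume x: "x \<in> mor C N (shift C N)"
    have y: "cmp C N (shift C N) Q e x \<in> mor C N Q" using x e N Q by simp
    have "cmp C N Q (shift C B) h (cmp C N (shift C N) Q e x) = \<zero>\<^bsub>Hom C N (shift C B)\<^esub>"
      using y m Q N B by (intro Hom_vanishesD[OF NR[OF B(1)]]) simp
    then obtain z where z: "z \<in> mor C N X" "cmp C N (shift C N) Q e x = cmp C N X Q g z"
      by (rule weak_kernel'[OF t N y])
    let ?z = "shift_mor C N X z"
    have k: "cmp C Q (shift C N) (shift C X) ?z d \<in> mor C Q (shift C X)" using z N X Q e by simp
    have "cmp C X Q (shift C X) (cmp C Q (shift C N) (shift C X) ?z d) g = \<zero>\<^bsub>Hom C X (shift C X)\<^esub>"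
      using k m X Q by (intro Hom_vanishesD[OF X(2)]) simp
    then obtain k' where k': "k' \<in> mor C (shift C B) (shift C X)"
      "cmp C Q (shift C N) (shift C X) ?z d = cmp C Q (shift C B) (shift C X) k' h"
      by (rule weak_cokernel'[OF t shift_obj[OF X(1)] k])
    obtain k'' where k'': "k'' \<in> mor C B X" "k' = shift_mor C B X k''"
      using shift_surject[OF B(2) X(1) k'(1)] .
    obtain s where s: "s \<in> mor C B B" "k'' = cmp C B B X f s"
      using a B(1) k''(1) unfolding right_approximation_def by blast
    have "?z = cmp C (shift C N) Q (shift C X) (cmp C Q (shift C N) (shift C X) ?z d) e"
      using z N X Q e by (simp add: cmp_assoc)
    then have ze: "?z = cmp C (shift C N) Q (shift C X) (cmp C Q (shift C B) (shift C X) k' h) e"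
      unfolding k'(2) .
    have gk: "cmp C (shift C B) (shift C X) (shift C Q) (shift_mor C X Q g) k' = \<zero>\<^bsub>Hom C (shift C B) (shift C Q)\<^esub>"
      unfolding k''(2) s(2) using s(1) B X f m Q by (simp add: cmp_reassoc[OF gf] flip: shift_cmp)
    have "shift_mor C N Q (cmp C N X Q g z) = cmp C (shift C N) (shift C X) (shift C Q) (shift_mor C X Q g) ?z"
      using z(1) N X Q m by (simp add: shift_cmp)
    also have "\<dots> = \<zero>\<^bsub>Hom C (shift C N) (shift C Q)\<^esub>"
      unfolding ze using k'(1) m e N X Q B by (simp add: cmp_assoc cmp_reassoc[OF gk])
    finally have "shift_mor C N Q (cmp C N X Q g z) = shift_mor C N Q \<zero>\<^bsub>Hom C N Q\<^esub>" using N Q by simp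
    then have "cmp C N X Q g z = \<zero>\<^bsub>Hom C N Q\<^esub>"
      by (rule shift_inject[rotated -1]) (use z(1) N X Q m in simp_all)
    then show "x = \<zero>\<^bsub>Hom C N (shift C N)\<^esub>" using zeroI[OF N x] z by simp
  qed
  have "N \<in> R" using maximal_rigid_member[OF R N RN NN] .
  then have "Q \<in> shifted R" using iso by (auto simp: shifted_def)
  then show ?thesis using t B(1) by (auto simp: resolution_def)
qed

text \<open>The dual argument, with the cone \<open>N\<close> of the approximation \<open>u : X \<rightarrow> B\<close>.  A map from \<open>N\<close> to \<open>T[1]\<close> with
  \<open>T\<close> in \<open>R\<close> vanishes on \<open>B\<close>, so it factors through \<open>w : N \<rightarrow> X[1]\<close> by a map \<open>k'[1]\<close> with
  \<open>k' : X \<rightarrow> T\<close>; then \<open>k'\<close> factors through \<open>u\<close>, and \<open>u[1] \<circ> w = 0\<close>.  For \<open>T = N\<close> the map \<open>k'\<close> first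
  lifts to \<open>B\<close> because \<open>Ext\<^sup>1(X, X) = 0\<close>.\<close>

lemma left_approximation_cone:
  assumes R: "maximal_rigid C R" and a: "left_approximation C R X B u"
    and X: "X \<in> obj C" "Hom_vanishes X (shift C X)"
  shows "\<exists>N v w. N \<in> R \<and> triangle X B N u v w"
proof -
  have r: "rigid C R" using R by (simp add: maximal_rigid_def)
  have B: "B \<in> R" "B \<in> obj C" and u: "u \<in> mor C X B" using a rigid_obj[OF r] by (auto simp: left_approximation_def)
  obtain N v w where t: "triangle X B N u v w" using cone_exists[OF X(1) B(2) u] .
  note N = triangleD(3)[OF t] and m = triangleD(5,6)[OF t]
  note uw = triangle_comp_zero''[OF t]
  have factor: "shift_mor C X T k = cmp C (shift C X) (shift C B) (shift C T) (shift_mor C B T s) (shift_mor C X B u)"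
    if "T \<in> obj C" "s \<in> mor C B T" "k = cmp C X B T s u" for T s k
    using that X B u by (simp add: shift_cmp)
  have NR: "Hom_vanishes N (shift C T)" if T: "T \<in> R" for T
    unfolding Hom_vanishes_def
  proof
    fix x assume x: "x \<in> mor C N (shift C T)"
    note To = rigid_obj[OF r T]
    have "cmp C B N (shift C T) x v = \<zero>\<^bsub>Hom C B (shift C T)\<^esub>"
      using x m N To B by (intro Hom_vanishesD[OF rigid_vanishes[OF r B(1) T]]) simp
    then obtain k where k: "k \<in> mor C (shift C X) (shift C T)" "x = cmp C N (shift C X) (shift C T) k w"
      by (rule weak_cokernel'[OF t shift_obj[OF To] x])
    obtain k' where k': "k' \<in> mor C X T" "k = shift_mor C X T k'" using shift_surject[OF X(1) To k(1)] .
    obtain s where s: "s \<in> mor C B T" "k' = cmp C X B T s u"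
      using a T k'(1) unfolding left_approximation_def by blast
    show "x = \<zero>\<^bsub>Hom C N (shift C T)\<^esub>"
      unfolding k(2) k'(2) factor[OF To s] using s(1) To B X u m N uw by (simp add: cmp_assoc)
  qed
  have RN: "Hom_vanishes T (shift C N)" if "T \<in> R" for T
    using Ext1_symmetric[OF N rigid_obj[OF r that] NR[OF that]] .
  have NN: "Hom_vanishes N (shift C N)"
    unfolding Hom_vanishes_def
  proof
    fix x assume x: "x \<in> mor C N (shift C N)"
    have "cmp C B N (shift C N) x v = \<zero>\<^bsub>Hom C B (shift C N)\<^esub>"
      using x m N B by (intro Hom_vanishesD[OF RN[OF B(1)]]) simp
    then obtain k where k: "k \<in> mor C (shift C X) (shift C N)" "x = cmp C N (shift C X) (shift C N) k w"
      by (rule weak_cokernel'[OF t shift_obj[OF N] x])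
    obtain k' where k': "k' \<in> mor C X N" "k = shift_mor C X N k'" using shift_surject[OF X(1) N k(1)] .
    have "cmp C X N (shift C X) w k' = \<zero>\<^bsub>Hom C X (shift C X)\<^esub>"
      using k'(1) m N X by (intro Hom_vanishesD[OF X(2)]) simp
    then obtain z where z: "z \<in> mor C X B" "k' = cmp C X B N v z" by (rule weak_kernel'[OF t X(1) k'(1)])
    obtain s where s: "s \<in> mor C B B" "z = cmp C X B B s u"
      using a B(1) z(1) unfolding left_approximation_def by blast
    have e: "k' = cmp C X B N (cmp C B B N v s) u" unfolding z(2) s(2) using s(1) m N B X u by (simp add: cmp_assoc)
    show "x = \<zero>\<^bsub>Hom C N (shift C N)\<^esub>"
      unfolding k(2) k'(2) using factor[OF N _ e] s(1) B X u m N uw by (simp add: cmp_assoc)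
  qed
  have "N \<in> R" using maximal_rigid_member[OF R N RN NN] .
  then show ?thesis using t by blast
qed

end

section \<open>Indices\<close>

interpretation rat_functions: vector_space "\<lambda>(c::rat) (f::'x \<Rightarrow> rat) x. c * f x"
  by unfold_locales (auto simp: fun_eq_iff algebra_simps)

lemma sum_fun_apply: "(\<Sum>v\<in>S. F v) x = (\<Sum>v\<in>S. F v x :: rat)"
  by (induction S rule: infinite_finite_induct) auto

text \<open>Indicator functions of disjoint nonempty sets are linearly independent.\<close>

lemma indicators_card_le:
  fixes A :: "'x set set"
  assumes disj: "\<And>c d. c \<in> A \<Longrightarrow> d \<in> A \<Longrightarrow> c \<noteq> d \<Longrightarrow> c \<inter> d = {}" and ne: "{} \<notin> A"
    and V: "finite V" and sp: "\<And>c. c \<in> A \<Longrightarrow> (\<lambda>x. if x \<in> c then 1 else 0) \<in> rat_functions.span V"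
  shows "finite A \<and> card A \<le> card V"
proof -
  define e :: "'x set \<Rightarrow> 'x \<Rightarrow> rat" where "e c x = (if x \<in> c then 1 else 0)" for c x
  have "rat_functions.independent (e ` A)"
    unfolding rat_functions.independent_explicit_finite_subsets
  proof (intro allI impI ballI)
    fix S u v assume S: "S \<subseteq> e ` A" "finite S" and z: "(\<Sum>v\<in>S. (\<lambda>x. u v * v x)) = 0" and v: "v \<in> S"
    obtain c where c: "c \<in> A" "v = e c" using S v by auto
    then obtain x where x: "x \<in> c" using ne by (metis ex_in_conv)
    have "u w * w x = (if w = v then u v else 0)" if w: "w \<in> S" for w
    proof -
      obtain d where d: "d \<in> A" "w = e d" using S w by auto
      show ?thesis
      proof (cases "c = d")
        case True
        then show ?thesis using c d x by (simp add: e_def)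
      next
        case False
        then have "x \<notin> d" using disj c(1) d(1) x by blast
        then have "w x = 0" "v x = 1" using c d x by (simp_all add: e_def)
        then show ?thesis by auto
      qed
    qed
    then have "(\<Sum>w\<in>S. u w * w x) = (\<Sum>w\<in>S. if w = v then u v else 0)" by (rule sum.cong[OF refl])
    also have "\<dots> = u v" using S v by simp
    finally show "u v = 0" using fun_cong[OF z, of x] by (simp add: sum_fun_apply)
  qed
  moreover have "e ` A \<subseteq> rat_functions.span V" using sp by (auto simp: e_def[abs_def])
  ultimately have "finite (e ` A) \<and> card (e ` A) \<le> card V"
    using rat_functions.independent_span_bound V by blast
  moreover have "inj_on e A"
  proof (rule inj_onI)
    fix c d assume cd: "c \<in> A" "d \<in> A" "e c = e d"
    show "c = d"
    proof (rule Set.set_eqI)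
      fix x show "x \<in> c \<longleftrightarrow> x \<in> d" using fun_cong[OF cd(3), of x] by (simp add: e_def split: if_splits)
    qed
  qed
  ultimately show ?thesis using card_image finite_imageD by metis
qed

lemma linear_map_surjective:
  assumes M: "module K M" and N: "module K N" and f: "linear_map K M N f"
    and S: "finite S" "S \<subseteq> f ` carrier M"
    and span: "\<And>x. x \<in> carrier N \<Longrightarrow> \<exists>c. c \<in> S \<rightarrow> carrier K \<and> x = (\<Oplus>\<^bsub>N\<^esub>s\<in>S. c s \<odot>\<^bsub>N\<^esub> s)"
    and x: "x \<in> carrier N"
  shows "\<exists>y\<in>carrier M. x = f y"
proof -
  interpret M: module K M by fact
  interpret N: module K N by fact
  have fs: "f (c \<odot>\<^bsub>M\<^esub> y) = c \<odot>\<^bsub>N\<^esub> f y" if "c \<in> carrier K" "y \<in> carrier M" for c y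
    using f that by (simp add: linear_map_def)
  have fc: "f y \<in> carrier N" if "y \<in> carrier M" for y using f that by (auto simp: linear_map_def)
  obtain c where c: "c \<in> S \<rightarrow> carrier K" "x = (\<Oplus>\<^bsub>N\<^esub>s\<in>S. c s \<odot>\<^bsub>N\<^esub> s)" using span[OF x] by blast
  have "\<forall>s\<in>S. \<exists>y. y \<in> carrier M \<and> f y = s" using S(2) by auto
  then obtain g where g: "\<And>s. s \<in> S \<Longrightarrow> g s \<in> carrier M \<and> f (g s) = s" by metis
  let ?y = "\<Oplus>\<^bsub>M\<^esub>s\<in>S. c s \<odot>\<^bsub>M\<^esub> g s"
  have mem: "(\<lambda>s. c s \<odot>\<^bsub>M\<^esub> g s) \<in> S \<rightarrow> carrier M" using c(1) g by auto
  have "f ?y = (\<Oplus>\<^bsub>N\<^esub>s\<in>S. f (c s \<odot>\<^bsub>M\<^esub> g s))" by (rule linear_map_finsum[OF M N f S(1) mem])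
  also have "\<dots> = (\<Oplus>\<^bsub>N\<^esub>s\<in>S. c s \<odot>\<^bsub>N\<^esub> s)"
  proof (rule N.finsum_cong')
    show "(\<lambda>s. c s \<odot>\<^bsub>N\<^esub> s) \<in> S \<rightarrow> carrier N" 
    proof
      fix s assume "s \<in> S"
      then have "c s \<in> carrier K" "s \<in> carrier N" using c(1) g[of s] fc[of "g s"] by auto
      then show "c s \<odot>\<^bsub>N\<^esub> s \<in> carrier N" by simp
    qed
    fix s assume s: "s \<in> S"
    then have "c s \<in> carrier K" using c(1) by auto
    then show "f (c s \<odot>\<^bsub>M\<^esub> g s) = c s \<odot>\<^bsub>N\<^esub> s" using fs[of "c s" "g s"] g[OF s] by simp
  qed simp
  finally show ?thesis using c(2) M.finsum_closed[OF mem] by (intro bexI[of _ ?y]) simp_all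
qed

locale two_Calabi_Yau_KRS_category = two_Calabi_Yau_category K C + krull_schmidt_category K C
  for K :: "'k ring" and C :: "('o, 'm, 'k, 'z) tri_cat_scheme" +
  assumes Hom_finite: "Hom_finite K C"
begin

text \<open>The class of an object of \<open>R[1]\<close> in the split Grothendieck group, as the function of the multiplicities
  of the objects \<open>I[1]\<close>.  The shift occurs because \<open>resolution_triangle\<close> decomposes shifted objects;
  with \<open>I\<close> as the argument, the class of \<open>X[1]\<close> is the indicator function of the class of \<open>X\<close>.\<close>

definition shift_class :: "'o \<Rightarrow> 'o \<Rightarrow> rat" where
  "shift_class Q I = (if I \<in> obj C \<and> local_End C I then of_nat (mult_of (shift C I) Q) else 0)"

lemma shift_class_direct_sum:
  "is_direct_sum C X [Y, Z] \<Longrightarrow> shift_class X = shift_class Y + shift_class Z"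
  using mult_of_direct_sum shift_local by (auto simp: shift_class_def fun_eq_iff)

lemma shift_class_shift:
  assumes X: "X \<in> obj C" "local_End C X"
  shows "shift_class (shift C X) = (\<lambda>I. if I \<in> iso_rel C `` {X} then 1 else 0)"
proof
  fix I
  show "shift_class (shift C X) I = (if I \<in> iso_rel C `` {X} then 1 else 0)"
  proof (cases "I \<in> obj C \<and> local_End C I")
    case True
    then have "mult_of (shift C I) (shift C X) = (if isomorphic C I X then 1 else 0)"
      using mult_of_local[of "shift C I" "shift C X"] shift_local X shift_isomorphic_iff by simp
    moreover have "isomorphic C I X \<longleftrightarrow> isomorphic C X I" using isomorphic_sym by blast
    ultimately show ?thesis using True by (simp add: shift_class_def iso_rel_def)
  next
    case False
    then have "\<not> isomorphic C X I" using local_iso[OF X(2)] by (auto simp: isomorphic_def)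
    then show ?thesis using False by (auto simp: shift_class_def iso_rel_def)
  qed
qed

text \<open>For a resolution \<open>B \<rightarrow> Y \<rightarrow> Q\<close> with \<open>Q \<cong> A[1]\<close> this is the index \<open>[B] - [A]\<close> of \<open>Y\<close>.\<close>

definition index :: "'o \<Rightarrow> 'o \<Rightarrow> 'o \<Rightarrow> rat" where
  "index B Q = shift_class (shift C B) - shift_class Q"

lemma index_direct_sum:
  assumes "is_direct_sum C B [B1, B2]" "is_direct_sum C Q [Q1, Q2]"
  shows "index B Q = index B1 Q1 + index B2 Q2"
proof -
  have "is_direct_sum C (shift C B) [shift C B1, shift C B2]" using shift_direct_sum[OF assms(1)] by simp
  then show ?thesis
    using shift_class_direct_sum assms(2) by (simp add: index_def)
qed

lemma index_triangle:
  assumes R: "rigid C R" and X: "X \<in> R" and t: "triangle X Y Z u v w"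
    and rY: "resolution R B Y Q" and rZ: "resolution R B' Z Q'"
  shows "shift_class (shift C X) = index B Q - index B' Q'"
proof -
  obtain E G where "is_direct_sum C E [shift C X, shift C B']"
    "is_direct_sum C G [Q', shift C B]" "is_direct_sum C G [Q, E]"
    using resolution_triangle[OF assms] .
  then have "shift_class Q' + shift_class (shift C B) = shift_class Q + (shift_class (shift C X) + shift_class (shift C B'))"
    using shift_class_direct_sum by metis
  then show ?thesis unfolding index_def by (simp add: algebra_simps)
qed

lemma indec_classes_eq:
  "T \<subseteq> obj C \<Longrightarrow> indec_classes C T = (\<lambda>X. iso_rel C `` {X}) ` {X \<in> T. local_End C X}"
  unfolding indec_classes_def quotient_def using indecomposable_iff by auto

text \<open>The indices of the indecomposables of \<open>T\<close> span a space \<open>span V\<close> that contains an index of every object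
  of \<open>T\<close>, by additivity along a decomposition.  A left \<open>T\<close>-approximation of an object \<open>X\<close> of \<open>R\<close> then
  shows that \<open>span V\<close> contains the class of \<open>X[1]\<close>.  For indecomposable \<open>X\<close> these classes are
  linearly independent.\<close>

lemma indec_classes_card_le:
  assumes R: "maximal_rigid C R" "contravariantly_finite C R"
    and T: "maximal_rigid C T" "covariantly_finite C T"
    and fin: "finite (indec_classes C T)"
  shows "finite (indec_classes C R) \<and> card (indec_classes C R) \<le> card (indec_classes C T)"
proof -
  have rR: "rigid C R" and rT: "rigid C T" using R T by (simp_all add: maximal_rigid_def)
  have oR: "R \<subseteq> obj C" and oT: "T \<subseteq> obj C" using rigid_obj rR rT by blast+
  have res: "\<exists>B Q. resolution R B X Q" if X: "X \<in> T" for X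
  proof -
    have Xo: "X \<in> obj C" using X oT by blast
    then obtain B f where "right_approximation C R B X f" using R(2) unfolding contravariantly_finite_def by blast
    then show ?thesis using right_approximation_resolution[OF R(1) _ Xo rigid_vanishes[OF rT X X]] by blast
  qed
  have "\<forall>c\<in>indec_classes C T. \<exists>X B Q. iso_rel C `` {X} = c \<and> X \<in> T \<and> resolution R B X Q"
    using res unfolding indec_classes_eq[OF oT] by blast
  then obtain t b q where tbq: "\<And>c. c \<in> indec_classes C T \<Longrightarrow>
      iso_rel C `` {t c} = c \<and> t c \<in> T \<and> resolution R (b c) (t c) (q c)"
    by metis
  define V where "V = (\<lambda>c. index (b c) (q c)) ` indec_classes C T"
  have sums: "\<exists>B Q. resolution R B X Q \<and> index B Q \<in> rat_functions.span V"
    if "is_direct_sum C X Ys" "\<forall>Y\<in>set Ys. Y \<in> T \<and> local_End C Y" for X Ys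
    using that
  proof (induction Ys arbitrary: X)
    case Nil
    then have X: "zero_object C X" by (simp add: zero_object_def)
    have "index X (shift C X) = 0" by (simp add: index_def)
    then have "index X (shift C X) \<in> rat_functions.span V" using rat_functions.span_zero by metis
    then show ?case using resolution_zero[OF rR X] by blast
  next
    case (Cons Y Ys)
    obtain Z where Z: "is_direct_sum C X [Y, Z]" "is_direct_sum C Z Ys" using direct_sum_Cons[OF Cons.prems(1)] .
    obtain B2 Q2 where r2: "resolution R B2 Z Q2" "index B2 Q2 \<in> rat_functions.span V"
      using Cons.IH[OF Z(2)] Cons.prems(2) by auto
    have Y: "Y \<in> T" "local_End C Y" using Cons.prems(2) by auto
    define c where "c = iso_rel C `` {Y}"
    have c: "c \<in> indec_classes C T" unfolding indec_classes_eq[OF oT] c_def using Y by blast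
    have "Y \<in> c" unfolding c_def iso_rel_def using isomorphic_refl oT Y(1) by blast
    then have "isomorphic C (t c) Y" using tbq[OF c] by (auto simp: iso_rel_def)
    then have r1: "resolution R (b c) Y (q c)" using tbq[OF c] resolution_isomorphic by blast
    obtain B Q where BQ: "resolution R B X Q" "is_direct_sum C B [b c, B2]" "is_direct_sum C Q [q c, Q2]"
      using resolution_direct_sum[OF rR r1 r2(1) Z(1)] .
    have "index (b c) (q c) \<in> rat_functions.span V" using c by (intro rat_functions.span_base) (auto simp: V_def)
    then have "index B Q \<in> rat_functions.span V"
      unfolding index_direct_sum[OF BQ(2,3)] using r2(2) by (rule rat_functions.span_add)
    then show ?case using BQ(1) by blast
  qed
  have spanT: "\<exists>B Q. resolution R B X Q \<and> index B Q \<in> rat_functions.span V" if X: "X \<in> T" for X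
  proof -
    have "X \<in> obj C" using X oT by blast
    then obtain Ys where Ys: "local_decomposition X Ys" by (rule local_decomposition_exists)
    then have s: "is_direct_sum C X Ys" "\<forall>Y\<in>set Ys. local_End C Y" by (simp_all add: local_decomposition_def)
    have "\<forall>Y\<in>set Ys. Y \<in> T" using rigid_retract[OF rT X] direct_sum_component[OF s(1)] by blast
    then show ?thesis using sums[OF s(1)] s(2) by blast
  qed
  have spanR: "shift_class (shift C X) \<in> rat_functions.span V" if X: "X \<in> R" for X
  proof -
    have Xo: "X \<in> obj C" using X oR by blast
    then obtain T0 u where "left_approximation C T X T0 u" using T(2) unfolding covariantly_finite_def by blast
    then obtain T1 v w where T1: "T1 \<in> T" and t: "triangle X T0 T1 u v w" and T0: "T0 \<in> T"
      using left_approximation_cone[OF T(1) _ Xo rigid_vanishes[OF rR X X]] unfolding left_approximation_def by blast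
    obtain B Q where r0: "resolution R B T0 Q" "index B Q \<in> rat_functions.span V" using spanT[OF T0] by blast
    obtain B' Q' where r1: "resolution R B' T1 Q'" "index B' Q' \<in> rat_functions.span V" using spanT[OF T1] by blast
    show ?thesis
      unfolding index_triangle[OF rR X t r0(1) r1(1)] using r0(2) r1(2) by (rule rat_functions.span_diff)
  qed
  have "finite V" using fin by (simp add: V_def)
  have quot: "indec_classes C R \<subseteq> obj C // iso_rel C" using oR by (auto simp: indec_classes_def quotient_def)
  have "finite (indec_classes C R) \<and> card (indec_classes C R) \<le> card V"
  proof (rule indicators_card_le[OF _ _ \<open>finite V\<close>])
    fix c d assume "c \<in> indec_classes C R" "d \<in> indec_classes C R" "c \<noteq> d"
    then show "c \<inter> d = {}" using quotient_disj[OF iso_rel_equiv] quot by blast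
  next
    show "{} \<notin> indec_classes C R" using in_quotient_imp_non_empty[OF iso_rel_equiv] quot by blast
  next
    fix c assume "c \<in> indec_classes C R"
    then obtain X where "X \<in> R" "local_End C X" "c = iso_rel C `` {X}" unfolding indec_classes_eq[OF oR] by blast
    then show "(\<lambda>x. if x \<in> c then 1 else 0) \<in> rat_functions.span V"
      using spanR[of X] shift_class_shift[of X] oR by auto
  qed
  moreover have "card V \<le> card (indec_classes C T)" unfolding V_def using fin by (rule card_image_le)
  ultimately show ?thesis by linarith
qed

section \<open>Maximal rigid objects\<close>

lemma add_subcat_iff:
  "X \<in> add_subcat C M \<longleftrightarrow> (\<exists>n Y. is_direct_sum C Y (replicate n M) \<and> retract X Y)"
  by (simp add: add_subcat_def retract_iff_direct_summand)

lemma power_exists: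
  assumes "M \<in> obj C" obtains Y where "is_direct_sum C Y (replicate n M)"
proof -
  have "set (replicate n M) \<subseteq> obj C" using assms by auto
  from finite_direct_sums[OF this] show thesis using that by blast
qed

lemma direct_sum_in_add_subcat: "is_direct_sum C Y (replicate n M) \<Longrightarrow> Y \<in> add_subcat C M"
  unfolding add_subcat_iff using isomorphic_retract isomorphic_refl direct_sum_obj(1) by blast

lemma add_subcat_obj: "X \<in> add_subcat C M \<Longrightarrow> X \<in> obj C"
  by (auto simp: add_subcat_iff retract_def)

text \<open>Decomposing \<open>id = p \<circ> i\<close> along \<open>Y\<close> gives a sum of endomorphisms of \<open>X\<close> that is a unit, so one summand
  is a unit.\<close>

lemma local_retract_component:
  assumes X: "local_End C X" and r: "retract X Y" and Y: "is_direct_sum C Y Ys"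
  obtains Z where "Z \<in> set Ys" "retract X Z"
proof -
  obtain i p where o: "X \<in> obj C" "Y \<in> obj C" and m: "i \<in> mor C X Y" "p \<in> mor C Y X"
    and c: "cmp C X Y X p i = ident C X"
    using r by (auto simp: retract_def)
  obtain \<iota> \<pi> where ds: "dsum Y Ys \<iota> \<pi>" using Y by (rule is_direct_sum_dsum)
  note oj = dsum_obj(2)[OF ds] and mj = dsum_mor[OF ds]
  interpret E: local_ring "End_ring X" using local_End_ring o X by simp
  let ?f = "\<lambda>j. cmp C X (Ys ! j) X (cmp C (Ys ! j) Y X p (\<iota> j)) (cmp C X Y (Ys ! j) (\<pi> j) i)"
  have "ident C X = cmp C X Y X p (\<Oplus>\<^bsub>Hom C X Y\<^esub>j\<in>{..<length Ys}. cmp C X (Ys ! j) Y (\<iota> j) (cmp C X Y (Ys ! j) (\<pi> j) i))"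
    using dsum_expand_left[OF ds o(1) m(1)] c by simp
  also have "\<dots> = (\<Oplus>\<^bsub>Hom C X X\<^esub>j\<in>{..<length Ys}. cmp C X Y X p (cmp C X (Ys ! j) Y (\<iota> j) (cmp C X Y (Ys ! j) (\<pi> j) i)))"
    using o m by (intro cmp_sum_right) (simp_all add: oj mj)
  also have "\<dots> = (\<Oplus>\<^bsub>Hom C X X\<^esub>j\<in>{..<length Ys}. ?f j)"
    using o m by (intro sum_mor_cong) (simp_all add: oj mj cmp_assoc)
  finally have "(\<Oplus>\<^bsub>End_ring X\<^esub>j\<in>{..<length Ys}. ?f j) \<in> Units (End_ring X)"
    using E.Units_one_closed by simp
  moreover have "?f j \<in> carrier (End_ring X)" if "j \<in> {..<length Ys}" for j
    using that o m by (simp add: oj mj)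
  ultimately obtain j where j: "j < length Ys" "?f j \<in> Units (End_ring X)"
    using E.finsum_nonunit[of "{..<length Ys}" ?f] by auto
  have "retract X (Ys ! j)"
    using j(2) o m unfolding Units_End_ring by (intro retract_of_unit[of X "Ys ! j"]) (simp_all add: oj[OF j(1)] mj[OF j(1)])
  then show thesis by (rule that[OF nth_mem[OF j(1)]])
qed

lemma local_add_subcat:
  assumes "local_End C X" "M \<in> obj C"
  shows "X \<in> add_subcat C M \<longleftrightarrow> retract X M"
proof
  assume "X \<in> add_subcat C M"
  then obtain n Y where "is_direct_sum C Y (replicate n M)" "retract X Y" by (auto simp: add_subcat_iff)
  then show "retract X M" using local_retract_component[OF assms(1)] by (metis in_set_replicate)
next
  assume "retract X M"
  moreover have "is_direct_sum C M (replicate 1 M)" using direct_sum_singleton assms(2) by simp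
  ultimately show "X \<in> add_subcat C M" unfolding add_subcat_iff by blast
qed

lemma num_indec_summands_eq:
  assumes "M \<in> obj C"
  shows "num_indec_summands C M = card (indec_classes C (add_subcat C M))"
proof -
  have "{X \<in> {X. direct_summand C X M}. indecomposable C X} = {X \<in> add_subcat C M. indecomposable C X}"
    using local_add_subcat[OF _ assms] indecomposable_iff retract_iff_direct_summand by auto
  then show ?thesis by (simp add: num_indec_summands_def indec_classes_def)
qed

lemma finite_indec_classes_add_subcat:
  assumes M: "M \<in> obj C"
  shows "finite (indec_classes C (add_subcat C M))"
proof -
  obtain Ys where Ys: "local_decomposition M Ys" using M by (rule local_decomposition_exists)
  then have s: "is_direct_sum C M Ys" "\<forall>Y\<in>set Ys. local_End C Y" by (simp_all add: local_decomposition_def)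
  have "iso_rel C `` {X} \<in> (\<lambda>Y. iso_rel C `` {Y}) ` set Ys"
    if X: "X \<in> add_subcat C M" "local_End C X" for X
  proof -
    have "retract X M" using X local_add_subcat M by blast
    then obtain Y where Y: "Y \<in> set Ys" "retract X Y" by (rule local_retract_component[OF X(2) _ s(1)])
    then have "isomorphic C X Y" using retract_of_local s(2) local_nonzero X(2) by blast
    then have "iso_rel C `` {X} = iso_rel C `` {Y}"
      by (intro equiv_class_eq[OF iso_rel_equiv]) (simp add: iso_rel_def)
    then show ?thesis using Y(1) by simp
  qed
  then have "indec_classes C (add_subcat C M) \<subseteq> (\<lambda>Y. iso_rel C `` {Y}) ` set Ys"
    using indec_classes_eq[of "add_subcat C M", OF subsetI] add_subcat_obj by (metis (no_types, lifting) image_subsetI mem_Collect_eq)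
  then show ?thesis by (rule finite_subset) simp
qed

definition Hom_spanned :: "'o \<Rightarrow> 'o \<Rightarrow> 'm list \<Rightarrow> bool" where
  "Hom_spanned X Y xs \<longleftrightarrow> set xs \<subseteq> mor C X Y \<and> (\<forall>x\<in>mor C X Y. \<exists>c. c \<in> set xs \<rightarrow> carrier K \<and>
     x = (\<Oplus>\<^bsub>Hom C X Y\<^esub>s\<in>set xs. c s \<odot>\<^bsub>Hom C X Y\<^esub> s))"

lemma Hom_spanned_exists:
  assumes "X \<in> obj C" "Y \<in> obj C" obtains xs where "Hom_spanned X Y xs"
proof -
  have "finite_dim K (Hom C X Y)" using Hom_finite assms by (simp add: Hom_finite_def)
  then obtain S where "finite S" and S: "S \<subseteq> carrier (Hom C X Y) \<and> (\<forall>x\<in>carrier (Hom C X Y). \<exists>c. c \<in> S \<rightarrow> carrier K \<and>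
     x = (\<Oplus>\<^bsub>Hom C X Y\<^esub>s\<in>S. c s \<odot>\<^bsub>Hom C X Y\<^esub> s))"
    unfolding finite_dim_def by (elim exE conjE) (rule that, assumption, intro conjI)
  obtain xs where "set xs = S" using \<open>finite S\<close> finite_list by blast
  then have "Hom_spanned X Y xs" unfolding Hom_spanned_def mor_def using S by (elim ssubst)
  then show thesis by (rule that)
qed

text \<open>The elements of a finite spanning family of \<open>Hom(M, X)\<close> are the components of a map \<open>f : M\<^sup>n \<rightarrow> X\<close>.  The
  image of composition with \<open>f\<close> is a subspace containing the family, so every map \<open>M \<rightarrow> X\<close> factors
  through \<open>f\<close>; hence so do maps from powers of \<open>M\<close> and their retracts.\<close>

lemma add_subcat_contravariantly_finite:
  assumes M: "M \<in> obj C"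
  shows "contravariantly_finite C (add_subcat C M)"
  unfolding contravariantly_finite_def
proof
  fix X assume X: "X \<in> obj C"
  obtain xs where span: "Hom_spanned M X xs" using Hom_spanned_exists[OF M X] .
  let ?n = "length xs"
  obtain B where B: "is_direct_sum C B (replicate ?n M)" using power_exists[OF M] .
  obtain \<iota> \<pi> where ds: "dsum B (replicate ?n M) \<iota> \<pi>" using B by (rule is_direct_sum_dsum)
  have Bo: "B \<in> obj C" using direct_sum_obj(1)[OF B] .
  have "xs ! j \<in> mor C (replicate ?n M ! j) X" if "j < length (replicate ?n M)" for j
    using that span nth_mem[of j xs] by (auto simp: Hom_spanned_def)
  then obtain f where f: "f \<in> mor C B X" "\<And>j. j < length (replicate ?n M) \<Longrightarrow> cmp C (replicate ?n M ! j) B X f (\<iota> j) = xs ! j"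
    using dsum_cofactor[OF ds X, of "\<lambda>j. xs ! j"] by blast
  have surj: "\<exists>y\<in>mor C M B. x = cmp C M B X f y" if x: "x \<in> mor C M X" for x
    unfolding mor_def
  proof (rule linear_map_surjective[OF Hom_module[OF M Bo] Hom_module[OF M X] cmp_linear_right[OF M Bo X f(1)], of "set xs"])
    show "set xs \<subseteq> cmp C M B X f ` carrier (Hom C M B)"
    proof
      fix s assume "s \<in> set xs"
      then obtain j where j: "j < ?n" "s = xs ! j" by (auto simp: in_set_conv_nth)
      then have "\<iota> j \<in> mor C M B" "s = cmp C M B X f (\<iota> j)" using dsum_mor(1)[OF ds, of j] f(2)[of j] by simp_all
      then show "s \<in> cmp C M B X f ` carrier (Hom C M B)" by (auto simp: mor_def)
    qed
  next
    show "\<exists>c. c \<in> set xs \<rightarrow> carrier K \<and> x' = (\<Oplus>\<^bsub>Hom C M X\<^esub>s\<in>set xs. c s \<odot>\<^bsub>Hom C M X\<^esub> s)"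
      if "x' \<in> carrier (Hom C M X)" for x'
      using span that unfolding Hom_spanned_def mor_def by blast
    show "x \<in> carrier (Hom C M X)" using x by (simp add: mor_def)
  qed simp
  have "right_approximation C (add_subcat C M) B X f"
    unfolding right_approximation_def
  proof (intro conjI ballI)
    show "B \<in> add_subcat C M" using direct_sum_in_add_subcat[OF B] .
    show "f \<in> mor C B X" by (rule f(1))
    fix A g assume A: "A \<in> add_subcat C M" and g: "g \<in> mor C A X"
    obtain k Y where Y: "is_direct_sum C Y (replicate k M)" and AY: "retract A Y" using A by (auto simp: add_subcat_iff)
    obtain i p where o: "A \<in> obj C" "Y \<in> obj C" and m: "i \<in> mor C A Y" "p \<in> mor C Y A" and c: "cmp C A Y A p i = ident C A"
      using AY by (auto simp: retract_def)
    obtain \<iota>' \<pi>' where ds': "dsum Y (replicate k M) \<iota>' \<pi>'" using Y by (rule is_direct_sum_dsum)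
    have \<iota>': "\<iota>' l \<in> mor C M Y" if "l < k" for l using dsum_mor(1)[OF ds', of l] that by simp
    have "\<exists>y. y \<in> mor C M B \<and> cmp C M Y X (cmp C Y A X g p) (\<iota>' l) = cmp C M B X f y" if "l < k" for l
    proof -
      have "cmp C M Y X (cmp C Y A X g p) (\<iota>' l) \<in> mor C M X" using \<iota>'[OF that] o m g M X by simp
      then show ?thesis using surj by blast
    qed
    then obtain y where y: "\<And>l. l < k \<Longrightarrow> y l \<in> mor C M B" "\<And>l. l < k \<Longrightarrow> cmp C M Y X (cmp C Y A X g p) (\<iota>' l) = cmp C M B X f (y l)"
      by metis
    obtain h where h: "h \<in> mor C Y B" "\<And>l. l < k \<Longrightarrow> cmp C M Y B h (\<iota>' l) = y l"
      using dsum_cofactor[OF ds' Bo, of y] y(1) by auto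
    have gp: "cmp C Y A X g p = cmp C Y B X f h"
    proof (rule dsum_epic[OF ds' X])
      fix l assume "l < length (replicate k M)"
      then have l: "l < k" by simp
      show "cmp C (replicate k M ! l) Y X (cmp C Y A X g p) (\<iota>' l) = cmp C (replicate k M ! l) Y X (cmp C Y B X f h) (\<iota>' l)"
        using y[OF l] h(2)[OF l] h(1) f(1) \<iota>'[OF l] M X Bo o l by (simp add: cmp_assoc[of M Y B X])
    qed (use o m g h f X Bo in simp_all)
    have "g = cmp C A Y X (cmp C Y A X g p) i" using o m g X c by (simp add: cmp_assoc)
    also have "\<dots> = cmp C A B X f (cmp C A Y B h i)" unfolding gp using o m h(1) f(1) X Bo by (simp add: cmp_assoc)
    finally show "\<exists>h\<in>mor C A B. g = cmp C A B X f h" using o m h(1) Bo by (intro bexI[of _ "cmp C A Y B h i"]) simp_all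
  qed
  then show "\<exists>T0 f. right_approximation C (add_subcat C M) T0 X f" by blast
qed

lemma add_subcat_covariantly_finite:
  assumes M: "M \<in> obj C"
  shows "covariantly_finite C (add_subcat C M)"
  unfolding covariantly_finite_def
proof
  fix X assume X: "X \<in> obj C"
  obtain xs where span: "Hom_spanned X M xs" using Hom_spanned_exists[OF X M] .
  let ?n = "length xs"
  obtain B where B: "is_direct_sum C B (replicate ?n M)" using power_exists[OF M] .
  obtain \<iota> \<pi> where ds: "dsum B (replicate ?n M) \<iota> \<pi>" using B by (rule is_direct_sum_dsum)
  have Bo: "B \<in> obj C" using direct_sum_obj(1)[OF B] .
  have "xs ! j \<in> mor C X (replicate ?n M ! j)" if "j < length (replicate ?n M)" for j
    using that span nth_mem[of j xs] by (auto simp: Hom_spanned_def)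
  then obtain f where f: "f \<in> mor C X B" "\<And>j. j < length (replicate ?n M) \<Longrightarrow> cmp C X B (replicate ?n M ! j) (\<pi> j) f = xs ! j"
    using dsum_factor[OF ds X, of "\<lambda>j. xs ! j"] by blast
  have surj: "\<exists>y\<in>mor C B M. x = cmp C X B M y f" if x: "x \<in> mor C X M" for x
    unfolding mor_def
  proof (rule linear_map_surjective[OF Hom_module[OF Bo M] Hom_module[OF X M] cmp_linear_left[OF X Bo M f(1)], of "set xs"])
    show "set xs \<subseteq> (\<lambda>y. cmp C X B M y f) ` carrier (Hom C B M)"
    proof
      fix s assume "s \<in> set xs"
      then obtain j where j: "j < ?n" "s = xs ! j" by (auto simp: in_set_conv_nth)
      then have "\<pi> j \<in> mor C B M" "s = cmp C X B M (\<pi> j) f" using dsum_mor(2)[OF ds, of j] f(2)[of j] by simp_all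
      then show "s \<in> (\<lambda>y. cmp C X B M y f) ` carrier (Hom C B M)" by (auto simp: mor_def)
    qed
  next
    show "\<exists>c. c \<in> set xs \<rightarrow> carrier K \<and> x' = (\<Oplus>\<^bsub>Hom C X M\<^esub>s\<in>set xs. c s \<odot>\<^bsub>Hom C X M\<^esub> s)"
      if "x' \<in> carrier (Hom C X M)" for x'
      using span that unfolding Hom_spanned_def mor_def by blast
    show "x \<in> carrier (Hom C X M)" using x by (simp add: mor_def)
  qed simp
  have "left_approximation C (add_subcat C M) X B f"
    unfolding left_approximation_def
  proof (intro conjI ballI)
    show "B \<in> add_subcat C M" using direct_sum_in_add_subcat[OF B] .
    show "f \<in> mor C X B" by (rule f(1))
    fix A g assume A: "A \<in> add_subcat C M" and g: "g \<in> mor C X A"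
    obtain k Y where Y: "is_direct_sum C Y (replicate k M)" and AY: "retract A Y" using A by (auto simp: add_subcat_iff)
    obtain i p where o: "A \<in> obj C" "Y \<in> obj C" and m: "i \<in> mor C A Y" "p \<in> mor C Y A" and c: "cmp C A Y A p i = ident C A"
      using AY by (auto simp: retract_def)
    obtain \<iota>' \<pi>' where ds': "dsum Y (replicate k M) \<iota>' \<pi>'" using Y by (rule is_direct_sum_dsum)
    have \<pi>': "\<pi>' l \<in> mor C Y M" if "l < k" for l using dsum_mor(2)[OF ds', of l] that by simp
    have "\<exists>y. y \<in> mor C B M \<and> cmp C X Y M (\<pi>' l) (cmp C X A Y i g) = cmp C X B M y f" if "l < k" for l
    proof -
      have "cmp C X Y M (\<pi>' l) (cmp C X A Y i g) \<in> mor C X M" using \<pi>'[OF that] o m g M X by simp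
      then show ?thesis using surj by blast
    qed
    then obtain y where y: "\<And>l. l < k \<Longrightarrow> y l \<in> mor C B M" "\<And>l. l < k \<Longrightarrow> cmp C X Y M (\<pi>' l) (cmp C X A Y i g) = cmp C X B M (y l) f"
      by metis
    obtain h where h: "h \<in> mor C B Y" "\<And>l. l < k \<Longrightarrow> cmp C B Y M (\<pi>' l) h = y l"
      using dsum_factor[OF ds' Bo, of y] y(1) by auto
    have ig: "cmp C X A Y i g = cmp C X B Y h f"
    proof (rule dsum_monic[OF ds' X])
      fix l assume "l < length (replicate k M)"
      then have l: "l < k" by simp
      show "cmp C X Y (replicate k M ! l) (\<pi>' l) (cmp C X A Y i g) = cmp C X Y (replicate k M ! l) (\<pi>' l) (cmp C X B Y h f)"
        using y[OF l] h(1) f(1) \<pi>'[OF l] M X Bo o l by (simp add: cmp_reassoc[OF h(2)[OF l]])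
    qed (use o m g h f X Bo in simp_all)
    have "g = cmp C X Y A p (cmp C X A Y i g)" using o m g X by (simp add: cmp_reassoc[OF c])
    also have "\<dots> = cmp C X B A (cmp C B Y A p h) f" unfolding ig using o m h(1) f(1) X Bo by (simp add: cmp_assoc)
    finally show "\<exists>h\<in>mor C B A. g = cmp C X B A h f" using o m h(1) Bo by (intro bexI[of _ "cmp C B Y A p h"]) simp_all
  qed
  then show "\<exists>T0 f. left_approximation C (add_subcat C M) X T0 f" by blast
qed

lemma maximal_rigid_object_card_le:
  assumes M: "maximal_rigid_object C M" and R: "maximal_rigid C R" "contravariantly_finite C R"
  shows "finite (indec_classes C R) \<and> card (indec_classes C R) \<le> num_indec_summands C M"
  using M indec_classes_card_le[OF R _ add_subcat_covariantly_finite finite_indec_classes_add_subcat, of M]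
    num_indec_summands_eq[of M] by (simp add: maximal_rigid_object_def)

text \<open>Take the direct sum \<open>M\<close> of representatives of the indecomposables of \<open>R\<close>.  An object of \<open>R\<close> with \<open>n\<close>
  indecomposable summands is a retract of \<open>M\<^sup>n\<close>.\<close>

lemma maximal_rigid_object_exists:
  assumes R: "maximal_rigid C R" and fin: "finite (indec_classes C R)"
  shows "\<exists>M. maximal_rigid_object C M"
proof -
  have rR: "rigid C R" using R by (simp add: maximal_rigid_def)
  have oR: "R \<subseteq> obj C" using rigid_obj[OF rR] by blast
  have "\<forall>c\<in>indec_classes C R. \<exists>X. X \<in> R \<and> iso_rel C `` {X} = c" unfolding indec_classes_eq[OF oR] by blast
  then obtain t where t: "\<And>c. c \<in> indec_classes C R \<Longrightarrow> t c \<in> R \<and> iso_rel C `` {t c} = c" by metis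
  obtain Ms where Ms: "set Ms = t ` indec_classes C R" using finite_list[OF finite_imageI[OF fin, of t]] by blast
  have MsR: "set Ms \<subseteq> R" unfolding Ms using t by blast
  then have "set Ms \<subseteq> obj C" using oR by blast
  from finite_direct_sums[OF this] obtain M where M: "is_direct_sum C M Ms" by blast
  have Mo: "M \<in> obj C" using direct_sum_obj(1)[OF M] .
  have MR: "M \<in> R" using rigid_direct_sum[OF rR MsR M] .
  have "add_subcat C M = R"
  proof
    show "add_subcat C M \<subseteq> R"
    proof
      fix X assume "X \<in> add_subcat C M"
      then obtain n Y where Y: "is_direct_sum C Y (replicate n M)" "retract X Y" by (auto simp: add_subcat_iff)
      have "set (replicate n M) \<subseteq> R" using MR by auto
      then have "Y \<in> R" using rigid_direct_sum[OF rR] Y(1) by blast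
      then show "X \<in> R" using rigid_retract[OF rR] Y(2) by blast
    qed
    show "R \<subseteq> add_subcat C M"
    proof
      fix X assume X: "X \<in> R"
      then have "X \<in> obj C" using oR by blast
      then obtain Ys where Ys: "local_decomposition X Ys" by (rule local_decomposition_exists)
      then have s: "is_direct_sum C X Ys" "\<forall>Y\<in>set Ys. local_End C Y" by (simp_all add: local_decomposition_def)
      have YM: "retract Y M" if Y: "Y \<in> set Ys" for Y
      proof -
        have YR: "Y \<in> R" using rigid_retract[OF rR X] direct_sum_component[OF s(1) Y] by blast
        define c where "c = iso_rel C `` {Y}"
        have c: "c \<in> indec_classes C R" unfolding indec_classes_eq[OF oR] c_def using YR s(2) Y by blast
        have "Y \<in> c" unfolding c_def iso_rel_def using isomorphic_refl oR YR by blast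
        then have "isomorphic C (t c) Y" using t[OF c] by (auto simp: iso_rel_def)
        then have "retract Y (t c)" using isomorphic_sym isomorphic_retract by blast
        moreover have "retract (t c) M" using direct_sum_component[OF M] Ms c by blast
        ultimately show ?thesis by (rule retract_trans)
      qed
      obtain Z where Z: "is_direct_sum C Z (replicate (length Ys) M)"
        using power_exists[OF Mo] .
      have "retract X Z"
        by (rule direct_sum_retract[OF s(1) Z]) (use YM in simp_all)
      then show "X \<in> add_subcat C M" unfolding add_subcat_iff using Z by blast
    qed
  qed
  then have "maximal_rigid_object C M" using R Mo by (simp add: maximal_rigid_object_def)
  then show ?thesis by blast
qed

end

theorem corollary3p7:
  fixes K :: "'k ring" and C :: "('o, 'm, 'k) tri_cat"
  assumes "algebraically_closed K"
    and "triangulated_category K C"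
    and "Hom_finite K C"
    and "Krull_Remak_Schmidt C"
    and "two_Calabi_Yau K C"
    and "\<exists>T. functorially_finite C T \<and> maximal_rigid C T"
  shows "((\<exists>T. maximal_rigid_object C T) \<longleftrightarrow>
           (\<forall>T. functorially_finite C T \<and> maximal_rigid C T \<longrightarrow> finite (indec_classes C T)))
       \<and> (\<forall>T T'. maximal_rigid_object C T \<and> maximal_rigid_object C T' \<longrightarrow>
           num_indec_summands C T = num_indec_summands C T')"
proof -
  interpret triangulated_category K C by fact
  interpret two_Calabi_Yau_KRS_category K C
    by unfold_locales (use assms in simp_all)
  have le: "num_indec_summands C T' \<le> num_indec_summands C T"
    if "maximal_rigid_object C T" "maximal_rigid_object C T'" for T T'
    using maximal_rigid_object_card_le[OF that(1), of "add_subcat C T'"] that(2)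
      add_subcat_contravariantly_finite num_indec_summands_eq
    by (simp add: maximal_rigid_object_def)
  show ?thesis
  proof (intro conjI iffI allI impI)
    fix T assume ex: "\<exists>T. maximal_rigid_object C T" and T: "functorially_finite C T \<and> maximal_rigid C T"
    from ex obtain M where "maximal_rigid_object C M" by blast
    then show "finite (indec_classes C T)"
      using maximal_rigid_object_card_le[of M T] T by (simp add: functorially_finite_def)
  next
    assume "\<forall>T. functorially_finite C T \<and> maximal_rigid C T \<longrightarrow> finite (indec_classes C T)"
    moreover obtain T where "functorially_finite C T" "maximal_rigid C T" using assms(6) by blast
    ultimately show "\<exists>T. maximal_rigid_object C T" using maximal_rigid_object_exists[of T] by blast
  next
    fix T T' assume "maximal_rigid_object C T \<and> maximal_rigid_object C T'"
    then show "num_indec_summands C T = num_indec_summands C T'" using le[of T T'] le[of T' T] by simp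
  qed
qed

end
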